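(* The problem 3-Veto Conformant Bribery is $\mathrm{NP}$-complete (under polynomial-time many-one reductions).
   Context: An election $(C,V)$ consists of a finite set of candidates $C$ and a finite collection (multiset, listed explicitly) of voters $V$; each voter has a vote, which is a strict total order over $C$. 3-Veto: in an election with $m$ candidates, a candidate receives $-1$ point from each vote in which it is ranked among the bottom 3 positions and 0 points from every other vote (scoring vector $\langle 0,\dots,0,-1,-1,-1\rangle$). The winners are all candidates with the highest total score (several winners are allowed). 3-Veto Conformant Bribery. Given: an election $(C,V)$, a bribe limit $k\ge 0$, and a preferred candidate $p\in C$. Question: does there exist a way to set the votes of a subcollection of at most $k$ voters in $V$ to votes that occur in (the original) $V$ such that $p$ is a 3-veto winner of the resulting election? *)

theory Defs
  imports
    "HOL-Computational_Algebra.Polynomial"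
    "HOL-Combinatorics.Multiset_Permutations"
begin

section \<open>Turing machines\<close>

text \<open>
  Deterministic multitape Turing machines with two-way infinite tapes. Tape symbols are the
  numbers below \<open>alphabet_size M\<close>, with \<open>0\<close> the blank. The non-halting states are the numbers
  below \<open>num_states M\<close>, computations start in state \<open>0\<close>, and the number \<open>num_states M\<close> itself
  is the unique halting state.
\<close>

datatype move = MoveLeft | Stay | MoveRight

fun offset :: "move \<Rightarrow> int" where
  "offset MoveLeft = -1"
| "offset Stay = 0"
| "offset MoveRight = 1"

record tm =
  num_tapes :: nat
  alphabet_size :: nat
  num_states :: nat
  transition :: "nat \<Rightarrow> nat list \<Rightarrow> nat \<times> (nat \<times> move) list"

text \<open>
  The transition function only matters on the finitely many arguments constrained here.
  Symbols \<open>1\<close> and \<open>2\<close> stand for the two bits, and \<open>3\<close> separates the components of a pair.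
\<close>

definition turing_machine :: "tm \<Rightarrow> bool" where
  "turing_machine M \<longleftrightarrow>
     num_tapes M \<ge> 1 \<and> alphabet_size M \<ge> 4 \<and>
     (\<forall>q < num_states M. \<forall>rs. length rs = num_tapes M \<and> set rs \<subseteq> {..<alphabet_size M} \<longrightarrow>
        (case transition M q rs of (q', as) \<Rightarrow>
           q' \<le> num_states M \<and> length as = num_tapes M \<and>
           (\<forall>(a, d) \<in> set as. a < alphabet_size M)))"

text \<open>A tape consists of its contents and its head position.\<close>

type_synonym tape = "(int \<Rightarrow> nat) \<times> int"
type_synonym config = "nat \<times> tape list"

fun read_tape :: "tape \<Rightarrow> nat" where
  "read_tape (f, h) = f h"

fun act :: "nat \<times> move \<Rightarrow> tape \<Rightarrow> tape" where
  "act (a, d) (f, h) = (f(h := a), h + offset d)"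

fun step :: "tm \<Rightarrow> config \<Rightarrow> config" where
  "step M (q, ts) =
     (if q < num_states M
      then (case transition M q (map read_tape ts) of (q', as) \<Rightarrow> (q', map2 act as ts))
      else (q, ts))"

definition contents :: "nat list \<Rightarrow> int \<Rightarrow> nat" where
  "contents w i = (if 0 \<le> i \<and> i < int (length w) then w ! nat i else 0)"

definition initial :: "tm \<Rightarrow> nat list \<Rightarrow> config" where
  "initial M w = (0, (contents w, 0) # replicate (num_tapes M - 1) (contents [], 0))"

text \<open>
  The input is on the first tape, the output on the last. Since halting configurations are
  fixed points of \<open>step\<close>, this says that \<open>M\<close> halts after at most \<open>t\<close> steps with output \<open>v\<close>.
\<close>

definition outputs_within :: "tm \<Rightarrow> nat list \<Rightarrow> nat \<Rightarrow> nat list \<Rightarrow> bool" where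
  "outputs_within M w t v \<longleftrightarrow>
     (case (step M ^^ t) (initial M w) of (q, ts) \<Rightarrow>
        q = num_states M \<and> fst (last ts) = contents v)"


section \<open>Polynomial time and NP-completeness\<close>

text \<open>Decision problems are languages of bit strings.\<close>

type_synonym language = "bool list set"

definition symbols :: "bool list \<Rightarrow> nat list" where
  "symbols = map (\<lambda>b. if b then 2 else 1)"

definition pair_symbols :: "bool list \<Rightarrow> bool list \<Rightarrow> nat list" where
  "pair_symbols x u = symbols x @ [3] @ symbols u"

definition polytime_function :: "(bool list \<Rightarrow> bool list) \<Rightarrow> bool" where
  "polytime_function f \<longleftrightarrow>
     (\<exists>M (p :: nat poly). turing_machine M \<and>
        (\<forall>x. outputs_within M (symbols x) (poly p (length x)) (symbols (f x))))"

definition polytime_relation :: "(bool list \<Rightarrow> bool list \<Rightarrow> bool) \<Rightarrow> bool" where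
  "polytime_relation R \<longleftrightarrow>
     (\<exists>M (p :: nat poly). turing_machine M \<and>
        (\<forall>x u. outputs_within M (pair_symbols x u) (poly p (length x + length u))
                 (symbols [R x u])))"

text \<open>NP by polynomial-time verifiers for certificates of polynomial length.\<close>

definition NP :: "language set" where
  "NP = {L. \<exists>R (q :: nat poly). polytime_relation R \<and>
              (\<forall>x. x \<in> L \<longleftrightarrow> (\<exists>u. length u \<le> poly q (length x) \<and> R x u))}"

definition polytime_reducible :: "language \<Rightarrow> language \<Rightarrow> bool" where
  "polytime_reducible A B \<longleftrightarrow> (\<exists>f. polytime_function f \<and> (\<forall>x. x \<in> A \<longleftrightarrow> f x \<in> B))"

definition NP_hard :: "language \<Rightarrow> bool" where
  "NP_hard B \<longleftrightarrow> (\<forall>A \<in> NP. polytime_reducible A B)"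

definition NP_complete :: "language \<Rightarrow> bool" where
  "NP_complete B \<longleftrightarrow> B \<in> NP \<and> NP_hard B"


section \<open>Elections and conformant bribery\<close>

text \<open>
  A vote is a strict total order on the candidates, given as the list of all candidates from
  most to least preferred. The voters are the positions of the list \<open>V\<close>.
\<close>

type_synonym 'a vote = "'a list"

definition election :: "'a set \<Rightarrow> 'a vote list \<Rightarrow> bool" where
  "election C V \<longleftrightarrow> finite C \<and> set V \<subseteq> permutations_of_set C"

text \<open>With fewer than three candidates, all candidates are among the bottom three.\<close>

definition bottom3 :: "'a vote \<Rightarrow> 'a set" where
  "bottom3 v = set (drop (length v - 3) v)"

definition veto3_score :: "'a vote list \<Rightarrow> 'a \<Rightarrow> int" where
  "veto3_score V c = (\<Sum>v\<leftarrow>V. if c \<in> bottom3 v then -1 else 0)"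

definition veto3_winners :: "'a set \<Rightarrow> 'a vote list \<Rightarrow> 'a set" where
  "veto3_winners C V = {c \<in> C. \<forall>d \<in> C. veto3_score V d \<le> veto3_score V c}"

text \<open>\<open>V'\<close> results from bribing the voters in \<open>S\<close>.\<close>

definition conformant_bribery :: "'a vote list \<Rightarrow> nat set \<Rightarrow> 'a vote list \<Rightarrow> bool" where
  "conformant_bribery V S V' \<longleftrightarrow>
     S \<subseteq> {..<length V} \<and> length V' = length V \<and>
     (\<forall>i < length V. if i \<in> S then V' ! i \<in> set V else V' ! i = V ! i)"

definition veto3_conformant_bribable :: "'a set \<Rightarrow> 'a vote list \<Rightarrow> nat \<Rightarrow> 'a \<Rightarrow> bool" where
  "veto3_conformant_bribable C V k p \<longleftrightarrow>
     (\<exists>S V'. card S \<le> k \<and> conformant_bribery V S V' \<and> p \<in> veto3_winners C V')"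


section \<open>The decision problem\<close>

text \<open>
  Candidates are named by natural numbers. Numbers are written in binary, least significant
  bit first, and lists are written explicitly; each item of a list is preceded by \<open>True\<close> and
  the end of the list is marked by \<open>False\<close>.
\<close>

fun binary :: "nat \<Rightarrow> bool list" where
  "binary n = (if n = 0 then [] else odd n # binary (n div 2))"

declare binary.simps [simp del]

definition encode_list :: "('a \<Rightarrow> bool list) \<Rightarrow> 'a list \<Rightarrow> bool list" where
  "encode_list e xs = concat (map (\<lambda>x. True # e x) xs) @ [False]"

definition encode_nat :: "nat \<Rightarrow> bool list" where
  "encode_nat n = encode_list (\<lambda>b. [b]) (binary n)"

definition encode_instance :: "nat list \<Rightarrow> nat vote list \<Rightarrow> nat \<Rightarrow> nat \<Rightarrow> bool list" where
  "encode_instance cs V k p =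
     encode_list encode_nat cs @ encode_list (encode_list encode_nat) V @
     encode_nat k @ encode_nat p"

definition veto3_conformant_bribery_problem :: language where
  "veto3_conformant_bribery_problem =
     {encode_instance cs V k p | cs V k p.
        distinct cs \<and> election (set cs) V \<and> p \<in> set cs \<and>
        veto3_conformant_bribable (set cs) V k p}"

text \<open>The encoding is unambiguous.\<close>

definition prefix_free :: "('a \<Rightarrow> bool list) \<Rightarrow> bool" where
  "prefix_free e \<longleftrightarrow> (\<forall>x y r s. e x @ r = e y @ s \<longrightarrow> x = y \<and> r = s)"

lemma prefix_free_encode_list:
  assumes "prefix_free e"
  shows "prefix_free (encode_list e)"
proof -
  have "xs = ys \<and> r = s" if "encode_list e xs @ r = encode_list e ys @ s" for xs ys r s
    using that
  proof (induction xs arbitrary: ys)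
    case Nil
    then show ?case by (cases ys) (auto simp: encode_list_def)
  next
    case (Cons x xs)
    then obtain y ys' where ys: "ys = y # ys'"
      by (cases ys) (auto simp: encode_list_def)
    with Cons.prems have "e x @ (encode_list e xs @ r) = e y @ (encode_list e ys' @ s)"
      by (simp add: encode_list_def)
    with assms have "x = y" "encode_list e xs @ r = encode_list e ys' @ s"
      unfolding prefix_free_def by blast+
    with Cons.IH ys show ?case by blast
  qed
  then show ?thesis by (auto simp: prefix_free_def)
qed

lemma binary_inject: "binary m = binary n \<Longrightarrow> m = n"
proof (induction m arbitrary: n rule: less_induct)
  case (less m)
  show ?case
  proof (cases "m = 0 \<or> n = 0")
    case True
    with less.prems show ?thesis
      by (simp add: binary.simps[of m] binary.simps[of n] split: if_splits)
  next
    case False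
    with less.prems have "odd m = odd n" "binary (m div 2) = binary (n div 2)"
      by (simp_all add: binary.simps[of m] binary.simps[of n])
    moreover from this less.IH[of "m div 2" "n div 2"] False have "m div 2 = n div 2" by simp
    ultimately show ?thesis by presburger
  qed
qed

lemma prefix_free_encode_nat: "prefix_free encode_nat"
proof -
  have "prefix_free (encode_list (\<lambda>b. [b]))"
    by (rule prefix_free_encode_list) (simp add: prefix_free_def)
  then show ?thesis
    unfolding prefix_free_def encode_nat_def by (meson binary_inject)
qed

lemma prefix_freeD:
  assumes "prefix_free e" "e x @ r = e y @ s"
  shows "x = y" "r = s"
  using assms by (auto simp: prefix_free_def)

lemma encode_instance_inject:
  assumes "encode_instance cs V k p = encode_instance cs' V' k' p'"
  shows "cs = cs' \<and> V = V' \<and> k = k' \<and> p = p'"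
proof -
  note pf = prefix_free_encode_nat prefix_free_encode_list[OF prefix_free_encode_nat]
    prefix_free_encode_list[OF prefix_free_encode_list[OF prefix_free_encode_nat]]
  have "encode_list encode_nat cs @ encode_list (encode_list encode_nat) V @
      encode_nat k @ encode_nat p =
    encode_list encode_nat cs' @ encode_list (encode_list encode_nat) V' @
      encode_nat k' @ encode_nat p'"
    using assms by (simp add: encode_instance_def)
  note 1 = prefix_freeD[OF pf(2) this]
  note 2 = prefix_freeD[OF pf(3) 1(2)]
  note 3 = prefix_freeD[OF pf(1) 2(2)]
  have "encode_nat p @ [] = encode_nat p' @ []" using 3(2) by simp
  note 4 = prefix_freeD[OF pf(1) this]
  show ?thesis using 1(1) 2(1) 3(1) 4(1) by simp
qed

end

theory Submission imports Defs begin

text \<open>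
  For membership, a certificate consists of the instance itself, with numbers as binary words,
  and of the new vote of every voter. The verifier encodes this instance and compares the result
  with its input, so that it never has to parse the input.

  For hardness, the computation of a verifier is described by a set of clauses, and satisfiability
  of a set of clauses is reduced to covering every element of a set exactly as often as demanded
  by a fixed number of triples from a given list, where triples may be repeated. A triple becomes a
  vote with the triple in the last three places. There are just enough votes against the preferred
  candidate \<open>p\<close> that all of the bribes must replace such a vote by the vote of a triple, and that
  every element must gain at least the demanded number of vetoes. Since the demands add up to three
  times the number of bribes, this is an exact cover.

  Both the verifier and the reduction are composed from list comprehensions, case distinctions and
  bounded iterations. These are realized by programs that keep their data as prefix codes of
  trees on a single stack; such a program only touches the top of the stack, hence programs can be
  composed without any allocation of storage.
\<close>

section \<open>Stack programs and their compilation to Turing machines\<close>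

text \<open>A bribed voter can only copy a vote that is already cast, and many voters may copy the
  same one; this is why triples are repeatable and demands may exceed 1. The risk is a bribe that
  copies a padding vote instead of a triple. The dummies \<open>d\<close>, \<open>d'\<close> in the
  bottom places of padding votes let such a vote veto at most one element, where a triple vetoes
  three, so a single such copy already ruins the count. In the tableau, the only purely negative
  clauses concern the last row. An assignment may make more variables true than the run does; what
  can be shown is that everything true in the run is forced. Acceptance is therefore expressed
  negatively, as the absence of the symbol 1 (answer \<open>False\<close>) on the output tape. For
  the programs, the obstacle is that iterating a polynomial-size step can blow up exponentially.
  Numbers used for counting are unary, while those of an instance may be exponential in its length
  and stay words of bits.\<close>

text \<open>
  Four stacks of symbols, \<open>0\<close> being the main stack, and a write-only output tape with index \<open>4\<close>.
  \<open>Put\<close> only occurs as the second half of a \<open>Push\<close>, after the head has moved to a fresh cell.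
\<close>

datatype com =
    Push nat nat
  | Put nat nat
  | Pop nat
  | Out nat
  | Seq com com
  | Cond nat "nat set" com com
  | While nat "nat set" com

definition peek :: "nat list \<Rightarrow> nat" where
  "peek l = (case l of [] \<Rightarrow> 0 | a # _ \<Rightarrow> a)"

lemma peek_simps [simp]: "peek [] = 0" "peek (a # l) = a"
  by (simp_all add: peek_def)

text \<open>Component \<open>4\<close> of the state is the output written so far, in reverse.\<close>

inductive exec :: "com \<Rightarrow> (nat \<Rightarrow> nat list) \<Rightarrow> nat \<Rightarrow> (nat \<Rightarrow> nat list) \<Rightarrow> bool" where
  Push: "i < 4 \<Longrightarrow> a < 4 \<Longrightarrow> exec (Push i a) s 2 (s(i := a # s i))"
| Pop: "i < 4 \<Longrightarrow> exec (Pop i) s 1 (s(i := tl (s i)))"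
| Out: "a < 4 \<Longrightarrow> exec (Out a) s 1 (s(4 := a # s 4))"
| Seq: "exec c s t s' \<Longrightarrow> exec d s' u s'' \<Longrightarrow> exec (Seq c d) s (Suc (t + u)) s''"
| CondT: "i < 4 \<Longrightarrow> peek (s i) \<in> A \<Longrightarrow> exec c s t s' \<Longrightarrow> exec (Cond i A c d) s (Suc t) s'"
| CondF: "i < 4 \<Longrightarrow> peek (s i) \<notin> A \<Longrightarrow> exec d s t s' \<Longrightarrow> exec (Cond i A c d) s (Suc t) s'"
| WhileT: "i < 4 \<Longrightarrow> peek (s i) \<in> A \<Longrightarrow> exec c s t s' \<Longrightarrow> exec (While i A c) s' u s'' \<Longrightarrow>
    exec (While i A c) s (Suc (t + u)) s''"
| WhileF: "i < 4 \<Longrightarrow> peek (s i) \<notin> A \<Longrightarrow> exec (While i A c) s 1 s"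

lemma exec_length: "exec c s t s' \<Longrightarrow> length (s' i) \<le> length (s i) + t"
  by (induction rule: exec.induct) auto

text \<open>The states of the machine are the continuations, i.e. the lists of commands still to be run.\<close>

fun conts :: "com \<Rightarrow> com list \<Rightarrow> com list set" where
  "conts (Push i a) k = {Push i a # k, Put i a # k, k}"
| "conts (Seq c d) k = insert (Seq c d # k) (conts c (d # k) \<union> conts d k)"
| "conts (Cond i A c d) k = insert (Cond i A c d # k) (conts c k \<union> conts d k)"
| "conts (While i A c) k = insert (While i A c # k) (insert k (conts c (While i A c # k)))"
| "conts c k = {c # k, k}"

text \<open>A loop body continues with the loop itself, so continuations do not pile up and can
  serve as states.\<close>

lemma finite_conts: "finite (conts c k)"
  by (induction c k rule: conts.induct) auto

lemma conts_self: "c # k \<in> conts c k" "k \<in> conts c k"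
  by (induction c k rule: conts.induct) auto

definition idle :: "nat list \<Rightarrow> (nat \<times> move) list" where
  "idle rs = map (\<lambda>a. (a, Stay)) rs"

text \<open>A transition writes before it moves, so a push takes two of them: rewrite the symbol
  read and move left, then write by \<open>Put\<close>. The \<open>mod 4\<close> keeps every command
  within the alphabet, whatever its arguments.\<close>

fun trans :: "com list \<Rightarrow> nat list \<Rightarrow> com list \<times> (nat \<times> move) list" where
  "trans [] rs = ([], idle rs)"
| "trans (Push i a # k) rs = (Put i a # k, (idle rs)[i := (rs ! i, MoveLeft)])"
| "trans (Put i a # k) rs = (k, (idle rs)[i := (a mod 4, Stay)])"
| "trans (Pop i # k) rs = (k, (idle rs)[i := (0, MoveRight)])"
| "trans (Out a # k) rs = (k, (idle rs)[4 := (a mod 4, MoveRight)])"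
| "trans (Seq c d # k) rs = (c # d # k, idle rs)"
| "trans (Cond i A c d # k) rs = ((if rs ! i \<in> A then c else d) # k, idle rs)"
| "trans (While i A c # k) rs = (if rs ! i \<in> A then c # While i A c # k else k, idle rs)"

text \<open>The exit \<open>k\<close> is excluded because its own transitions may lead out of the
  set; for \<open>k = []\<close> it is the halting state.\<close>

lemma conts_trans:
  assumes "q \<in> conts c k" "q \<noteq> k"
  shows "fst (trans q rs) \<in> conts c k"
  using assms
proof (induction c k arbitrary: q rule: conts.induct)
  case (2 c d k)
  then consider "q = Seq c d # k" | "q \<in> conts c (d # k)" "q \<noteq> d # k" | "q \<in> conts d k" 
    using conts_self by auto
  then show ?case using 2 conts_self[where c = c and k = "d # k"] by cases auto
next
  case (3 i A c d k)
  then consider "q = Cond i A c d # k" | "q \<in> conts c k" | "q \<in> conts d k"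
    by auto
  then show ?case using 3 conts_self[where c = c and k = k] conts_self[where c = d and k = k] by cases auto
next
  case (4 i A c k)
  then consider "q = While i A c # k" | "q \<in> conts c (While i A c # k)" "q \<noteq> While i A c # k"
    by auto
  then show ?case using 4 conts_self[where c = c and k = "While i A c # k"] by cases auto
qed auto

lemma trans_acts:
  assumes "set rs \<subseteq> {..<4}" 
  shows "length (snd (trans q rs)) = length rs" and "\<forall>(a, d) \<in> set (snd (trans q rs)). a < 4"
proof -
  show "length (snd (trans q rs)) = length rs"
    by (cases "(q, rs)" rule: trans.cases) (auto simp: idle_def)
  have i: "set (idle rs) \<subseteq> {..<4} \<times> UNIV"
    using assms by (auto simp: idle_def)
  have u: "set ((idle rs)[i := (a, d)]) \<subseteq> {..<4} \<times> UNIV" if "i < length rs \<longrightarrow> a < 4" for i a d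
    using that i set_update_subsetI[OF i, of "(a, d)" i]
    by (cases "i < length rs") (auto simp: list_update_beyond idle_def)
  have "rs ! i < 4" if "i < length rs" for i
    using that assms nth_mem by fastforce
  then have "set (snd (trans q rs)) \<subseteq> {..<4} \<times> UNIV"
    by (cases "(q, rs)" rule: trans.cases) (simp_all add: i u)
  then show "\<forall>(a, d) \<in> set (snd (trans q rs)). a < 4" by auto
qed

section \<open>Simulation of stack programs on tapes, with continuations as states\<close>

definition cstep :: "com list \<times> tape list \<Rightarrow> com list \<times> tape list" where
  "cstep = (\<lambda>(q, ts). case trans q (map read_tape ts) of (q', as) \<Rightarrow> (q', map2 act as ts))"

text \<open>The stack lies under and to the right of the head, all other cells being blank. The
  position \<open>h\<close> varies because the head travels with every push and pop; an input tape
  is the case \<open>h = 0\<close>.\<close>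

definition stack_tape :: "nat list \<Rightarrow> int \<Rightarrow> tape" where
  "stack_tape l h = (\<lambda>z. contents l (z - h), h)"

text \<open>The output is anchored at cell 0, where \<open>outputs_within\<close> expects
  it.\<close>

definition out_tape :: "nat list \<Rightarrow> tape" where
  "out_tape l = (contents (rev l), int (length l))"

definition represents :: "tape list \<Rightarrow> (nat \<Rightarrow> nat list) \<Rightarrow> bool" where
  "represents ts s \<longleftrightarrow> length ts = 5 \<and> (\<forall>i<4. \<exists>h. ts ! i = stack_tape (s i) h) \<and> ts ! 4 = out_tape (s 4)"

lemma read_stack_tape [simp]: "read_tape (stack_tape l h) = peek l"
  by (cases l) (auto simp: stack_tape_def contents_def)

lemma map2_act_idle: "map2 act (idle (map read_tape ts)) ts = ts"
proof -
  have *: "act (read_tape t, Stay) t = t" for t by (cases t) auto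
  then show ?thesis by (auto simp: idle_def * intro!: nth_equalityI)
qed

lemma map2_act_update:
  assumes "i < length ts"
  shows "map2 act ((idle (map read_tape ts))[i := x]) ts = ts[i := act x (ts ! i)]"
proof -
  have *: "act (read_tape t, Stay) t = t" for t by (cases t) auto
  show ?thesis using assms
    by (auto simp: idle_def nth_list_update * intro!: nth_equalityI)
qed


lemma contents_Cons: "contents (a # l) z = (if z = 0 then a else contents l (z - 1))"
  by (auto simp: contents_def nth_Cons' nat_diff_distrib)

lemma act_push:
  "act (a, Stay) (act (peek l, MoveLeft) (stack_tape l h)) = stack_tape (a # l) (h - 1)"
proof -
  have "(\<lambda>z. contents l (z - h))(h := peek l) = (\<lambda>z. contents l (z - h))"
    by (cases l) (auto simp: contents_def)
  then show ?thesis
    by (auto simp: stack_tape_def contents_Cons algebra_simps)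
qed

lemma act_pop: "act (0, MoveRight) (stack_tape l h) = stack_tape (tl l) (h + 1)"
proof (cases l)
  case (Cons a l')
  have "contents (a # l') z = contents l' (z - 1)" if "z \<noteq> 0" for z
    using that by (simp add: contents_Cons)
  moreover have "contents l' (- 1) = 0" by (simp add: contents_def)
  ultimately show ?thesis using Cons
    by (auto simp: stack_tape_def fun_eq_iff diff_diff_eq)
qed (auto simp: stack_tape_def contents_def)

lemma act_out: "act (a, MoveRight) (out_tape l) = out_tape (a # l)"
  by (auto simp: out_tape_def contents_def nth_append fun_eq_iff)

lemma cstep_idle: "trans q (map read_tape ts) = (q', idle (map read_tape ts)) \<Longrightarrow> cstep (q, ts) = (q', ts)"
  by (simp add: cstep_def map2_act_idle)

lemma funpow_add_apply: "(f ^^ (m + n)) x = (f ^^ n) ((f ^^ m) x)"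
  by (simp add: add.commute[of m n] funpow_add)

lemma exec_cstep:
  assumes "exec c s t s'" "represents ts s"
  shows "\<exists>ts'. represents ts' s' \<and> (cstep ^^ t) (c # k, ts) = (k, ts')"
  using assms
proof (induction arbitrary: k ts rule: exec.induct)
  case (Push i a s)
  then obtain h where h: "ts ! i = stack_tape (s i) h" and l: "length ts = 5"
    by (auto simp: represents_def)
  define ts1 where "ts1 = ts[i := act (peek (s i), MoveLeft) (ts ! i)]"
  have 1: "cstep (Push i a # k, ts) = (Put i a # k, ts1)"
    using Push.hyps l h by (simp add: cstep_def map2_act_update ts1_def)
  have 2: "cstep (Put i a # k, ts1) = (k, ts1[i := act (a, Stay) (ts1 ! i)])"
    using Push.hyps l by (simp add: cstep_def map2_act_update ts1_def)
  have "ts1[i := act (a, Stay) (ts1 ! i)] = ts[i := stack_tape (a # s i) (h - 1)]"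
    using Push.hyps l h act_push by (simp add: ts1_def)
  moreover have "represents (ts[i := stack_tape (a # s i) (h - 1)]) (s(i := a # s i))"
    using Push.prems Push.hyps by (auto simp: represents_def nth_list_update)
  ultimately show ?case using 1 2 by (auto simp: numeral_2_eq_2 simp del: fun_upd_apply)
next
  case (Pop i s)
  then obtain h where h: "ts ! i = stack_tape (s i) h" and l: "length ts = 5"
    by (auto simp: represents_def)
  have 1: "cstep (Pop i # k, ts) = (k, ts[i := stack_tape (tl (s i)) (h + 1)])"
    using Pop.hyps l h act_pop by (simp add: cstep_def map2_act_update)
  moreover have "represents (ts[i := stack_tape (tl (s i)) (h + 1)]) (s(i := tl (s i)))"
    using Pop.prems Pop.hyps by (auto simp: represents_def nth_list_update)
  ultimately show ?case by (auto simp del: fun_upd_apply)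
next
  case (Out a s)
  then have h: "ts ! 4 = out_tape (s 4)" and l: "length ts = 5"
    by (auto simp: represents_def)
  have 1: "cstep (Out a # k, ts) = (k, ts[4 := out_tape (a # s 4)])"
    using Out.hyps l h act_out by (simp add: cstep_def map2_act_update)
  moreover have "represents (ts[4 := out_tape (a # s 4)]) (s(4 := a # s 4))"
    using Out.prems Out.hyps by (auto simp: represents_def nth_list_update)
  ultimately show ?case by (auto simp del: fun_upd_apply)
next
  case (Seq c s t s' d u s'')
  have *: "cstep (Seq c d # k, ts) = (c # d # k, ts)" by (rule cstep_idle) simp
  obtain ts' where 1: "represents ts' s'" "(cstep ^^ t) (c # d # k, ts) = (d # k, ts')"
    using Seq.IH(1)[OF Seq.prems] by blast
  obtain ts'' where 2: "represents ts'' s''" "(cstep ^^ u) (d # k, ts') = (k, ts'')"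
    using Seq.IH(2)[OF 1(1)] by blast
  show ?case using 1 2 * by (auto simp: funpow_add_apply funpow_Suc_right simp del: funpow.simps)
next
  case (CondT i s A c t s' d)
  have "rs ! i = peek (s i)" if "rs = map read_tape ts" for rs
    using CondT.prems CondT.hyps that by (auto simp: represents_def)
  then have *: "cstep (Cond i A c d # k, ts) = (c # k, ts)" 
    by (intro cstep_idle) (use CondT.hyps in auto)
  then show ?case using CondT.IH[OF CondT.prems] by (auto simp: funpow_Suc_right simp del: funpow.simps)
next
  case (CondF i s A d t s' c)
  have "rs ! i = peek (s i)" if "rs = map read_tape ts" for rs
    using CondF.prems CondF.hyps that by (auto simp: represents_def)
  then have *: "cstep (Cond i A c d # k, ts) = (d # k, ts)" 
    by (intro cstep_idle) (use CondF.hyps in auto)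
  then show ?case using CondF.IH[OF CondF.prems] by (auto simp: funpow_Suc_right simp del: funpow.simps)
next
  case (WhileT i s A c t s' u s'')
  have "rs ! i = peek (s i)" if "rs = map read_tape ts" for rs
    using WhileT.prems WhileT.hyps that by (auto simp: represents_def)
  then have *: "cstep (While i A c # k, ts) = (c # While i A c # k, ts)" 
    by (intro cstep_idle) (use WhileT.hyps in auto)
  obtain ts' where 1: "represents ts' s'" "(cstep ^^ t) (c # While i A c # k, ts) = (While i A c # k, ts')"
    using WhileT.IH(1)[OF WhileT.prems] by blast
  obtain ts'' where 2: "represents ts'' s''" "(cstep ^^ u) (While i A c # k, ts') = (k, ts'')"
    using WhileT.IH(2)[OF 1(1)] by blast
  show ?case using 1 2 * by (auto simp: funpow_add_apply funpow_Suc_right simp del: funpow.simps)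
next
  case (WhileF i s A c)
  have "rs ! i = peek (s i)" if "rs = map read_tape ts" for rs
    using WhileF.prems WhileF.hyps that by (auto simp: represents_def)
  then have *: "cstep (While i A c # k, ts) = (k, ts)" 
    by (intro cstep_idle) (use WhileF.hyps in auto)
  then show ?case using WhileF.prems by auto
qed

text \<open>The list \<open>qs\<close> enumerates the continuations, with the initial one first and the halting one last.\<close>

definition number :: "'a list \<Rightarrow> 'a \<Rightarrow> nat" where
  "number qs q = (LEAST n. n < length qs \<and> qs ! n = q)"

lemma number:
  assumes "q \<in> set qs"
  shows "number qs q < length qs" "qs ! number qs q = q"
  using assms LeastI_ex[of "\<lambda>n. n < length qs \<and> qs ! n = q"]
  unfolding number_def by (auto simp: in_set_conv_nth)

lemma number_nth: "distinct qs \<Longrightarrow> n < length qs \<Longrightarrow> number qs (qs ! n) = n"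
  by (metis nth_eq_iff_index_eq nth_mem number)

definition compile :: "com list list \<Rightarrow> tm" where
  "compile qs = \<lparr>num_tapes = 5, alphabet_size = 4, num_states = length qs - 1,
     transition = (\<lambda>n rs. case trans (qs ! n) rs of (q, as) \<Rightarrow> (number qs q, as))\<rparr>"

context
  fixes c :: com and qs :: "com list list"
  assumes qs: "set qs = conts c []" "distinct qs" "qs \<noteq> []" "qs ! 0 = [c]" "last qs = []"
begin

lemma closed:
  assumes "n < length qs - 1" 
  shows "fst (trans (qs ! n) rs) \<in> set qs"
proof -
  have "qs ! n \<noteq> qs ! (length qs - 1)"
    using assms qs(2) by (subst nth_eq_iff_index_eq) auto
  then have "qs ! n \<noteq> []" using qs by (simp add: last_conv_nth)
  moreover have "qs ! n \<in> conts c []" using assms qs(1) nth_mem[of n qs] by simp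
  ultimately show ?thesis using conts_trans qs(1) by blast
qed

lemma compile_tm: "turing_machine (compile qs)"
proof -
  have "case transition (compile qs) n rs of (q', as) \<Rightarrow>
      q' \<le> length qs - 1 \<and> length as = 5 \<and> (\<forall>(a, d)\<in>set as. a < 4)"
    if n: "n < length qs - 1" and rs: "length rs = 5" "set rs \<subseteq> {..<4}" for n rs
  proof -
    obtain q as where t: "trans (qs ! n) rs = (q, as)" by fastforce
    then have "number qs q < length qs" using number(1)[OF closed[OF n, of rs]] by simp
    moreover have "length as = 5" "\<forall>(a, d)\<in>set as. a < 4"
      using trans_acts[OF rs(2), of "qs ! n"] t rs(1) by simp_all
    moreover have "transition (compile qs) n rs = (number qs q, as)"
      by (simp add: compile_def t)
    ultimately show ?thesis by simp
  qed
  then show ?thesis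
    by (simp add: turing_machine_def compile_def)
qed

lemma number_last: "number qs [] = length qs - 1"
  using number_nth[of qs "length qs - 1"] qs by (simp add: last_conv_nth)

lemma compile_step:
  assumes q: "q \<in> set qs" and c: "cstep (q, ts) = (q', ts')"
  shows "step (compile qs) (number qs q, ts) = (number qs q', ts')"
proof (cases "q = []")
  case True
  then have "q' = []" "ts' = ts" using c by (simp_all add: cstep_def map2_act_idle)
  then show ?thesis using True number_last by (simp add: compile_def)
next
  case False
  have "qs ! (length qs - 1) = []" using qs(3,5) by (simp add: last_conv_nth)
  then have "number qs q \<noteq> length qs - 1"
    using number(2)[OF q] False by auto
  then have *: "number qs q < length qs - 1" using number(1)[OF q] by linarith
  obtain as where "trans q (map read_tape ts) = (q', as)" "ts' = map2 act as ts"
    using c by (auto simp: cstep_def split: prod.splits)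
  then show ?thesis using number(2)[OF q] *
    by (simp add: compile_def)
qed

lemma compile_steps:
  assumes "q \<in> set qs" "(cstep ^^ t) (q, ts) = (q', ts')"
  shows "(step (compile qs) ^^ t) (number qs q, ts) = (number qs q', ts') \<and> q' \<in> set qs"
  using assms(2)
proof (induction t arbitrary: q' ts')
  case (Suc t)
  obtain r us where r: "(cstep ^^ t) (q, ts) = (r, us)" by fastforce
  then have c: "cstep (r, us) = (q', ts')" using Suc.prems by simp
  have "r \<in> set qs" using Suc.IH[OF r] by simp
  moreover have "q' = fst (trans r (map read_tape us))"
    using c by (auto simp: cstep_def split: prod.splits)
  ultimately have "q' \<in> set qs"
    using conts_trans[of r c "[]" "map read_tape us"] qs(1) by (cases "r = []") auto
  then show ?case using Suc.IH[OF r] compile_step[OF \<open>r \<in> set qs\<close> c] by simp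
qed (use assms(1) in simp)

lemma compile_outputs:
  assumes "exec c ((\<lambda>_. [])(0 := w)) t s" "t \<le> T" "s 4 = rev v"
  shows "outputs_within (compile qs) w T v"
proof -
  define ts where "ts = (contents w, 0) # replicate 4 (contents [], 0 :: int)"
  have "\<exists>h. ts ! i = stack_tape (((\<lambda>_. [])(0 := w)) i) h" if "i < 4" for i
    using that by (intro exI[of _ 0]) (auto simp: ts_def stack_tape_def nth_Cons')
  then have "represents ts ((\<lambda>_. [])(0 := w))"
    by (auto simp: represents_def ts_def out_tape_def)
  from exec_cstep[OF assms(1) this, of "[]"] obtain ts' where
    ts': "represents ts' s" "(cstep ^^ t) ([c], ts) = ([], ts')" by auto
  have "(cstep ^^ n) ([], ts') = ([], ts')" for n
    by (induction n) (simp_all add: cstep_def map2_act_idle)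
  then have "(cstep ^^ T) ([c], ts) = ([], ts')"
    using ts'(2) funpow_add_apply[of t "T - t" cstep "([c], ts)"] assms(2) by simp
  moreover have "number qs [c] = 0"
    using number_nth[of qs 0] qs by simp
  moreover have "[c] \<in> set qs" using qs(1) conts_self by auto
  ultimately have "(step (compile qs) ^^ T) (initial (compile qs) w) = (length qs - 1, ts')"
    using compile_steps[of "[c]" T ts] number_last by (simp add: initial_def compile_def ts_def)
  moreover have "last ts' = ts' ! 4"
    using ts'(1) by (subst last_conv_nth) (auto simp: represents_def)
  then have "fst (last ts') = contents v"
    using ts'(1) assms(3) by (simp add: represents_def out_tape_def)
  ultimately show ?thesis
    by (simp add: outputs_within_def compile_def)
qed

end

lemma stack_program_tm:
  obtains M where "turing_machine M"
    "\<And>w t s T v. exec c ((\<lambda>_. [])(0 := w)) t s \<Longrightarrow> t \<le> T \<Longrightarrow> s 4 = rev v \<Longrightarrow> outputs_within M w T v"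
proof -
  have "[c] \<in> conts c []" "[] \<in> conts c []" using conts_self by auto
  moreover obtain xs where "set xs = conts c [] - {[c], []}" "distinct xs"
    using finite_distinct_list[of "conts c [] - {[c], []}"] finite_conts by auto
  ultimately have "set ([c] # xs @ [[]]) = conts c []" "distinct ([c] # xs @ [[]])"
    "[c] # xs @ [[]] \<noteq> []" "([c] # xs @ [[]]) ! 0 = [c]" "last ([c] # xs @ [[]]) = []"
    by auto
  from compile_tm[OF this] compile_outputs[OF this] show ?thesis
    by (intro that) 
qed

section \<open>Programs on serialized trees\<close>

definition exec_le :: "com \<Rightarrow> (nat \<Rightarrow> nat list) \<Rightarrow> nat \<Rightarrow> (nat \<Rightarrow> nat list) \<Rightarrow> bool" where
  "exec_le c s T s' \<longleftrightarrow> (\<exists>t \<le> T. exec c s t s')"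

lemma exec_le_mono: "exec_le c s T s' \<Longrightarrow> T \<le> T' \<Longrightarrow> exec_le c s T' s'"
  unfolding exec_le_def using le_trans by blast

lemma exec_le_Seq:
  assumes "exec_le c s T s'" "exec_le d s' U s''" 
  shows "exec_le (Seq c d) s (T + U + 1) s''"
proof -
  obtain t u where "exec c s t s'" "t \<le> T" "exec d s' u s''" "u \<le> U"
    using assms unfolding exec_le_def by blast
  then show ?thesis unfolding exec_le_def by (intro exI[of _ "Suc (t + u)"]) (auto intro: exec.Seq)
qed

lemma exec_le_Cond:
  assumes "i < 4" "exec_le (if peek (s i) \<in> A then c else d) s T s'"
  shows "exec_le (Cond i A c d) s (T + 1) s'"
proof -
  obtain t where "exec (if peek (s i) \<in> A then c else d) s t s'" "t \<le> T"
    using assms unfolding exec_le_def by blast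
  then show ?thesis using assms(1) unfolding exec_le_def
    by (intro exI[of _ "Suc t"]) (auto intro: exec.CondT exec.CondF split: if_splits)
qed

lemma exec_le_WhileT:
  assumes "i < 4" "peek (s i) \<in> A" "exec_le c s T s'" "exec_le (While i A c) s' U s''"
  shows "exec_le (While i A c) s (T + U + 1) s''"
proof -
  obtain t u where "exec c s t s'" "t \<le> T" "exec (While i A c) s' u s''" "u \<le> U"
    using assms unfolding exec_le_def by blast
  then show ?thesis using assms(1,2) unfolding exec_le_def
    by (intro exI[of _ "Suc (t + u)"]) (auto intro: exec.WhileT)
qed

lemma exec_le_WhileF: "i < 4 \<Longrightarrow> peek (s i) \<notin> A \<Longrightarrow> exec_le (While i A c) s 1 s"
  unfolding exec_le_def using exec.WhileF by blast

declare One_nat_def [simp del]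

fun loopfree :: "com \<Rightarrow> bool" where
  "loopfree (Push i a) \<longleftrightarrow> i < 4 \<and> a < 4"
| "loopfree (Pop i) \<longleftrightarrow> i < 4"
| "loopfree (Out a) \<longleftrightarrow> a < 4"
| "loopfree (Seq c d) \<longleftrightarrow> loopfree c \<and> loopfree d"
| "loopfree (Cond i A c d) \<longleftrightarrow> i < 4 \<and> loopfree c \<and> loopfree d"
| "loopfree _ \<longleftrightarrow> False"

fun run :: "com \<Rightarrow> (nat \<Rightarrow> nat list) \<Rightarrow> (nat \<Rightarrow> nat list)" where
  "run (Push i a) s = s(i := a # s i)"
| "run (Pop i) s = s(i := tl (s i))"
| "run (Out a) s = s(4 := a # s 4)"
| "run (Seq c d) s = run d (run c s)"
| "run (Cond i A c d) s = (if peek (s i) \<in> A then run c s else run d s)"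
| "run _ s = s"

fun cost :: "com \<Rightarrow> nat" where
  "cost (Push i a) = 2"
| "cost (Seq c d) = cost c + cost d + 1"
| "cost (Cond i A c d) = max (cost c) (cost d) + 1"
| "cost _ = 1"

lemma exec_run: "loopfree c \<Longrightarrow> exec_le c s (cost c) (run c s)"
proof (induction c arbitrary: s)
  case (Seq c d)
  then show ?case using exec_le_Seq by fastforce
next
  case (Cond i A c d)
  then have "exec_le (if peek (s i) \<in> A then c else d) s (max (cost c) (cost d)) (run (Cond i A c d) s)"
    using exec_le_mono[OF Cond.IH(1)] exec_le_mono[OF Cond.IH(2)] by simp
  then show ?case using Cond.prems by (auto intro: exec_le_Cond)
qed (auto simp: exec_le_def intro: exec.intros)

lemma exec_runI: "loopfree c \<Longrightarrow> run c s = s' \<Longrightarrow> cost c \<le> T \<Longrightarrow> exec_le c s T s'"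
  using exec_run exec_le_mono by blast

definition st :: "nat list \<Rightarrow> nat list \<Rightarrow> nat list \<Rightarrow> nat list \<Rightarrow> nat list \<Rightarrow> nat \<Rightarrow> nat list" where
  "st m a b c v = ((\<lambda>_. [])(0 := m, 1 := a, 2 := b, 3 := c, 4 := v))"

lemma st_apply [simp]:
  "st m a b c v 0 = m" "st m a b c v 1 = a" "st m a b c v 2 = b"
  "st m a b c v 3 = c" "st m a b c v 4 = v"
  by (simp_all add: st_def)

lemma st_update [simp]:
  "(st m a b c v)(0 := l) = st l a b c v" "(st m a b c v)(1 := l) = st m l b c v"
  "(st m a b c v)(2 := l) = st m a l c v" "(st m a b c v)(3 := l) = st m a b l v"
  "(st m a b c v)(4 := l) = st m a b c l"
  by (auto simp: st_def fun_eq_iff)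

text \<open>A command cannot name the symbol it has read, so the body is instantiated for each of
  the symbols 1, 2, 3; the blank read on an empty stack ends the loop.\<close>

definition drain :: "nat \<Rightarrow> (nat \<Rightarrow> com) \<Rightarrow> com" where
  "drain i f = While i {1, 2, 3}
     (Cond i {1} (Seq (Pop i) (f 1)) (Cond i {2} (Seq (Pop i) (f 2)) (Seq (Pop i) (f 3))))"

text \<open>\<open>G l d\<close> is the state with \<open>l\<close> still to be read and
  \<open>d\<close> already read, in reverse. The 5 extra steps per symbol pay for the loop, two
  tests, the pop and its sequencing.\<close>

lemma exec_drain:
  assumes i: "i < 4" and G: "\<And>l d. G l d i = l"
    and f: "\<And>a l d. a \<in> {1, 2, 3} \<Longrightarrow> exec_le (f a) ((G (a # l) d)(i := l)) K (G l (a # d))"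
    and l: "set l \<subseteq> {1, 2, 3}"
  shows "exec_le (drain i f) (G l d) ((K + 5) * length l + 1) (G [] (rev l @ d))"
  using l
proof (induction l arbitrary: d)
  case Nil
  then show ?case using i G by (auto simp: drain_def intro!: exec_le_WhileF)
next
  case (Cons a l)
  let ?c = "Cond i {1} (Seq (Pop i) (f 1)) (Cond i {2} (Seq (Pop i) (f 2)) (Seq (Pop i) (f 3)))"
  have a: "a \<in> {1, 2, 3}" using Cons.prems by auto
  have pop: "exec_le (Pop i) (G (a # l) d) 1 ((G (a # l) d)(i := l))"
    using i G by (auto intro!: exec_runI)
  have s: "exec_le (Seq (Pop i) (f a)) (G (a # l) d) (1 + K + 1) (G l (a # d))"
    by (rule exec_le_Seq[OF pop f[OF a]])
  then have "exec_le ?c (G (a # l) d) (1 + K + 1 + 1 + 1) (G l (a # d))"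
    using a exec_le_mono[OF s, of "1 + K + 1 + 1"] G by (intro exec_le_Cond i) (auto intro: exec_le_Cond i)
  from exec_le_WhileT[OF i _ this Cons.IH[unfolded drain_def]] a Cons.prems G
  show ?case unfolding drain_def[symmetric]
    by (auto elim!: exec_le_mono)
qed

abbreviation pour :: "nat \<Rightarrow> nat \<Rightarrow> com" where
  "pour i j \<equiv> drain i (Push j)"

lemma exec_pour:
  assumes "set l \<subseteq> {1, 2, 3}"
  shows "exec_le (pour 0 1) (st l a b c v) (7 * length l + 1) (st [] (rev l @ a) b c v)"
    "exec_le (pour 1 0) (st m l b c v) (7 * length l + 1) (st (rev l @ m) [] b c v)"
    "exec_le (pour 2 0) (st m a l c v) (7 * length l + 1) (st (rev l @ m) a [] c v)"
    "exec_le (pour 2 1) (st m a l c v) (7 * length l + 1) (st m (rev l @ a) [] c v)"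
proof -
  have *: "exec_le (pour i j) (G l d) (7 * length l + 1) (G [] (rev l @ d))"
    if "i < 4" "j < 4" "\<And>l d. G l d i = l" "\<And>a l d. ((G (a # l) d)(i := l, j := a # ((G (a # l) d)(i := l)) j)) = G l (a # d)"
    for i j G d
  proof -
    have "exec_le (Push j a) ((G (a # l) d)(i := l)) 2 (G l (a # d))" if "a \<in> {1, 2, 3}" for a l d
      using that \<open>j < 4\<close> \<open>\<And>a l d. ((G (a # l) d)(i := l, j := a # ((G (a # l) d)(i := l)) j)) = G l (a # d)\<close>
      by (intro exec_runI) auto
    from exec_drain[of i G "Push j" 2 l d, OF \<open>i < 4\<close> \<open>\<And>l d. G l d i = l\<close> this assms] show ?thesis by simp
  qed
  show "exec_le (pour 0 1) (st l a b c v) (7 * length l + 1) (st [] (rev l @ a) b c v)"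
    by (rule *[where G = "\<lambda>l d. st l d b c v"]) simp_all
  show "exec_le (pour 1 0) (st m l b c v) (7 * length l + 1) (st (rev l @ m) [] b c v)"
    by (rule *[where G = "\<lambda>l d. st d l b c v"]) simp_all
  show "exec_le (pour 2 0) (st m a l c v) (7 * length l + 1) (st (rev l @ m) a [] c v)"
    by (rule *[where G = "\<lambda>l d. st d a l c v"]) simp_all
  show "exec_le (pour 2 1) (st m a l c v) (7 * length l + 1) (st m (rev l @ a) [] c v)"
    by (rule *[where G = "\<lambda>l d. st m d l c v"]) simp_all
qed

section \<open>Moving, copying and dropping prefix codes of trees\<close>

datatype tree = Leaf | Node tree tree

fun code :: "tree \<Rightarrow> nat list" where
  "code Leaf = [1]"
| "code (Node a b) = 2 # code a @ code b"

lemma set_code: "set (code t) \<subseteq> {1, 2, 3}"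
  by (induction t) auto

lemma code_pos: "length (code t) > 0"
  by (cases t) auto

text \<open>
  The prefix code of a tree is self-delimiting: its end is reached when the number of pending
  subtrees, kept in unary on stack \<open>3\<close>, drops to zero.
\<close>

definition move_loop :: "nat \<Rightarrow> com" where
  "move_loop i = While 3 {1} (Cond 0 {2} (Seq (Pop 0) (Seq (Push i 2) (Push 3 1)))
     (Seq (Pop 0) (Seq (Push i 1) (Pop 3))))"

text \<open>In continuation style: the cost \<open>T\<close> of the rest of the loop is a premise,
  so that both subtrees of a node are handled one after the other within the same loop. Each symbol
  costs 8 for the body and 1 for the loop.\<close>

lemma exec_move_loop:
  assumes "i = 1 \<or> i = 2"
    and "exec_le (move_loop i) ((st m a b c v)(i := rev (code t) @ (st m a b c v) i)) T s"
  shows "exec_le (move_loop i) (st (code t @ m) a b (1 # c) v) (9 * length (code t) + T) s"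
  using assms(2)
proof (induction t arbitrary: m a b c T)
  case Leaf
  let ?c = "Cond 0 {2} (Seq (Pop 0) (Seq (Push i 2) (Push 3 1))) (Seq (Pop 0) (Seq (Push i 1) (Pop 3)))"
  have 1: "exec_le ?c (st (1 # m) a b (1 # c) v) 8 ((st m a b c v)(i := rev (code Leaf) @ (st m a b c v) i))"
    using assms(1) by (intro exec_runI) auto
  have "exec_le (move_loop i) (st (1 # m) a b (1 # c) v) (8 + T + 1) s"
    unfolding move_loop_def 
    by (rule exec_le_WhileT[OF _ _ 1 Leaf[unfolded move_loop_def]]) simp_all
  then show ?case by (auto elim: exec_le_mono)
next
  case (Node l r)
  let ?c = "Cond 0 {2} (Seq (Pop 0) (Seq (Push i 2) (Push 3 1))) (Seq (Pop 0) (Seq (Push i 1) (Pop 3)))"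
  let ?s = "(st (code l @ code r @ m) a b (1 # 1 # c) v)(i := 2 # (st m a b c v) i)"
  have 1: "exec_le ?c (st (code (Node l r) @ m) a b (1 # c) v) 8 ?s"
    using assms(1) by (intro exec_runI) auto
  have 2: "exec_le (move_loop i) ?s (9 * length (code l) + (9 * length (code r) + T)) s"
    using assms(1)
  proof
    assume i: "i = 1"
    then have "exec_le (move_loop i) (st (code r @ m) (rev (code l) @ 2 # a) b (1 # c) v) (9 * length (code r) + T) s"
      using Node.prems by (intro Node.IH(2)) simp
    then show ?thesis using i Node.IH(1)[of "code r @ m" "2 # a" b "1 # c"] by simp
  next
    assume i: "i = 2"
    then have "exec_le (move_loop i) (st (code r @ m) a (rev (code l) @ 2 # b) (1 # c) v) (9 * length (code r) + T) s"
      using Node.prems by (intro Node.IH(2)) simp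
    then show ?thesis using i Node.IH(1)[of "code r @ m" a "2 # b" "1 # c"] by simp
  qed
  have "exec_le (move_loop i) (st (code (Node l r) @ m) a b (1 # c) v)
      (8 + (9 * length (code l) + (9 * length (code r) + T)) + 1) s"
    unfolding move_loop_def 
    by (rule exec_le_WhileT[OF _ _ 1 2[unfolded move_loop_def]]) simp_all
  then show ?case by (auto elim: exec_le_mono)
qed

definition move_tree :: "nat \<Rightarrow> com" where
  "move_tree i = Seq (Push 3 1) (move_loop i)"

lemma exec_move_tree:
  assumes "i = 1 \<or> i = 2"
  shows "exec_le (move_tree i) (st (code t @ m) a b [] v) (9 * length (code t) + 4)
      ((st m a b [] v)(i := rev (code t) @ (st m a b [] v) i))"
proof -
  have 1: "exec_le (Push 3 1) (st (code t @ m) a b [] v) 2 (st (code t @ m) a b [1] v)"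
    by (rule exec_runI) auto
  have 2: "exec_le (move_loop i) (st (code t @ m) a b [1] v) (9 * length (code t) + 1)
      ((st m a b [] v)(i := rev (code t) @ (st m a b [] v) i))"
    using assms by (intro exec_move_loop) (auto simp: move_loop_def intro!: exec_le_WhileF)
  show ?thesis using exec_le_Seq[OF 1 2] by (auto simp: move_tree_def elim: exec_le_mono)
qed

text \<open>On an empty stack 3, \<open>Pop 3\<close> does nothing, so the drain just
  discards.\<close>

definition drop_tree :: com where
  "drop_tree = Seq (move_tree 2) (drain 2 (\<lambda>_. Pop 3))"

lemma exec_drop_tree:
  "exec_le drop_tree (st (code t @ m) a [] [] v) (21 * length (code t)) (st m a [] [] v)"
proof -
  have 1: "exec_le (move_tree 2) (st (code t @ m) a [] [] v) (9 * length (code t) + 4) (st m a (rev (code t)) [] v)"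
    using exec_move_tree[of 2 t m a "[]" v] by simp
  have 2: "exec_le (drain 2 (\<lambda>_. Pop 3)) (st m a (rev (code t)) [] v) ((1 + 5) * length (rev (code t)) + 1) (st m a [] [] v)"
    using set_code by (intro exec_drain[where G = "\<lambda>l d. st m a l [] v"]) (auto intro!: exec_runI)
  show ?thesis unfolding drop_tree_def
    by (rule exec_le_mono[OF exec_le_Seq[OF 1 2]]) (use code_pos[of t] in \<open>simp add: algebra_simps del: length_greater_0_conv\<close>)
qed

text \<open>Every pour reverses; the second copy goes over stack 1 to reach stack 0 in the right
  order.\<close>

definition dup_tree :: com where
  "dup_tree = Seq (move_tree 1) (Seq (drain 1 (\<lambda>a. Seq (Push 0 a) (Push 2 a))) (Seq (pour 2 1) (pour 1 0)))"

lemma exec_dup_tree: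
  "exec_le dup_tree (st (code t @ m) [] [] [] v) (43 * length (code t)) (st (code t @ code t @ m) [] [] [] v)"
proof -
  have 1: "exec_le (move_tree 1) (st (code t @ m) [] [] [] v) (9 * length (code t) + 4) (st m (rev (code t)) [] [] v)"
    using exec_move_tree[of 1 t m "[]" "[]" v] by simp
  have "exec_le (drain 1 (\<lambda>a. Seq (Push 0 a) (Push 2 a))) (st ([] @ m) (rev (code t)) [] [] v)
      ((5 + 5) * length (rev (code t)) + 1) (st ((rev (rev (code t)) @ []) @ m) [] (rev (rev (code t)) @ []) [] v)"
    using set_code by (intro exec_drain[where G = "\<lambda>l d. st (d @ m) l d [] v"]) (auto intro!: exec_runI)
  then have 2: "exec_le (drain 1 (\<lambda>a. Seq (Push 0 a) (Push 2 a))) (st m (rev (code t)) [] [] v)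
      (10 * length (code t) + 1) (st (code t @ m) [] (code t) [] v)" by simp
  note 3 = exec_pour(4)[OF set_code, of "code t @ m" "[]" t "[]" v]
  have 4: "exec_le (pour 1 0) (st (code t @ m) (rev (code t) @ []) [] [] v) (7 * length (rev (code t)) + 1)
     (st (code t @ code t @ m) [] [] [] v)"
    using exec_pour(2)[of "rev (code t)"] set_code by simp
  show ?thesis unfolding dup_tree_def
    by (rule exec_le_mono[OF exec_le_Seq[OF 1 exec_le_Seq[OF 2 exec_le_Seq[OF 3 4]]]]) (use code_pos[of t] in \<open>simp add: algebra_simps del: length_greater_0_conv\<close>)
qed

definition swap_trees :: com where
  "swap_trees = Seq (move_tree 1) (Seq (move_tree 2) (Seq (pour 1 0) (pour 2 0)))"

lemma exec_swap_trees:
  "exec_le swap_trees (st (code t @ code u @ m) [] [] [] v) (32 * (length (code t) + length (code u)))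
     (st (code u @ code t @ m) [] [] [] v)"
proof -
  have 1: "exec_le (move_tree 1) (st (code t @ code u @ m) [] [] [] v) (9 * length (code t) + 4)
      (st (code u @ m) (rev (code t)) [] [] v)"
    using exec_move_tree[of 1 t "code u @ m" "[]" "[]" v] by simp
  have 2: "exec_le (move_tree 2) (st (code u @ m) (rev (code t)) [] [] v) (9 * length (code u) + 4)
      (st m (rev (code t)) (rev (code u)) [] v)"
    using exec_move_tree[of 2 u m "rev (code t)" "[]" v] by simp
  have 3: "exec_le (pour 1 0) (st m (rev (code t)) (rev (code u)) [] v) (7 * length (rev (code t)) + 1)
     (st (code t @ m) [] (rev (code u)) [] v)"
    using exec_pour(2)[of "rev (code t)"] set_code by simp
  have 4: "exec_le (pour 2 0) (st (code t @ m) [] (rev (code u)) [] v) (7 * length (rev (code u)) + 1)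
     (st (code u @ code t @ m) [] [] [] v)"
    using exec_pour(3)[of "rev (code u)"] set_code by simp
  show ?thesis unfolding swap_trees_def
    by (rule exec_le_mono[OF exec_le_Seq[OF 1 exec_le_Seq[OF 2 exec_le_Seq[OF 3 4]]]]) (use code_pos[of t] code_pos[of u] in \<open>simp add: algebra_simps del: length_greater_0_conv\<close>)
qed

definition nip_tree :: com where
  "nip_tree = Seq (move_tree 1) (Seq drop_tree (pour 1 0))"

lemma exec_nip_tree:
  "exec_le nip_tree (st (code t @ code u @ m) [] [] [] v) (30 * (length (code t) + length (code u)))
     (st (code t @ m) [] [] [] v)"
proof -
  have 1: "exec_le (move_tree 1) (st (code t @ code u @ m) [] [] [] v) (9 * length (code t) + 4)
      (st (code u @ m) (rev (code t)) [] [] v)"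
    using exec_move_tree[of 1 t "code u @ m" "[]" "[]" v] by simp
  note 2 = exec_drop_tree[of u m "rev (code t)" v]
  have 3: "exec_le (pour 1 0) (st m (rev (code t)) [] [] v) (7 * length (rev (code t)) + 1)
     (st (code t @ m) [] [] [] v)"
    using exec_pour(2)[of "rev (code t)"] set_code by simp
  show ?thesis unfolding nip_tree_def
    by (rule exec_le_mono[OF exec_le_Seq[OF 1 exec_le_Seq[OF 2 3]]]) (use code_pos[of t] code_pos[of u] in \<open>simp add: algebra_simps del: length_greater_0_conv\<close>)
qed

section \<open>Polynomial-time functions on encodable types\<close>

class enc =
  fixes enc :: "'a \<Rightarrow> tree"
  assumes enc_inject: "enc x = enc y \<Longrightarrow> x = y"

instantiation tree :: enc
begin
definition enc_tree :: "tree \<Rightarrow> tree" where "enc_tree t = t"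
instance by standard (simp add: enc_tree_def)
end

instantiation bool :: enc
begin
definition enc_bool :: "bool \<Rightarrow> tree" where "enc_bool b = (if b then Node Leaf Leaf else Leaf)"
instance by standard (simp add: enc_bool_def split: if_splits)
end

instantiation unit :: enc
begin
definition enc_unit :: "unit \<Rightarrow> tree" where "enc_unit u = Leaf"
instance by standard simp
end

instantiation nat :: enc
begin
text \<open>Unary, so that a number can serve as the bound of a loop: polynomial in the size means
  polynomial in the value.\<close>

fun enc_nat :: "nat \<Rightarrow> tree" where
  "enc_nat 0 = Leaf"
| "enc_nat (Suc n) = Node Leaf (enc_nat n)"
instance
proof
  show "x = y" if "enc x = enc y" for x y :: nat
    using that by (induction x arbitrary: y) (case_tac y; simp)+
qed
end

instantiation prod :: (enc, enc) enc
begin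
definition enc_prod :: "'a \<times> 'b \<Rightarrow> tree" where "enc_prod p = Node (enc (fst p)) (enc (snd p))"
instance by standard (auto simp: enc_prod_def dest: enc_inject intro: prod_eqI)
end

instantiation list :: (enc) enc
begin
fun enc_list :: "'a list \<Rightarrow> tree" where
  "enc_list [] = Leaf"
| "enc_list (x # xs) = Node (enc x) (enc_list xs)"
instance
proof
  show "x = y" if "enc x = enc y" for x y :: "'a list"
    using that by (induction x arbitrary: y) (case_tac y; auto dest: enc_inject)+
qed
end

definition tsize :: "'a::enc \<Rightarrow> nat" where
  "tsize x = length (code (enc x))"

lemma tsize_simps [simp]:
  "tsize (x, y) = tsize x + tsize y + 1"
  "tsize ([] :: 'a::enc list) = 1"
  "tsize (z # zs) = tsize z + tsize zs + 1"
  "tsize Leaf = 1" "tsize (Node t u) = tsize t + tsize u + 1"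
  "tsize n = 2 * n + 1"
  by (auto simp: tsize_def enc_prod_def enc_tree_def) (induction n; simp)

lemma tsize_bool: "tsize (b :: bool) \<le> 3"
  by (simp add: tsize_def enc_bool_def)

lemma tsize_pos: "tsize x \<ge> 1"
  using code_pos[of "enc x"] unfolding tsize_def by linarith

definition main :: "'a::enc \<Rightarrow> nat list \<Rightarrow> nat \<Rightarrow> nat list" where
  "main x r = st (code (enc x) @ r) [] [] [] []"

text \<open>The rest \<open>r\<close> of the stack is arbitrary and does not enter the time bound:
  values saved below the argument survive any program, which is what makes composition work.\<close>

definition computes :: "com \<Rightarrow> ('a::enc \<Rightarrow> 'b::enc) \<Rightarrow> nat poly \<Rightarrow> bool" where
  "computes c f p \<longleftrightarrow> (\<forall>x r. exec_le c (main x r) (poly p (tsize x)) (main (f x) r))"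

definition PT :: "('a::enc \<Rightarrow> 'b::enc) \<Rightarrow> bool" where
  "PT f \<longleftrightarrow> (\<exists>c p. computes c f p)"

lemma PT_I:
  assumes "\<And>x r. exec_le c (main x r) (poly p (tsize x)) (main (f x) r)"
  shows "PT f"
  using assms unfolding PT_def computes_def by blast

lemma PT_E:
  assumes "PT f"
  obtains c p where "\<And>x r. exec_le c (main x r) (poly p (tsize x)) (main (f x) r)"
  using assms unfolding PT_def computes_def by blast

lemma poly_mono_nat: "m \<le> n \<Longrightarrow> poly p m \<le> poly p (n :: nat)"
  by (induction p) (auto intro!: mult_le_mono)

text \<open>A stack grows by no more symbols than there are steps, so a polynomial running time
  bounds the size of the result.\<close>

lemma PT_tsize:
  assumes "PT f"
  obtains p where "\<And>x. tsize (f x) \<le> poly p (tsize x)"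
proof -
  from assms obtain c p where c: "\<And>x r. exec_le c (main x r) (poly p (tsize x)) (main (f x) r)"
    by (rule PT_E) blast
  have "tsize (f x) \<le> poly ([:0, 1:] + p) (tsize x)" for x
    using c[of x "[]"] exec_length[of c "main x []" _ "main (f x) []" 0]
    unfolding exec_le_def by (fastforce simp: main_def tsize_def)
  then show ?thesis by (rule that)
qed

text \<open>A program sees codes only. Types with coinciding codes are thus converted for free:
  pairs and nonempty lists, numbers and unit lists, trees and lists of trees.\<close>

lemma PT_cast: 
  assumes "PT f" "\<And>x. enc (g x) = enc (f x)"
  shows "PT g"
  using assms unfolding PT_def computes_def main_def by metis

lemma exec_skip: "exec_le (Pop 3) (st m a b [] v) 1 (st m a b [] v)"
  by (intro exec_runI) auto

lemma PT_id: "PT (\<lambda>x. x)"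
  by (rule PT_I[where c = "Pop 3" and p = 1]) (auto simp: main_def intro: exec_skip)

lemma PT_comp: 
  assumes "PT f" "PT g"
  shows "PT (\<lambda>x. f (g x))"
proof -
  from assms(1) obtain c p where c: "\<And>x r. exec_le c (main x r) (poly p (tsize x)) (main (f x) r)"
    by (rule PT_E) blast
  from assms(2) obtain d q where d: "\<And>x r. exec_le d (main x r) (poly q (tsize x)) (main (g x) r)"
    by (rule PT_E) blast
  from assms(2) obtain s where s: "\<And>x. tsize (g x) \<le> poly s (tsize x)" by (rule PT_tsize) blast
  have "exec_le (Seq d c) (main x r) (poly (q + pcompose p s + 1) (tsize x)) (main (f (g x)) r)" for x r
    using exec_le_Seq[OF d[of x r] c[of "g x" r]] poly_mono_nat[OF s[of x], of p]
    by (auto simp: poly_pcompose elim: exec_le_mono)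
  then show ?thesis by (rule PT_I)
qed

text \<open>\<open>g\<close> runs on a copy of the argument and \<open>f\<close> on the original
  after a swap; in prefix code, a single symbol in front turns the two results into a pair.\<close>

lemma PT_Pair: 
  assumes "PT f" "PT g"
  shows "PT (\<lambda>x. (f x, g x))"
proof -
  from assms(1) obtain c p where c: "\<And>x r. exec_le c (main x r) (poly p (tsize x)) (main (f x) r)"
    by (rule PT_E) blast
  from assms(2) obtain d q where d: "\<And>x r. exec_le d (main x r) (poly q (tsize x)) (main (g x) r)"
    by (rule PT_E) blast
  from assms(2) obtain s where s: "\<And>x. tsize (g x) \<le> poly s (tsize x)" by (rule PT_tsize) blast
  let ?t = "[:43:] * [:0, 1:] + (q + ([:32:] * (s + [:0, 1:]) + (p + [:10:])))"
  have "exec_le (Seq dup_tree (Seq d (Seq swap_trees (Seq c (Push 0 2))))) (main x r) (poly ?t (tsize x))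
      (main (f x, g x) r)" for x r
  proof -
    have 1: "exec_le dup_tree (main x r) (43 * tsize x) (main x (code (enc x) @ r))"
      unfolding main_def tsize_def by (rule exec_dup_tree)
    note 2 = d[of x "code (enc x) @ r"]
    have 3: "exec_le swap_trees (main (g x) (code (enc x) @ r)) (32 * (tsize (g x) + tsize x)) (main x (code (enc (g x)) @ r))"
      unfolding main_def tsize_def by (rule exec_swap_trees)
    note 4 = c[of x "code (enc (g x)) @ r"]
    have 5: "exec_le (Push 0 2) (main (f x) (code (enc (g x)) @ r)) 2 (main (f x, g x) r)"
      by (rule exec_runI) (auto simp: main_def enc_prod_def)
    show ?thesis
      by (rule exec_le_mono[OF exec_le_Seq[OF 1 exec_le_Seq[OF 2 exec_le_Seq[OF 3 exec_le_Seq[OF 4 5]]]]])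
        (use s[of x] in \<open>simp add: algebra_simps\<close>)
  qed
  then show ?thesis by (rule PT_I)
qed

lemma PT_fst: "PT fst"
proof (rule PT_I[where p = "[:31:] * [:0, 1:] + [:10:]"])
  fix x :: "'a \<times> 'b" and r
  have 1: "exec_le (Pop 0) (main x r) 1 (main (fst x) (code (enc (snd x)) @ r))"
    by (rule exec_runI) (auto simp: main_def enc_prod_def)
  have 2: "exec_le nip_tree (main (fst x) (code (enc (snd x)) @ r)) (30 * (tsize (fst x) + tsize (snd x))) (main (fst x) r)"
    unfolding main_def tsize_def by (rule exec_nip_tree)
  show "exec_le (Seq (Pop 0) nip_tree) (main x r) (poly ([:31:] * [:0, 1:] + [:10:]) (tsize x)) (main (fst x) r)"
    by (rule exec_le_mono[OF exec_le_Seq[OF 1 2]]) (cases x, simp)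
qed

lemma PT_snd: "PT snd"
proof (rule PT_I[where p = "[:31:] * [:0, 1:] + [:10:]"])
  fix x :: "'a \<times> 'b" and r
  have 1: "exec_le (Pop 0) (main x r) 1 (main (fst x) (code (enc (snd x)) @ r))"
    by (rule exec_runI) (auto simp: main_def enc_prod_def)
  have 2: "exec_le drop_tree (main (fst x) (code (enc (snd x)) @ r)) (21 * tsize (fst x)) (main (snd x) r)"
    unfolding main_def tsize_def by (rule exec_drop_tree)
  show "exec_le (Seq (Pop 0) drop_tree) (main x r) (poly ([:31:] * [:0, 1:] + [:10:]) (tsize x)) (main (snd x) r)"
    by (rule exec_le_mono[OF exec_le_Seq[OF 1 2]]) (cases x, simp)
qed

lemma PT_fst': "PT f \<Longrightarrow> PT (\<lambda>x. fst (f x))"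
  and PT_snd': "PT f \<Longrightarrow> PT (\<lambda>x. snd (f x))"
  using PT_comp[OF PT_fst] PT_comp[OF PT_snd] by blast+

lemma PT_Leaf: "PT (\<lambda>x. Leaf)"
proof (rule PT_I[where p = "[:21:] * [:0, 1:] + [:10:]"])
  fix x :: 'a and r
  have 1: "exec_le drop_tree (main x r) (21 * tsize x) (st r [] [] [] [])"
    unfolding main_def tsize_def by (rule exec_drop_tree)
  have 2: "exec_le (Push 0 1) (st r [] [] [] []) 2 (main Leaf r)"
    by (rule exec_runI) (auto simp: main_def enc_tree_def)
  show "exec_le (Seq drop_tree (Push 0 1)) (main x r) (poly ([:21:] * [:0, 1:] + [:10:]) (tsize x)) (main Leaf r)"
    by (rule exec_le_mono[OF exec_le_Seq[OF 1 2]]) simp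
qed

lemma PT_const: "PT (\<lambda>x :: 'a::enc. c :: 'b::enc)"
proof -
  have "PT (\<lambda>x :: 'a. t)" for t :: tree
  proof (induction t)
    case (Node t u)
    show ?case by (rule PT_cast[OF PT_Pair[OF Node]]) (simp add: enc_prod_def enc_tree_def)
  qed (rule PT_Leaf)
  then show ?thesis by (rule PT_cast) (auto simp: enc_tree_def)
qed

text \<open>A branch sees the components of the tested list in front of the argument.\<close>

lemma PT_case_list:
  assumes "PT l" "PT f" "PT (\<lambda>p. g (snd p) (fst (fst p)) (snd (fst p)))"
  shows "PT (\<lambda>x. case l x of [] \<Rightarrow> f x | y # ys \<Rightarrow> g x y ys)"
proof -
  have "PT (\<lambda>x. (l x, x))" using assms(1) PT_id by (rule PT_Pair)
  then obtain c p where c: "\<And>x r. exec_le c (main x r) (poly p (tsize x)) (main (l x, x) r)"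
    by (rule PT_E) blast
  obtain s where s: "\<And>x. tsize (l x) \<le> poly s (tsize x)" by (rule PT_tsize[OF assms(1)]) blast
  from assms(2) obtain d q where d: "\<And>x r. exec_le d (main x r) (poly q (tsize x)) (main (f x) r)"
    by (rule PT_E) blast
  from assms(3) obtain e u where
    e: "\<And>x r. exec_le e (main x r) (poly u (tsize x)) (main (g (snd x) (fst (fst x)) (snd (fst x))) r)"
    by (rule PT_E) blast
  let ?b = "Cond 0 {1} (Seq (Pop 0) d) (Seq (Push 0 2) e)"
  let ?t = "p + ([:2:] + ([:5:] + q + pcompose u (s + [:0, 1:] + 1) + 1) + 1)"
  have "exec_le (Seq c (Seq (Pop 0) ?b)) (main x r)
      (poly ?t (tsize x)) (main (case l x of [] \<Rightarrow> f x | y # ys \<Rightarrow> g x y ys) r)" for x r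
  proof -
    let ?s = "st (code (enc (l x)) @ code (enc x) @ r) [] [] [] []"
    have 1: "exec_le (Pop 0) (main (l x, x) r) 1 ?s"
      by (rule exec_runI) (auto simp: main_def enc_prod_def)
    have 2: "exec_le ?b ?s (poly ([:5:] + q + pcompose u (s + [:0, 1:] + 1) + 1) (tsize x)) 
        (main (case l x of [] \<Rightarrow> f x | y # ys \<Rightarrow> g x y ys) r)"
    proof (cases "l x")
      case Nil
      have "exec_le (Pop 0) ?s 1 (main x r)"
        using Nil by (intro exec_runI) (auto simp: main_def)
      note 3 = exec_le_Seq[OF this d]
      have "exec_le (Seq (Pop 0) d) ?s (poly ([:5:] + q + pcompose u (s + [:0, 1:] + 1)) (tsize x)) (main (f x) r)"
        by (rule exec_le_mono[OF 3]) simp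
      then have "exec_le ?b ?s (poly ([:5:] + q + pcompose u (s + [:0, 1:] + 1)) (tsize x) + 1) (main (f x) r)"
        by (intro exec_le_Cond) (use Nil in simp_all)
      then show ?thesis using Nil by simp
    next
      case (Cons y ys)
      \<comment> \<open>The code of \<open>y # ys\<close> is also that of \<open>(y, ys)\<close>, so
        one symbol in front joins it with \<open>x\<close>.\<close>
      have "exec_le (Push 0 2) ?s 2 (main ((y, ys), x) r)"
        using Cons by (intro exec_runI) (auto simp: main_def enc_prod_def)
      note 3 = exec_le_Seq[OF this e]
      have "poly u (tsize ((y, ys), x)) \<le> poly u (poly (s + [:0, 1:] + 1) (tsize x))"
        using s[of x] Cons by (intro poly_mono_nat) simp
      then have "exec_le (Seq (Push 0 2) e) ?s (poly ([:5:] + q + pcompose u (s + [:0, 1:] + 1)) (tsize x)) (main (g x y ys) r)"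
        using exec_le_mono[OF 3] by (simp add: poly_pcompose)
      then have "exec_le ?b ?s (poly ([:5:] + q + pcompose u (s + [:0, 1:] + 1)) (tsize x) + 1) (main (g x y ys) r)"
        by (intro exec_le_Cond) (use Cons in simp_all)
      then show ?thesis using Cons by simp
    qed
    show ?thesis
      by (rule exec_le_mono[OF exec_le_Seq[OF c exec_le_Seq[OF 1 2]]]) simp
  qed
  then show ?thesis by (rule PT_I)
qed

lemma PT_Cons: "PT f \<Longrightarrow> PT g \<Longrightarrow> PT (\<lambda>x. f x # g x)"
  by (rule PT_cast[OF PT_Pair]) (auto simp: enc_prod_def)

text \<open>A truth value has the code of a unit list of length at most 1, so branching is a case
  distinction on lists.\<close>

lemma PT_if:
  assumes "PT b" "PT f" "PT g"
  shows "PT (\<lambda>x. if b x then f x else g x)"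
proof -
  define l where "l x = (if b x then [()] else [])" for x
  have "PT l" by (rule PT_cast[OF assms(1)]) (simp add: l_def enc_bool_def enc_unit_def)
  then have "PT (\<lambda>x. case l x of [] \<Rightarrow> g x | _ # _ \<Rightarrow> f x)"
    by (rule PT_case_list[OF _ assms(3) PT_comp[OF assms(2)]]) (rule PT_snd)
  moreover have "(\<lambda>x. case l x of [] \<Rightarrow> g x | _ # _ \<Rightarrow> f x) = (\<lambda>x. if b x then f x else g x)"
    by (auto simp: l_def)
  ultimately show ?thesis by simp
qed

text \<open>The invariant bounds all states in terms of the initial argument \<open>x\<close>; a
  bound in terms of the previous state would compose to exponential growth. The measure
  \<open>m\<close> bounds the number of rounds.\<close>

lemma PT_while:
  assumes "PT i" "PT f" "PT b"
    and init: "\<And>x. Inv x (i x)"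
    and step: "\<And>x s. Inv x s \<Longrightarrow> b s \<Longrightarrow> Inv x (f s) \<and> m (f s) < (m s :: nat)"
    and exit: "\<And>x s. Inv x s \<Longrightarrow> \<not> b s \<Longrightarrow> s = h x"
    and size: "\<And>x s. Inv x s \<Longrightarrow> tsize s \<le> poly p (tsize x)"
    and count: "\<And>x. m (i x) \<le> poly p (tsize x)"
  shows "PT h"
proof -
  from PT_Pair[OF assms(3) PT_id] obtain c q where
    c: "\<And>x r. exec_le c (main x r) (poly q (tsize x)) (main (b x, x) r)"
    by (rule PT_E) blast
  from assms(2) obtain d u where d: "\<And>x r. exec_le d (main x r) (poly u (tsize x)) (main (f x) r)"
    by (rule PT_E) blast
  from assms(1) obtain e w where e: "\<And>x r. exec_le e (main x r) (poly w (tsize x)) (main (i x) r)"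
    by (rule PT_E) blast
  define test where "test = Seq c (Pop 0)"
  \<comment> \<open>Inside the loop the flag is the code \<open>[2, 1, 1]\<close> of
    \<open>True\<close>, which takes three pops; after the loop one pop removes the code
    \<open>[1]\<close> of \<open>False\<close>.\<close>
  define body where "body = Seq (Pop 0) (Seq (Pop 0) (Seq (Pop 0) (Seq d test)))"
  let ?v = "\<lambda>s r. st (code (enc (b s)) @ code (enc s) @ r) [] [] [] []"
  have test: "exec_le test (main s r) (poly q (tsize s) + 2) (?v s r)" for s r
  proof -
    have "exec_le (Pop 0) (main (b s, s) r) 1 (?v s r)"
      by (rule exec_runI) (auto simp: main_def enc_prod_def)
    from exec_le_mono[OF exec_le_Seq[OF c this]] show ?thesis by (simp add: test_def)
  qed
  define B where "B = (\<lambda>n. poly q (poly p n) + poly u (poly p n) + 20)"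
  have body: "exec_le body (?v s r) (B (tsize x)) (?v (f s) r)" if s: "Inv x s" "b s" for x s r
  proof -
    let ?c = "\<lambda>l. st (l @ code (enc s) @ r) [] [] [] []"
    have 1: "exec_le (Pop 0) (?v s r) 1 (?c [1, 1])" "exec_le (Pop 0) (?c [1, 1]) 1 (?c [1])"
      "exec_le (Pop 0) (?c [1]) 1 (main s r)"
      using s(2) by (auto intro!: exec_runI simp: main_def enc_bool_def)
    have "poly q (tsize (f s)) \<le> poly q (poly p (tsize x))" "poly u (tsize s) \<le> poly u (poly p (tsize x))"
      using size[OF s(1)] step[OF s] size[of x "f s"] by (auto intro!: poly_mono_nat)
    then show ?thesis unfolding body_def
      by (intro exec_le_mono[OF exec_le_Seq[OF 1(1) exec_le_Seq[OF 1(2) exec_le_Seq[OF 1(3) exec_le_Seq[OF d test]]]]])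
        (simp add: B_def)
  qed
  have loop: "exec_le (While 0 {2} body) (?v s r) (m s * (B (tsize x) + 1) + 1) (?v (h x) r)" if "Inv x s" for x s r
    using that
  proof (induction "m s" arbitrary: s rule: less_induct)
    case less
    show ?case
    proof (cases "b s")
      case True
      note st = step[OF less.prems True]
      have "exec_le (While 0 {2} body) (?v s r) (B (tsize x) + (m (f s) * (B (tsize x) + 1) + 1) + 1) (?v (h x) r)"
        by (rule exec_le_WhileT[OF _ _ body[OF less.prems True] less.hyps]) 
          (use True st in \<open>auto simp: enc_bool_def\<close>)
      moreover have "(m (f s) + 1) * (B (tsize x) + 1) \<le> m s * (B (tsize x) + 1)"
        using st by (intro mult_le_mono1) simp
      then have "B (tsize x) + (m (f s) * (B (tsize x) + 1) + 1) + 1 \<le> m s * (B (tsize x) + 1) + 1"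
        by (simp only: distrib_right mult_1)
      ultimately show ?thesis by (rule exec_le_mono)
    next
      case False
      then have "exec_le (While 0 {2} body) (?v s r) 1 (?v s r)"
        by (intro exec_le_WhileF) (auto simp: enc_bool_def)
      then show ?thesis using exit[OF less.prems False] by (auto elim: exec_le_mono)
    qed
  qed
  let ?b = "pcompose q p + pcompose u p + [:21:]"
  have "exec_le (Seq e (Seq test (Seq (While 0 {2} body) (Pop 0)))) (main x r)
     (poly (w + (pcompose q p + p * ?b + [:10:])) (tsize x)) (main (h x) r)" for x r
  proof -
    have 1: "exec_le (Pop 0) (?v (h x) r) 1 (main (h x) r)" if "\<not> b (h x)"
      using that by (intro exec_runI) (auto simp: main_def enc_bool_def)
    \<comment> \<open>A state of least measure among those satisfying the invariant must fail the
      test, and \<open>exit\<close> identifies it as \<open>h x\<close>.\<close>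
    have "\<exists>s. Inv x s \<and> \<not> b s" 
      by (rule ccontr) (use init[of x] step in \<open>metis (lifting) ex_has_least_nat linorder_not_less\<close>)
    then have nb: "\<not> b (h x)" using exit by blast
    have "poly q (tsize (i x)) \<le> poly q (poly p (tsize x))"
      by (rule poly_mono_nat[OF size[OF init]])
    moreover have "m (i x) * (B (tsize x) + 1) \<le> poly p (tsize x) * (B (tsize x) + 1)"
      using count by (rule mult_le_mono1)
    moreover have "poly (w + (pcompose q p + p * ?b + [:10:])) (tsize x) =
        poly w (tsize x) + (poly q (poly p (tsize x)) + poly p (tsize x) * (B (tsize x) + 1) + 10)"
      by (simp add: poly_pcompose B_def algebra_simps)
    ultimately show ?thesis
      by (intro exec_le_mono[OF exec_le_Seq[OF e exec_le_Seq[OF test exec_le_Seq[OF loop[OF init] 1[OF nb]]]]])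
        linarith
  qed
  then show ?thesis by (rule PT_I)
qed

declare One_nat_def [simp]

section \<open>Closure properties\<close>

lemma PT_comp2:
  assumes "PT (\<lambda>p. F (fst p) (snd p))" "PT f" "PT g"
  shows "PT (\<lambda>x. F (f x) (g x))"
  using PT_comp[OF assms(1) PT_Pair[OF assms(2,3)]] by simp

lemma PT_comp3:
  assumes "PT (\<lambda>p. F (fst (fst p)) (snd (fst p)) (snd p))" "PT f" "PT g" "PT h"
  shows "PT (\<lambda>x. F (f x) (g x) (h x))"
  using PT_comp[OF assms(1) PT_Pair[OF PT_Pair[OF assms(2,3)] assms(4)]] by simp

lemmas PT_base = PT_const PT_id PT_fst' PT_snd' PT_Pair PT_Cons

lemma PT_nonempty: "PT l \<Longrightarrow> PT (\<lambda>x. l x \<noteq> [])"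
proof -
  assume "PT l"
  then have "PT (\<lambda>x. case l x of [] \<Rightarrow> False | y # ys \<Rightarrow> True)"
    by (rule PT_case_list) (rule PT_const)+
  moreover have "(\<lambda>x. case l x of [] \<Rightarrow> False | y # ys \<Rightarrow> True) = (\<lambda>x. l x \<noteq> [])"
    by (auto split: list.splits)
  ultimately show ?thesis by simp
qed

lemma PT_cong: "PT f \<Longrightarrow> (\<And>x. g x = f x) \<Longrightarrow> PT g"
  by (rule PT_cast) auto

lemma PT_not: "PT b \<Longrightarrow> PT (\<lambda>x. \<not> b x)"
  by (rule PT_cong[OF PT_if[OF _ PT_const PT_const, of b False True]]) auto

lemma PT_conj: "PT b \<Longrightarrow> PT c \<Longrightarrow> PT (\<lambda>x. b x \<and> c x)"
  by (rule PT_cong[OF PT_if[OF _ _ PT_const, of b c False]]) auto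

lemma tsize_drop: "tsize (drop n xs) \<le> tsize xs"
proof (induction xs arbitrary: n)
  case (Cons x xs)
  then show ?case by (cases n) (auto intro: le_SucI trans_le_add2)
qed simp

lemma tsize_member: "y \<in> set xs \<Longrightarrow> tsize y \<le> tsize xs"
  by (induction xs) auto

lemma length_le_tsize: "length xs \<le> tsize xs"
  by (induction xs) auto

lemma PT_fold:
  assumes "PT l" "PT a" "PT (\<lambda>p. f (fst (fst p)) (snd (fst p)) (snd p))"
    and bound: "\<And>x n. tsize (fold (f x) (take n (l x)) (a x)) \<le> poly p (tsize x)"
  shows "PT (\<lambda>x. fold (f x) (l x) (a x))"
proof -
  define g where "g s = (case fst s of [] \<Rightarrow> s | y # ys \<Rightarrow> (ys, fst (snd s), f (fst (snd s)) y (snd (snd s))))" for s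
  obtain q where q: "\<And>x. tsize (l x) \<le> poly q (tsize x)" by (rule PT_tsize[OF assms(1)]) blast
  define Inv where "Inv x s \<longleftrightarrow> (\<exists>n \<le> length (l x). s = (drop n (l x), x, fold (f x) (take n (l x)) (a x)))" for x s
  have "PT (\<lambda>x. ([] :: 'b list, x, fold (f x) (l x) (a x)))"
  proof (rule PT_while)
    show "PT (\<lambda>x. (l x, x, a x))" by (intro PT_base assms)
    show "PT g" unfolding g_def by (intro PT_case_list PT_base PT_comp3[OF assms(3)])
    show "PT (\<lambda>s. fst s \<noteq> ([] :: 'b list))" by (intro PT_nonempty PT_base)
    show "Inv x (l x, x, a x)" for x unfolding Inv_def by (intro exI[of _ 0]) simp
    show "Inv x (g s) \<and> length (fst (g s)) < length (fst s)" if "Inv x s" "fst s \<noteq> []" for x s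
    proof -
      from that(1) obtain n where n: "s = (drop n (l x), x, fold (f x) (take n (l x)) (a x))" 
        unfolding Inv_def by blast
      with that(2) have "n < length (l x)" by simp
      then show ?thesis unfolding Inv_def n g_def
        by (auto simp flip: Cons_nth_drop_Suc simp: take_Suc_conv_app_nth intro!: exI[of _ "Suc n"])
    qed
    show "s = ([], x, fold (f x) (l x) (a x))" if "Inv x s" "\<not> fst s \<noteq> []" for x s
      using that unfolding Inv_def by auto
    show "tsize s \<le> poly (q + [:0, 1:] + p + [:2:]) (tsize x)" if "Inv x s" for x s
    proof -
      from that obtain n where n: "s = (drop n (l x), x, fold (f x) (take n (l x)) (a x))" 
        unfolding Inv_def by blast
      show ?thesis using tsize_drop[of n "l x"] q[of x] bound[of x n] unfolding n by simp
    qed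
    show "length (fst (l x, x, a x)) \<le> poly (q + [:0, 1:] + p + [:2:]) (tsize x)" for x
      using length_le_tsize[of "l x"] q[of x] by simp
  qed
  then show ?thesis using PT_comp[OF PT_snd PT_comp[OF PT_snd]] by fastforce
qed

text \<open>The increment may depend on \<open>x\<close> and on the list element but not on the
  accumulator: it then adds up over the list instead of multiplying.\<close>

lemma PT_fold_growth:
  assumes "PT l" "PT a" "PT (\<lambda>p. f (fst (fst p)) (snd (fst p)) (snd p))"
    and growth: "\<And>x y z. tsize (f x y z) \<le> tsize z + poly p (tsize x + tsize y)"
  shows "PT (\<lambda>x. fold (f x) (l x) (a x))"
proof -
  obtain q where q: "\<And>x. tsize (l x) \<le> poly q (tsize x)" by (rule PT_tsize[OF assms(1)]) blast
  obtain s where s: "\<And>x. tsize (a x) \<le> poly s (tsize x)" by (rule PT_tsize[OF assms(2)]) blast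
  have "tsize (fold (f x) (take n (l x)) (a x)) \<le> poly (s + q * pcompose p ([:0, 1:] + q)) (tsize x)" for x n
  proof -
    let ?B = "poly p (tsize x + poly q (tsize x))"
    have "tsize (fold (f x) ys z) \<le> tsize z + length ys * ?B" if "set ys \<subseteq> set (l x)" for ys z
      using that
    proof (induction ys arbitrary: z)
      case (Cons y ys)
      have "tsize y \<le> poly q (tsize x)" using Cons.prems tsize_member[of y "l x"] q[of x] by auto
      then have "tsize (f x y z) \<le> tsize z + ?B"
        using growth[of x y z] poly_mono_nat[of "tsize x + tsize y" "tsize x + poly q (tsize x)" p] by simp
      then show ?case using Cons.IH[of "f x y z"] Cons.prems by simp
    qed simp
    from this[of "take n (l x)" "a x"] have "tsize (fold (f x) (take n (l x)) (a x)) \<le>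
        tsize (a x) + length (take n (l x)) * ?B" by (meson set_take_subset)
    also have "\<dots> \<le> poly s (tsize x) + poly q (tsize x) * ?B"
      using s[of x] q[of x] length_le_tsize[of "l x"] by (intro add_mono mult_le_mono1) auto
    finally show ?thesis by (simp add: poly_pcompose)
  qed
  then show ?thesis by (intro PT_fold[OF assms(1-3)])
qed

section \<open>Lists, unary arithmetic and equality\<close>

lemma PT_rev: 
  assumes "PT l" 
  shows "PT (\<lambda>x. rev (l x))"
proof -
  have "PT (\<lambda>x. fold Cons (l x) [])"
    by (rule PT_fold_growth[where p = "[:1, 1:]"]) (intro PT_base assms | simp)+
  then show ?thesis by (simp add: fold_Cons_rev)
qed

lemma PT_append: 
  assumes "PT l" "PT k" 
  shows "PT (\<lambda>x. l x @ k x)"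
proof -
  have "PT (\<lambda>x. fold Cons (rev (l x)) (k x))"
    by (rule PT_fold_growth[where p = "[:1, 1:]"]) (intro PT_base PT_rev assms | simp)+
  then show ?thesis by (simp add: fold_Cons_rev)
qed

lemma tsize_append: "tsize (xs @ ys) \<le> tsize xs + tsize ys"
  by (induction xs) auto

lemma PT_concat_map:
  assumes "PT l" "PT (\<lambda>p. f (fst p) (snd p))"
  shows "PT (\<lambda>x. concat (map (f x) (l x)))"
proof -
  obtain q where q: "\<And>p. tsize (f (fst p) (snd p)) \<le> poly q (tsize p)" by (rule PT_tsize[OF assms(2)]) blast
  have "PT (\<lambda>x. fold (\<lambda>y z. f x y @ z) (rev (l x)) [])"
  proof (rule PT_fold_growth)
    show "tsize (f x y @ z) \<le> tsize z + poly (pcompose q [:1, 1:]) (tsize x + tsize y)" for x y z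
      using tsize_append[of "f x y" z] q[of "(x, y)"] by (simp add: poly_pcompose add.commute)
  qed (intro PT_base PT_append PT_rev PT_comp2[OF assms(2)] assms(1))+
  moreover have "fold (\<lambda>y z. f x y @ z) (rev xs) [] = concat (map (f x) xs)" for x xs
    by (induction xs) auto
  ultimately show ?thesis by simp
qed

lemma PT_concat: "PT l \<Longrightarrow> PT (\<lambda>x. concat (l x))"
  using PT_concat_map[of l "\<lambda>x y. y"] by (simp add: PT_base)

lemma PT_map:
  assumes "PT l" "PT (\<lambda>p. f (fst p) (snd p))"
  shows "PT (\<lambda>x. map (f x) (l x))"
  using PT_concat_map[OF assms(1), of "\<lambda>x y. [f x y]"] PT_Cons[OF assms(2) PT_const]
  by (simp add: concat_map_singleton)

lemma PT_filter:
  assumes "PT l" "PT (\<lambda>p. f (fst p) (snd p))"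
  shows "PT (\<lambda>x. filter (f x) (l x))"
proof -
  have "concat (map (\<lambda>y. if P y then [y] else []) xs) = filter P xs" for P and xs :: "'b list"
    by (induction xs) auto
  then show ?thesis
    using PT_concat_map[OF assms(1), of "\<lambda>x y. if f x y then [y] else []"]
      PT_if[OF assms(2) PT_Cons[OF PT_snd PT_const] PT_const, of "[]" "[]"] by simp
qed

lemma PT_ball:
  assumes "PT l" "PT (\<lambda>p. f (fst p) (snd p))"
  shows "PT (\<lambda>x. \<forall>y \<in> set (l x). f x y)"
  using PT_not[OF PT_nonempty[OF PT_filter[OF assms(1) PT_not[OF assms(2)]]]] 
  by (simp add: filter_empty_conv)

lemma PT_bex:
  assumes "PT l" "PT (\<lambda>p. f (fst p) (snd p))"
  shows "PT (\<lambda>x. \<exists>y \<in> set (l x). f x y)"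
  using PT_nonempty[OF PT_filter[OF assms]] by (simp add: filter_empty_conv)

text \<open>\<open>n\<close> has the code of a list of \<open>n\<close> units, so arithmetic and
  counting loops reduce to list functions.\<close>

lemma PT_units: "PT n \<Longrightarrow> PT (\<lambda>x. replicate (n x) ())"
proof (rule PT_cast)
  have "enc (replicate m ()) = enc m" for m
    by (induction m) (auto simp: enc_unit_def)
  then show "enc (replicate (n x) ()) = enc (n x)" for x .
qed

lemma PT_length: "PT l \<Longrightarrow> PT (\<lambda>x. length (l x))"
proof (rule PT_cast)
  assume "PT l"
  then show "PT (\<lambda>x. map (\<lambda>y. ()) (l x))" by (rule PT_map) (rule PT_const)
  have "enc (length xs) = enc (map (\<lambda>y. ()) xs)" for xs :: "'b list"
    by (induction xs) (auto simp: enc_unit_def)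
  then show "enc (length (l x)) = enc (map (\<lambda>y. ()) (l x))" for x by blast
qed

lemma PT_replicate: 
  assumes "PT n" "PT f" 
  shows "PT (\<lambda>x. replicate (n x) (f x))"
proof -
  have "PT (\<lambda>x. map (\<lambda>y. f x) (replicate (n x) ()))"
    by (intro PT_map PT_units PT_comp[OF assms(2)] PT_base assms)
  then show ?thesis by simp
qed

lemma PT_plus: 
  assumes "PT m" "PT n" 
  shows "PT (\<lambda>x. m x + n x :: nat)"
  using PT_length[OF PT_append[OF PT_units[OF assms(1)] PT_units[OF assms(2)]]] by simp

lemma PT_Suc: "PT n \<Longrightarrow> PT (\<lambda>x. Suc (n x))"
  using PT_plus[OF _ PT_const, of n 1] by simp

lemma PT_times: 
  assumes "PT m" "PT n" 
  shows "PT (\<lambda>x. m x * n x :: nat)"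
proof -
  have "PT (\<lambda>x. length (concat (map (\<lambda>y. replicate (n x) ()) (replicate (m x) ()))))"
    by (intro PT_length PT_concat_map PT_units PT_comp[OF assms(2)] PT_base assms)
  then show ?thesis by (simp add: length_concat sum_list_replicate)
qed

lemma PT_poly: "PT n \<Longrightarrow> PT (\<lambda>x. poly p (n x) :: nat)"
  by (induction p) (simp_all add: PT_const PT_plus PT_times)

lemma PT_drop: 
  assumes "PT n" "PT l" 
  shows "PT (\<lambda>x. drop (n x) (l x))"
proof -
  have tl: "PT (\<lambda>x. case snd x of [] \<Rightarrow> snd x | y # ys \<Rightarrow> ys)"
    by (intro PT_case_list PT_base)
  have "PT (\<lambda>x. fold (\<lambda>u k. case k of [] \<Rightarrow> k | y # ys \<Rightarrow> ys) (replicate (n x) ()) (l x))"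
  proof (rule PT_fold_growth)
    show "tsize (case k of [] \<Rightarrow> k | y # ys \<Rightarrow> ys) \<le> tsize k + poly 0 (tsize x + tsize y)" for x y and k :: "'b list"
      by (cases k) auto
  qed (intro tl PT_units assms)+
  moreover have "fold (\<lambda>u k. case k of [] \<Rightarrow> k | y # ys \<Rightarrow> ys) (replicate m ()) k = drop m k" for m and k :: "'b list"
    by (induction m arbitrary: k) (auto split: list.splits)
  ultimately show ?thesis by simp
qed

lemma PT_minus: 
  assumes "PT m" "PT n" 
  shows "PT (\<lambda>x. m x - n x :: nat)"
  using PT_length[OF PT_drop[OF assms(2) PT_units[OF assms(1)]]] by simp

lemma PT_le: 
  assumes "PT m" "PT n" 
  shows "PT (\<lambda>x. m x \<le> (n x :: nat))"
  using PT_not[OF PT_nonempty[OF PT_units[OF PT_minus[OF assms]]]] by simp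

lemma PT_upt: 
  assumes "PT n" 
  shows "PT (\<lambda>x. [0..<n x])"
proof -
  obtain q where q: "\<And>x. tsize (n x) \<le> poly q (tsize x)" by (rule PT_tsize[OF assms]) blast
  have 1: "((\<lambda>k. k @ [length k]) ^^ m) [] = [0..<m]" for m
    by (induction m) simp_all
  have 2: "tsize [0..<m] \<le> 1 + m * (2 * m + 2)" for m
  proof -
    have "tsize xs \<le> 1 + length xs * (2 * m + 2)" if "set xs \<subseteq> {..<m}" for xs
      using that by (induction xs) auto
    from this[of "[0..<m]"] show ?thesis by (simp add: lessThan_atLeast0)
  qed
  \<comment> \<open>The appended number grows with the accumulator, so \<open>PT_fold_growth\<close>
    does not apply; the closed form of the accumulator bounds its size.\<close>
  have "PT (\<lambda>x. fold (\<lambda>u k. k @ [length k]) (replicate (n x) ()) [])"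
  proof (rule PT_fold)
    show "tsize (fold (\<lambda>u k. k @ [length k]) (take m (replicate (n x) ())) []) \<le>
      poly (1 + q * ([:2:] * q + [:2:])) (tsize x)" for x m
    proof -
      have "tsize [0..<min m (n x)] \<le> 1 + min m (n x) * (2 * min m (n x) + 2)" by (rule 2)
      also have "\<dots> \<le> 1 + n x * (2 * n x + 2)" by (intro add_mono mult_le_mono) auto
      also have "\<dots> \<le> 1 + poly q (tsize x) * (2 * poly q (tsize x) + 2)"
        using q[of x] by (intro add_mono mult_le_mono) auto
      finally show ?thesis by (simp add: 1)
    qed
  qed (intro PT_append PT_base PT_length PT_units assms)+
  then show ?thesis by (simp add: 1)
qed

text \<open>The value of \<open>nth\<close> beyond the end is unspecified, so indexing is made
  computable by a default.\<close>

lemma PT_nth_or: 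
  assumes "PT l" "PT n" "PT d"
  shows "PT (\<lambda>x. if n x < length (l x) then l x ! n x else d x)"
proof (rule PT_cong)
  show "PT (\<lambda>x. case drop (n x) (l x) of [] \<Rightarrow> d x | y # ys \<Rightarrow> y)"
    by (intro PT_case_list PT_drop PT_base assms)
  show "(if n x < length (l x) then l x ! n x else d x) = (case drop (n x) (l x) of [] \<Rightarrow> d x | y # ys \<Rightarrow> y)" for x
    by (auto split: list.splits simp flip: Cons_nth_drop_Suc)
qed

text \<open>Read along its right spine, any tree is the code of a list of trees; this makes case
  distinction on lists available for trees.\<close>

fun subtrees :: "tree \<Rightarrow> tree list" where
  "subtrees Leaf = []"
| "subtrees (Node t u) = t # subtrees u"

lemma enc_subtrees: "enc (subtrees t) = enc t"
  by (induction t) (auto simp: enc_tree_def)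

lemma PT_subtrees: "PT f \<Longrightarrow> PT (\<lambda>x. subtrees (f x))"
  by (erule PT_cast) (rule enc_subtrees)

lemma subtrees_inject: "subtrees t = subtrees u \<longleftrightarrow> t = u"
  using enc_subtrees by (metis enc_inject)

text \<open>Equality of trees is decided with a worklist of pairs that still have to be compared.\<close>

definition compare_step :: 
    "(tree list \<times> tree list) list \<times> bool \<Rightarrow> (tree list \<times> tree list) list \<times> bool" where
  "compare_step s = (case fst s of [] \<Rightarrow> s | p # ws \<Rightarrow>
     (case fst p of
        [] \<Rightarrow> (case snd p of [] \<Rightarrow> (ws, True) | _ # _ \<Rightarrow> ([], False))
      | a # as \<Rightarrow> (case snd p of [] \<Rightarrow> ([], False)
          | b # bs \<Rightarrow> ((subtrees a, subtrees b) # (as, bs) # ws, True))))"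

definition compare_inv :: 
    "tree list \<times> tree list \<Rightarrow> (tree list \<times> tree list) list \<times> bool \<Rightarrow> bool" where
  "compare_inv x s \<longleftrightarrow> (snd s \<longrightarrow> (fst x = snd x \<longleftrightarrow> (\<forall>p \<in> set (fst s). fst p = snd p))) \<and>
    (\<not> snd s \<longrightarrow> fst s = [] \<and> fst x \<noteq> snd x) \<and> tsize (fst s) \<le> tsize [x]"

lemma tsize_subtrees: "tsize (subtrees t) = tsize t"
  by (simp add: tsize_def enc_subtrees)

text \<open>Splitting a pair of nonempty lists frees one node symbol on each side. The one on the
  left lowers the measure, and both together pay for the additional pair and list cell, so that the
  worklist does not grow.\<close>

lemma compare_step:
  assumes "compare_inv x s" "fst s \<noteq> []" 
  defines "m \<equiv> \<lambda>s. \<Sum>p\<leftarrow>fst s. tsize (fst p)"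
  shows "compare_inv x (compare_step s) \<and> m (compare_step s) < m s"
proof -
  obtain ps qs ws k where s: "s = ((ps, qs) # ws, k)"
    using assms(2) by (cases s; cases "fst s") auto
  show ?thesis
  proof (cases ps)
    case Nil
    then show ?thesis using assms(1) tsize_pos[of "[] :: tree list"] 
      by (cases qs) (auto simp: s compare_step_def compare_inv_def m_def)
  next
    case (Cons a as)
    then show ?thesis using assms(1) 
      by (cases qs) (auto simp: s compare_step_def compare_inv_def m_def tsize_subtrees subtrees_inject)
  qed
qed

lemma PT_eq:
  assumes "PT f" "PT g"
  shows "PT (\<lambda>x. f x = g x)"
proof -
  have "PT (\<lambda>x :: tree list \<times> tree list. ([] :: (tree list \<times> tree list) list, fst x = snd x))"
  proof (rule PT_while[where Inv = compare_inv and f = compare_step and b = "\<lambda>s. fst s \<noteq> []"])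
    show "PT (\<lambda>x :: tree list \<times> tree list. ([x], True))" by (intro PT_base)
    show "PT compare_step" unfolding compare_step_def
      by (intro PT_case_list PT_base PT_subtrees)
    show "PT (\<lambda>s. fst s \<noteq> ([] :: (tree list \<times> tree list) list))" by (intro PT_nonempty PT_base)
    show "compare_inv x ([x], True)" for x by (simp add: compare_inv_def)
    show "compare_inv x (compare_step s) \<and> (\<Sum>p\<leftarrow>fst (compare_step s). tsize (fst p)) < (\<Sum>p\<leftarrow>fst s. tsize (fst p))"
      if "compare_inv x s" "fst s \<noteq> []" for x s using compare_step[OF that] .
    show "s = ([], fst x = snd x)" if "compare_inv x s" "\<not> fst s \<noteq> []" for x s
      using that by (cases s) (auto simp: compare_inv_def)
    show "tsize s \<le> poly [:6, 1:] (tsize x)" if "compare_inv x s" for x s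
      using that tsize_bool[of "snd s"] by (cases s) (auto simp: compare_inv_def)
    show "(\<Sum>p\<leftarrow>fst ([x], True). tsize (fst p)) \<le> poly [:6, 1:] (tsize x)" for x :: "tree list \<times> tree list"
      by (cases x) simp
  qed
  note eq = PT_comp[OF PT_snd this]
  have "PT (\<lambda>x. subtrees (enc (f x)))" "PT (\<lambda>x. subtrees (enc (g x)))"
    by (intro PT_subtrees PT_cast[OF assms(1)] PT_cast[OF assms(2)]; simp add: enc_tree_def)+
  from PT_comp[OF eq PT_Pair[OF this]] show ?thesis
    by (rule PT_cong) (auto simp: subtrees_inject dest: enc_inject)
qed

lemma PT_member: "PT f \<Longrightarrow> PT l \<Longrightarrow> PT (\<lambda>x. f x \<in> set (l x))"
proof -
  assume f: "PT f" and l: "PT l"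
  have "PT (\<lambda>x. \<exists>y \<in> set (l x). y = f x)"
    by (intro PT_bex PT_eq PT_base l PT_comp[OF f])
  then show ?thesis by (rule PT_cong) auto
qed

lemma PT_remdups: 
  assumes "PT l"
  shows "PT (\<lambda>x. remdups (l x))"
proof -
  have "PT (\<lambda>x. fold (\<lambda>y z. if y \<in> set z then z else y # z) (rev (l x)) [])"
  proof (rule PT_fold_growth)
    show "tsize (if y \<in> set z then z else y # z) \<le> tsize z + poly [:1, 1:] (tsize x + tsize y)" for x :: 'a and y z
      by simp
  qed (intro PT_rev PT_if PT_member PT_base assms)+
  moreover have "fold (\<lambda>y z. if y \<in> set z then z else y # z) (rev xs) [] = remdups xs" for xs :: "'b list"
    by (induction xs) auto
  ultimately show ?thesis by simp
qed

lemma PT_distinct: "PT l \<Longrightarrow> PT (\<lambda>x. distinct (l x))"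
  by (rule PT_cong[OF PT_eq[OF PT_remdups]]) (auto simp: remdups_id_iff_distinct)

section \<open>Binary numerals, obtained by counting\<close>

fun increment :: "bool list \<Rightarrow> bool list" where
  "increment [] = [True]"
| "increment (b # bs) = (if b then False # increment bs else True # bs)"

lemma increment_binary: "increment (binary n) = binary (Suc n)"
proof (induction n rule: less_induct)
  case (less n)
  show ?case
  proof (cases "n = 0")
    case True
    then show ?thesis by (simp add: binary.simps[of "Suc 0"] binary.simps[of 0])
  next
    case False
    then show ?thesis using less[of "n div 2"]
      by (auto simp: binary.simps[of n] binary.simps[of "Suc n"] elim!: oddE evenE)
  qed
qed

lemma tsize_bools: "tsize (bs :: bool list) \<le> 1 + 4 * length bs"
proof (induction bs)
  case (Cons b bs)
  then show ?case using tsize_bool[of b] by simp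
qed simp

text \<open>The fold keeps the carry and the reversed output; a carry that survives the whole word
  becomes a new top bit.\<close>

lemma PT_increment: "PT l \<Longrightarrow> PT (\<lambda>x. increment (l x))"
proof -
  assume l: "PT l"
  define f where "f b s = (fst s \<and> b, (b \<noteq> fst s) # snd s)" for b and s :: "bool \<times> bool list"
  have 1: "fold f bs (c, z) = (c \<and> (\<forall>b\<in>set bs. b), rev (if c then take (length bs) (increment bs) else bs) @ z)" for bs c z
    by (induction bs arbitrary: c z) (auto simp: f_def)
  have 2: "increment bs = rev (snd (fold f bs (True, []))) @ (if fst (fold f bs (True, [])) then [True] else [])" for bs
    unfolding 1 by (induction bs) auto
  have "PT (\<lambda>x. fold f (l x) (True, []))"
  proof (rule PT_fold_growth)
    show "tsize (f y z) \<le> tsize z + poly [:10:] (tsize x + tsize y)" for x :: 'a and y z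
      using tsize_bool[of "y \<noteq> fst z"] tsize_bool[of "fst z \<and> y"] tsize_pos[of "fst z"]
      by (cases z) (simp add: f_def)
    show "PT (\<lambda>p :: ('a \<times> bool) \<times> bool \<times> bool list. f (snd (fst p)) (snd p))"
      unfolding f_def by (intro PT_conj PT_not PT_eq PT_base)
  qed (intro PT_base l)+
  note this = PT_append[OF PT_rev[OF PT_snd'[OF this]] PT_if[OF PT_fst'[OF this] PT_const PT_const]]
  then show ?thesis by (rule PT_cong) (rule 2)
qed

lemma length_binary: "length (binary n) \<le> n"
proof (induction n rule: less_induct)
  case (less n)
  show ?case
  proof (cases "n = 0")
    case False
    then have "length (binary (n div 2)) \<le> n div 2" "n div 2 < n" by (auto intro: less)
    then show ?thesis using False by (simp add: binary.simps[of n])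
  qed (simp add: binary.simps)
qed

lemma PT_binary:
  assumes "PT n"
  shows "PT (\<lambda>x. binary (n x))"
proof -
  obtain q where q: "\<And>x. tsize (n x) \<le> poly q (tsize x)" by (rule PT_tsize[OF assms]) blast
  have 1: "(increment ^^ m) [] = binary m" for m
    by (induction m) (simp_all add: increment_binary binary.simps[of 0])
  have "PT (\<lambda>x. fold (\<lambda>u. increment) (replicate (n x) ()) [])"
  proof (rule PT_fold)
    show "tsize (fold (\<lambda>u. increment) (take m (replicate (n x) ())) []) \<le> poly ([:1:] + [:4:] * q) (tsize x)" for x m
      using tsize_bools[of "binary (min m (n x))"] length_binary[of "min m (n x)"] q[of x] by (simp add: 1)
  qed (intro PT_increment PT_units PT_base assms)+
  then show ?thesis by (simp add: 1)
qed

lemmas PT_intros = PT_base PT_append PT_rev PT_concat PT_if PT_not PT_conj PT_Suc PT_length PT_replicate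
  PT_plus PT_times PT_minus PT_le PT_poly PT_drop PT_upt PT_eq PT_member PT_remdups PT_distinct PT_binary
  PT_concat_map PT_map PT_filter PT_ball PT_bex

section \<open>From stack programs to Turing machines\<close>

declare One_nat_def [simp del]

definition read_bit :: "nat \<Rightarrow> com" where
  "read_bit a = (if a = 1 then Seq (Push 0 1) (Push 0 2)
     else if a = 2 then Seq (Push 0 1) (Seq (Push 0 1) (Seq (Push 0 2) (Push 0 2)))
     else Push 0 1)"

definition read_input :: com where
  "read_input = Seq (pour 0 1) (Seq (Push 0 1) (drain 1 read_bit))"

text \<open>Bits become list cells in prefix code, and the separator becomes the end of the first
  list, so that a pair only lacks the symbol 2 in front. The word is processed from its end, hence
  \<open>read_bit\<close> pushes the same symbols last to first.\<close>

fun deserialize :: "nat list \<Rightarrow> nat list" where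
  "deserialize [] = [1]"
| "deserialize (a # d) = (if a = 1 then [2, 1] else if a = 2 then [2, 2, 1, 1] else [1]) @ deserialize d"

lemma exec_read_input:
  assumes "set w \<subseteq> {1, 2, 3}"
  shows "exec_le read_input (st w [] [] [] []) (30 * length w + 6) (st (deserialize w) [] [] [] [])"
proof -
  have 1: "exec_le (pour 0 1) (st w [] [] [] []) (7 * length w + 1) (st [] (rev w) [] [] [])"
    using exec_pour(1)[OF assms, of "[]"] by simp
  have 2: "exec_le (Push 0 1) (st [] (rev w) [] [] []) 2 (st [1] (rev w) [] [] [])"
    by (rule exec_runI) auto
  have "exec_le (drain 1 read_bit) (st (deserialize []) (rev w) [] [] []) ((11 + 5) * length (rev w) + 1)
      (st (deserialize (rev (rev w) @ [])) [] [] [] [])"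
  proof (rule exec_drain[where G = "\<lambda>l d. st (deserialize d) l [] [] []"])
    show "exec_le (read_bit a) ((st (deserialize d) (a # l) [] [] [])(1 := l)) 11 (st (deserialize (a # d)) l [] [] [])"
      if "a \<in> {1, 2, 3}" for a l d
      using that by (intro exec_runI) (auto simp: read_bit_def)
  qed (use assms in auto)
  then have 3: "exec_le (drain 1 read_bit) (st [1] (rev w) [] [] []) (16 * length w + 1) (st (deserialize w) [] [] [] [])"
    by simp
  show ?thesis unfolding read_input_def
    by (rule exec_le_mono[OF exec_le_Seq[OF 1 exec_le_Seq[OF 2 3]]]) simp
qed

lemma deserialize_symbols: "deserialize (symbols bs) = code (enc bs)"
  by (induction bs) (auto simp: symbols_def enc_bool_def)

lemma deserialize_pair: "2 # deserialize (pair_symbols x u) = code (enc (x, u))"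
proof -
  have "deserialize (symbols x @ 3 # w) = code (enc x) @ deserialize w" for w
    by (induction x) (auto simp: symbols_def enc_bool_def)
  then show ?thesis by (simp add: pair_symbols_def deserialize_symbols enc_prod_def)
qed

definition write_output :: com where
  "write_output = While 0 {2} (Seq (Pop 0) (Cond 0 {1} (Seq (Pop 0) (Out 1))
     (Seq (Pop 0) (Seq (Pop 0) (Seq (Pop 0) (Out 2))))))"

lemma exec_write_output:
  "exec_le write_output (st (code (enc (bs :: bool list))) [] [] [] v) (11 * length bs + 1) 
    (st [1] [] [] [] (rev (symbols bs) @ v))"
proof (induction bs arbitrary: v)
  case Nil
  then show ?case unfolding write_output_def by (auto intro!: exec_le_WhileF simp: symbols_def)
next
  case (Cons b bs)
  have "exec_le (Seq (Pop 0) (Cond 0 {1} (Seq (Pop 0) (Out 1))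
     (Seq (Pop 0) (Seq (Pop 0) (Seq (Pop 0) (Out 2)))))) (st (code (enc (b # bs))) [] [] [] v) 10
     (st (code (enc bs)) [] [] [] ((if b then 2 else 1) # v))"
    by (rule exec_runI) (auto simp: enc_bool_def)
  from exec_le_WhileT[OF _ _ this Cons.IH[unfolded write_output_def]]
  show ?case unfolding write_output_def by (auto simp: symbols_def elim!: exec_le_mono)
qed

declare One_nat_def [simp]

lemma set_symbols: "set (symbols x) \<subseteq> {1, 2, 3}" "set (pair_symbols x u) \<subseteq> {1, 2, 3}"
  by (auto simp: symbols_def pair_symbols_def)

text \<open>The prelude \<open>d\<close> will be a no-op for functions; for relations it pushes the
  2 that a pair still lacks.\<close>

lemma computes_outputs:
  assumes c: "\<And>x r. exec_le c (main x r) (poly p (tsize x)) (main (f x :: bool list) r)"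
    and q: "\<And>x. length (f x) \<le> poly q (tsize x)"
  obtains M s where "turing_machine M"
    "\<And>w x. set w \<subseteq> {1, 2, 3} \<Longrightarrow> pre @ deserialize w = code (enc x) \<Longrightarrow> loopfree d \<Longrightarrow>
      run d (st (deserialize w) [] [] [] []) = main x [] \<Longrightarrow>
      outputs_within M w (poly s (length w + tsize x)) (symbols (f x))"
proof -
  define e where "e = Seq read_input (Seq d (Seq c write_output))"
  obtain M where M: "turing_machine M"
    "\<And>w t s T v. exec e ((\<lambda>_. [])(0 := w)) t s \<Longrightarrow> t \<le> T \<Longrightarrow> s 4 = rev v \<Longrightarrow> outputs_within M w T v"
    by (rule stack_program_tm) blast
  define s where "s = [:10 + cost d:] + [:0, 30:] + p + [:11:] * q"
  show ?thesis
  proof (rule that)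
    fix w and x :: 'a
    assume w: "set w \<subseteq> {1, 2, 3}" and d: "loopfree d" "run d (st (deserialize w) [] [] [] []) = main x []"
    have 4: "exec_le write_output (main (f x) []) (11 * length (f x) + 1) (st [1] [] [] [] (rev (symbols (f x))))"
      using exec_write_output[of "f x" "[]"] by (simp add: main_def)
    have "exec_le e (st w [] [] [] []) (30 * length w + 6 + (cost d + (poly p (tsize x) + (11 * length (f x) + 1) + 1) + 1) + 1)
        (st [1] [] [] [] (rev (symbols (f x))))"
      unfolding e_def
      by (intro exec_le_Seq[OF exec_read_input[OF w]] exec_le_Seq[OF exec_runI[OF d order_refl]] exec_le_Seq[OF c] 4)
    moreover have "poly s (length w + tsize x) \<ge> 
        30 * length w + 6 + (cost d + (poly p (tsize x) + (11 * length (f x) + 1) + 1) + 1) + 1"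
      using q[of x] poly_mono_nat[of "tsize x" "length w + tsize x" q] 
        poly_mono_nat[of "tsize x" "length w + tsize x" p] by (simp add: s_def)
    ultimately have "exec_le e (st w [] [] [] []) (poly s (length w + tsize x)) (st [1] [] [] [] (rev (symbols (f x))))"
      by (rule exec_le_mono)
    moreover have "st w [] [] [] [] = (\<lambda>_. [])(0 := w)" by (auto simp: st_def)
    ultimately show "outputs_within M w (poly s (length w + tsize x)) (symbols (f x))"
      unfolding exec_le_def using M(2) by (metis st_apply(5))
  qed (rule M(1))
qed

lemma outputs_within_mono:
  assumes "outputs_within M w t v" "t \<le> T"
  shows "outputs_within M w T v"
proof -
  obtain q ts where q: "(step M ^^ t) (initial M w) = (q, ts)" by fastforce
  have "(step M ^^ n) (num_states M, ts) = (num_states M, ts)" for n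
    by (induction n) auto
  then have "(step M ^^ T) (initial M w) = (q, ts)" if "q = num_states M"
    using that q funpow_add_apply[of t "T - t" "step M" "initial M w"] assms(2) by simp
  then show ?thesis using assms(1) q by (auto simp: outputs_within_def)
qed

lemma length_le_PT:
  assumes "PT f"
  obtains q where "\<And>x. length (f x) \<le> poly q (tsize x)"
  using PT_tsize[OF assms] length_le_tsize le_trans by metis

theorem PT_polytime_function:
  assumes "PT f"
  shows "polytime_function f"
proof -
  from assms obtain c p where c: "\<And>x r. exec_le c (main x r) (poly p (tsize x)) (main (f x) r)"
    by (rule PT_E) blast
  obtain q where q: "\<And>x. length (f x) \<le> poly q (tsize x)" by (rule length_le_PT[OF assms]) blast
  obtain M s where M: "turing_machine M"
    "\<And>w x. set w \<subseteq> {1, 2, 3} \<Longrightarrow> [] @ deserialize w = code (enc x) \<Longrightarrow> loopfree (Pop 3) \<Longrightarrow>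
      run (Pop 3) (st (deserialize w) [] [] [] []) = main x [] \<Longrightarrow>
      outputs_within M w (poly s (length w + tsize x)) (symbols (f x))"
    using computes_outputs[where c = c and p = p and f = f and q = q, OF c q] by blast
  have "outputs_within M (symbols x) (poly (pcompose s [:1, 5:]) (length x)) (symbols (f x))" for x
  proof (rule outputs_within_mono)
    show "outputs_within M (symbols x) (poly s (length (symbols x) + tsize x)) (symbols (f x))"
      by (rule M(2)) (auto simp: set_symbols[simplified] deserialize_symbols main_def)
    show "poly s (length (symbols x) + tsize x) \<le> poly (pcompose s [:1, 5:]) (length x)"
      using tsize_bools[of x] by (auto simp: poly_pcompose symbols_def intro!: poly_mono_nat)
  qed
  then show ?thesis unfolding polytime_function_def using M(1) by blast
qed

theorem PT_polytime_relation:
  assumes "PT (\<lambda>p. R (fst p) (snd p))"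
  shows "polytime_relation R"
proof -
  define f where "f p = [R (fst p) (snd p)]" for p
  have "PT f" unfolding f_def by (intro PT_intros assms)
  then obtain c p where c: "\<And>x r. exec_le c (main x r) (poly p (tsize x)) (main (f x) r)"
    by (rule PT_E) blast
  obtain q where q: "\<And>x. length (f x) \<le> poly q (tsize x)" by (rule length_le_PT[OF \<open>PT f\<close>]) blast
  obtain M s where M: "turing_machine M"
    "\<And>w x. set w \<subseteq> {1, 2, 3} \<Longrightarrow> [2] @ deserialize w = code (enc x) \<Longrightarrow> loopfree (Push 0 2) \<Longrightarrow>
      run (Push 0 2) (st (deserialize w) [] [] [] []) = main x [] \<Longrightarrow>
      outputs_within M w (poly s (length w + tsize x)) (symbols (f x))"
    using computes_outputs[where c = c and p = p and f = f and q = q, OF c q] by blast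
  have "outputs_within M (pair_symbols x u) (poly (pcompose s [:4, 5:]) (length x + length u)) (symbols [R x u])" for x u
  proof (rule outputs_within_mono)
    show "outputs_within M (pair_symbols x u) (poly s (length (pair_symbols x u) + tsize (x, u))) (symbols [R x u])"
      using M(2)[of "pair_symbols x u" "(x, u)"] set_symbols(2) deserialize_pair 
      by (auto simp: main_def f_def)
    show "poly s (length (pair_symbols x u) + tsize (x, u)) \<le> poly (pcompose s [:4, 5:]) (length x + length u)"
      using tsize_bools[of x] tsize_bools[of u] 
      by (auto simp: poly_pcompose symbols_def pair_symbols_def intro!: poly_mono_nat)
  qed
  then show ?thesis unfolding polytime_relation_def using M(1) by blast
qed

section \<open>Conformant bribery as a list of vote pairs\<close>

definition vetoes :: "'a vote list \<Rightarrow> 'a \<Rightarrow> nat" where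
  "vetoes V c = length (filter (\<lambda>v. c \<in> bottom3 v) V)"

lemma vetoes_simps [simp]:
  "vetoes [] c = 0"
  "vetoes (v # V) c = (if c \<in> bottom3 v then Suc (vetoes V c) else vetoes V c)"
  "vetoes (V @ V') c = vetoes V c + vetoes V' c"
  by (auto simp: vetoes_def)

lemma veto3_score_vetoes: "veto3_score V c = - int (vetoes V c)"
  by (induction V) (auto simp: veto3_score_def)

lemma veto3_winners_vetoes:
  "p \<in> veto3_winners C V \<longleftrightarrow> p \<in> C \<and> (\<forall>d \<in> C. vetoes V p \<le> vetoes V d)"
  by (auto simp: veto3_winners_def veto3_score_vetoes)

definition bribe_pairs :: "'a vote list \<Rightarrow> nat \<Rightarrow> ('a vote \<times> 'a vote) list \<Rightarrow> bool" where
  "bribe_pairs V k W \<longleftrightarrow> map fst W = V \<and> snd ` set W \<subseteq> set V \<and>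
     length (filter (\<lambda>w. fst w \<noteq> snd w) W) \<le> k"

text \<open>Giving a bribed voter the old vote changes nothing, so it is enough to count the voters
  whose vote really changes; their positions serve as \<open>S\<close>.\<close>

lemma bribable_pairs:
  "veto3_conformant_bribable C V k p \<longleftrightarrow>
     (\<exists>W. bribe_pairs V k W \<and> p \<in> veto3_winners C (map snd W))"
proof
  assume "veto3_conformant_bribable C V k p"
  then obtain S V' where S: "card S \<le> k" "conformant_bribery V S V'" and p: "p \<in> veto3_winners C V'"
    unfolding veto3_conformant_bribable_def by blast
  have l: "length V' = length V" and S': "S \<subseteq> {..<length V}"
    and i: "\<And>i. i < length V \<Longrightarrow> if i \<in> S then V' ! i \<in> set V else V' ! i = V ! i"
    using S(2) by (auto simp: conformant_bribery_def)
  have "length (filter (\<lambda>w. fst w \<noteq> snd w) (zip V V')) \<le> card S"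
    unfolding length_filter_conv_card
  proof (rule card_mono)
    show "{j. j < length (zip V V') \<and> fst (zip V V' ! j) \<noteq> snd (zip V V' ! j)} \<subseteq> S"
      using i l by (auto split: if_splits) metis
  qed (use S' finite_subset in blast)
  moreover have "snd ` set (zip V V') \<subseteq> set V"
    using i l by (auto simp: set_zip split: if_splits) (metis nth_mem)
  ultimately have "bribe_pairs V k (zip V V')" using S(1) l by (auto simp: bribe_pairs_def)
  then show "\<exists>W. bribe_pairs V k W \<and> p \<in> veto3_winners C (map snd W)"
    using p l by (intro exI[of _ "zip V V'"]) auto
next
  assume "\<exists>W. bribe_pairs V k W \<and> p \<in> veto3_winners C (map snd W)"
  then obtain W where W: "bribe_pairs V k W" "p \<in> veto3_winners C (map snd W)" by blast
  define S where "S = {i. i < length W \<and> fst (W ! i) \<noteq> snd (W ! i)}"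
  have "card S \<le> k" using W(1) by (simp add: S_def bribe_pairs_def length_filter_conv_card)
  moreover have "conformant_bribery V S (map snd W)"
    using W(1) by (force simp: bribe_pairs_def conformant_bribery_def S_def)
  ultimately show "veto3_conformant_bribable C V k p"
    using W(2) unfolding veto3_conformant_bribable_def by blast
qed

lemma vetoes_map:
  assumes "inj f"
  shows "vetoes (map (map f) V) (f c) = vetoes V c"
proof -
  have "f c \<in> bottom3 (map f v) \<longleftrightarrow> c \<in> bottom3 v" for v
    by (simp add: bottom3_def drop_map inj_image_mem_iff[OF assms])
  then show ?thesis by (induction V) auto
qed

text \<open>Used with \<open>binary\<close> to let the verifier work on words, and with
  \<open>label\<close> to name the candidates of the reduction by numbers.\<close>

lemma bribable_rename:
  assumes f: "inj f"
  shows "veto3_conformant_bribable (f ` C) (map (map f) V) k (f p) \<longleftrightarrow>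
    veto3_conformant_bribable C V k p"
proof -
  let ?F = "map_prod (map f) (map f)"
  have win: "f p \<in> veto3_winners (f ` C) (map snd (map ?F W)) \<longleftrightarrow> p \<in> veto3_winners C (map snd W)" for W
  proof -
    have "map snd (map ?F W) = map (map f) (map snd W)" by (induction W) auto
    then show ?thesis using vetoes_map[OF f] inj_image_mem_iff[OF f]
      by (simp add: veto3_winners_vetoes del: map_map)
  qed
  have pairs: "bribe_pairs (map (map f) V) k (map ?F W) \<longleftrightarrow> bribe_pairs V k W" for W
  proof -
    have inj: "inj (map f)" using f by simp
    have "map fst (map ?F W) = map (map f) (map fst W)" by (induction W) auto
    moreover have "snd ` set (map ?F W) = map f ` snd ` set W" by force
    moreover have "length (filter (\<lambda>w. fst w \<noteq> snd w) (map ?F W)) = length (filter (\<lambda>w. fst w \<noteq> snd w) W)"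
      using injD[OF inj] by (induction W) auto
    ultimately show ?thesis using inj inj_image_subset_iff[OF inj] 
      unfolding bribe_pairs_def by (metis (no_types, lifting) inj_map_eq_map list.set_map)
  qed
  \<comment> \<open>New votes are copies of old ones, so every bribery of the renamed election
    consists of renamed votes.\<close>
  have "\<exists>W. W' = map ?F W" if "bribe_pairs (map (map f) V) k W'" for W'
  proof -
    have "\<exists>u. w = ?F u" if w: "w \<in> set W'" for w
    proof -
      have "fst w \<in> set (map fst W')" "snd w \<in> snd ` set W'" using w by auto
      then have "fst w \<in> range (map f)" "snd w \<in> range (map f)"
        using \<open>bribe_pairs (map (map f) V) k W'\<close> unfolding bribe_pairs_def by auto
      then show ?thesis by (metis imageE map_prod_simp prod.collapse)
    qed
    then show ?thesis unfolding ex_map_conv by blast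
  qed
  then show ?thesis unfolding bribable_pairs using win pairs by metis
qed

section \<open>Numerals\<close>

fun unbinary :: "bool list \<Rightarrow> nat" where
  "unbinary [] = 0"
| "unbinary (b # bs) = (if b then 1 else 0) + 2 * unbinary bs"

lemma unbinary_binary: "unbinary (binary n) = n"
proof (induction n rule: less_induct)
  case (less n)
  then show ?case by (cases "n = 0") (auto simp: binary.simps[of n] binary.simps[of 0])
qed

text \<open>These words form the range of \<open>binary\<close>: the most significant bit comes last
  and is not 0.\<close>

definition numeral_word :: "bool list \<Rightarrow> bool" where
  "numeral_word bs \<longleftrightarrow> (case rev bs of [] \<Rightarrow> True | b # _ \<Rightarrow> b)"

lemma binary_unbinary: "numeral_word bs \<Longrightarrow> binary (unbinary bs) = bs"
proof (induction bs)
  case (Cons b bs)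
  have n: "numeral_word bs" "bs = [] \<Longrightarrow> b"
    using Cons.prems by (auto simp: numeral_word_def split: list.splits)
  have "unbinary bs > 0 \<or> b"
    using n Cons.IH by (cases "unbinary bs") (auto simp: binary.simps)
  then have "binary (unbinary (b # bs)) = odd (unbinary (b # bs)) # binary (unbinary (b # bs) div 2)"
    by (subst binary.simps) auto
  moreover have "odd (unbinary (b # bs)) = b" "unbinary (b # bs) div 2 = unbinary bs" by auto
  ultimately show ?case using Cons.IH[OF n(1)] by simp
qed (simp add: binary.simps)

lemma numeral_word_binary: "numeral_word (binary n)"
proof (induction n rule: less_induct)
  case (less n)
  show ?case
  proof (cases "n = 0")
    case False
    have "binary (n div 2) = [] \<Longrightarrow> odd n"
      using False unbinary_binary[of "n div 2"] by (auto simp: div_eq_0_iff)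
    moreover have "numeral_word (binary (n div 2))" using False by (intro less) auto
    ultimately show ?thesis using False 
      by (auto simp: binary.simps[of n] numeral_word_def split: list.splits)
  qed (simp add: binary.simps numeral_word_def)
qed

lemma inj_binary: "inj binary"
  by (rule injI) (rule binary_inject)

lemma PT_encode_list:
  assumes "PT l" "PT (\<lambda>p. e (fst p) (snd p))"
  shows "PT (\<lambda>x. encode_list (e x) (l x))"
  unfolding encode_list_def by (intro PT_intros assms)

abbreviation encode_bits :: "bool list \<Rightarrow> bool list" where
  "encode_bits \<equiv> encode_list (\<lambda>b. [b])"

lemma encode_nat_binary: "encode_nat n = encode_bits (binary n)"
  by (simp add: encode_nat_def)

lemma encode_list_map: "encode_list e (map f xs) = encode_list (\<lambda>x. e (f x)) xs"
  by (simp add: encode_list_def comp_def)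

section \<open>Membership in NP\<close>

definition word_instance :: "bool list list \<Rightarrow> bool list list list \<Rightarrow> bool list \<Rightarrow> bool list \<Rightarrow> bool list" where
  "word_instance cs V k p = encode_list encode_bits cs @ encode_list (encode_list encode_bits) V @
     encode_bits k @ encode_bits p"

lemma encode_instance_word:
  "encode_instance cs V k p = word_instance (map binary cs) (map (map binary) V) (binary k) (binary p)"
  by (simp add: encode_instance_def word_instance_def encode_list_map encode_nat_binary[abs_def])

text \<open>The bribe limit may be exponential in the length of its numeral, out of reach of unary
  arithmetic. Only its comparison with a number of voters matters, so it is cut off there, and at
  every digit to keep intermediate values small.\<close>

fun capped :: "nat \<Rightarrow> bool list \<Rightarrow> nat" where
  "capped n [] = 0"
| "capped n (b # bs) = (let m = (if b then 1 else 0) + 2 * capped n bs in if m \<le> n then m else n)"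

lemma capped: "capped n bs = min n (unbinary bs)"
  by (induction bs) (auto simp: Let_def)

text \<open>
  Instead of parsing \<open>x\<close>, the verifier encodes the instance contained in the certificate and
  compares the result with \<open>x\<close>. Candidates and numbers are kept as binary words.
\<close>

definition certifies ::
    "bool list \<Rightarrow> bool list list \<Rightarrow> (bool list vote \<times> bool list vote) list \<Rightarrow> bool list \<Rightarrow> bool list \<Rightarrow> bool" where
  "certifies x cs W k p \<longleftrightarrow>
     x = word_instance cs (map fst W) k p \<and> (\<forall>c \<in> set cs. numeral_word c) \<and> numeral_word k \<and>
     distinct cs \<and> p \<in> set cs \<and>
     (\<forall>w \<in> set W. distinct (fst w) \<and> (\<forall>c \<in> set (fst w). c \<in> set cs) \<and> (\<forall>c \<in> set cs. c \<in> set (fst w)) \<and>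
       snd w \<in> set (map fst W)) \<and>
     length (filter (\<lambda>w. fst w \<noteq> snd w) W) \<le> capped (length W) k \<and>
     (\<forall>d \<in> set cs. vetoes (map snd W) p \<le> vetoes (map snd W) d)"

lemma problem_certifies:
  "x \<in> veto3_conformant_bribery_problem \<longleftrightarrow> (\<exists>cs W k p. certifies x cs W k p)"
proof
  assume "x \<in> veto3_conformant_bribery_problem"
  then obtain cs V k p where x: "x = encode_instance cs V k p" and cs: "distinct cs" "p \<in> set cs"
    and V: "election (set cs) V" and b: "veto3_conformant_bribable (set cs) V k p"
    unfolding veto3_conformant_bribery_problem_def by blast
  from b have "veto3_conformant_bribable (binary ` set cs) (map (map binary) V) k (binary p)"
    by (simp add: bribable_rename[OF inj_binary])
  then obtain W where W: "bribe_pairs (map (map binary) V) k W"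
      "binary p \<in> veto3_winners (binary ` set cs) (map snd W)"
    unfolding bribable_pairs by blast
  have fst: "map fst W = map (map binary) V" using W(1) by (simp add: bribe_pairs_def)
  have votes: "distinct (fst w) \<and> set (fst w) = binary ` set cs" if "w \<in> set W" for w
  proof -
    have "fst w \<in> set (map (map binary) V)" using that unfolding fst[symmetric] by simp
    then obtain u where u: "fst w = map binary u" "u \<in> set V" by auto
    with V have "set u = set cs" "distinct u" by (auto simp: election_def permutations_of_set_def)
    then show ?thesis using u(1) inj_on_subset[OF inj_binary subset_UNIV] by (simp add: distinct_map)
  qed
  have "certifies x (map binary cs) W (binary k) (binary p)"
    unfolding certifies_def
  proof (intro conjI ballI)
    show "x = word_instance (map binary cs) (map fst W) (binary k) (binary p)"
      by (simp add: x fst encode_instance_word)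
    show "distinct (map binary cs)"
      using cs inj_on_subset[OF inj_binary subset_UNIV] by (simp add: distinct_map)
    show "snd w \<in> set (map fst W)" if "w \<in> set W" for w
      using W(1) that unfolding bribe_pairs_def fst by blast
    show "length (filter (\<lambda>w. fst w \<noteq> snd w) W) \<le> capped (length W) (binary k)"
      using W(1) by (simp add: bribe_pairs_def capped unbinary_binary)
    show "vetoes (map snd W) (binary p) \<le> vetoes (map snd W) d" if "d \<in> set (map binary cs)" for d
      using W(2) that by (auto simp: veto3_winners_vetoes)
  qed (use votes cs numeral_word_binary in auto)
  then show "\<exists>cs W k p. certifies x cs W k p" by blast
next
  assume "\<exists>cs W k p. certifies x cs W k p"
  then obtain cs W k p where c: "certifies x cs W k p" by blast
  define cs' V' k' p' where d: "cs' = map unbinary cs" "V' = map (map unbinary) (map fst W)"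
    "k' = unbinary k" "p' = unbinary p"
  from c have x: "x = word_instance cs (map fst W) k p" and words: "\<And>c. c \<in> set cs \<Longrightarrow> numeral_word c"
    and k: "numeral_word k" and cs: "distinct cs" and p: "p \<in> set cs"
    and votes: "\<And>w. w \<in> set W \<Longrightarrow> distinct (fst w) \<and> set (fst w) = set cs"
    and new: "snd ` set W \<subseteq> set (map fst W)"
    and card: "length (filter (\<lambda>w. fst w \<noteq> snd w) W) \<le> unbinary k"
    and win: "\<And>d. d \<in> set cs \<Longrightarrow> vetoes (map snd W) p \<le> vetoes (map snd W) d"
    unfolding certifies_def capped by (simp_all add: subset_iff) blast+
  have num: "binary (unbinary c) = c" if "c \<in> set cs" for c
    using that by (intro binary_unbinary words)
  have 1: "map binary cs' = cs" "binary p' = p" "binary k' = k"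
    using num p by (simp_all add: d binary_unbinary[OF k] map_idI)
  have "map binary (map unbinary (fst w)) = fst w" if "w \<in> set W" for w
    unfolding map_map by (rule map_idI) (use votes[OF that] num in simp)
  then have 2: "map (map binary) V' = map fst W"
    unfolding d map_map by (intro map_cong) auto
  have inj: "inj_on unbinary (set cs)" using num by (rule inj_on_inverseI)
  have "v \<in> permutations_of_set (set cs')" if "v \<in> set V'" for v
  proof -
    from that obtain w where "v = map unbinary (fst w)" "w \<in> set W" unfolding d by auto
    then show ?thesis using votes[of w] inj by (simp add: d permutations_of_set_def distinct_map)
  qed
  then have "election (set cs') V'" unfolding election_def by (simp add: subset_iff)
  moreover have "distinct cs'" "p' \<in> set cs'"
    using cs p inj unfolding d by (simp_all add: distinct_map)
  moreover have "x = encode_instance cs' V' k' p'"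
    unfolding encode_instance_word 1 2 by (rule x)
  moreover have "veto3_conformant_bribable (binary ` set cs') (map (map binary) V') k' (binary p')"
    unfolding bribable_pairs 2
  proof (intro exI[of _ W] conjI)
    show "bribe_pairs (map fst W) k' W"
      using new card unfolding bribe_pairs_def d by simp
    have "binary ` set cs' = set cs" using 1(1) by (metis list.set_map)
    then show "binary p' \<in> veto3_winners (binary ` set cs') (map snd W)"
      using p win 1(2) unfolding veto3_winners_vetoes by simp
  qed
  ultimately show "x \<in> veto3_conformant_bribery_problem"
    unfolding veto3_conformant_bribery_problem_def bribable_rename[OF inj_binary] by blast
qed

lemma tsize_encode_list:
  assumes "\<And>x. x \<in> set xs \<Longrightarrow> tsize x \<le> 2 * length (e x)"
  shows "tsize xs \<le> 2 * length (encode_list e xs)"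
  using assms
proof (induction xs)
  case (Cons a xs)
  then have "tsize a \<le> 2 * length (e a)" "tsize xs \<le> 2 * length (encode_list e xs)" by auto
  then show ?case by (simp add: encode_list_def)
qed (simp add: encode_list_def)

lemma tsize_encode_bits: "tsize bs \<le> 2 * length (encode_bits bs)"
  by (rule le_trans[OF tsize_bools], induction bs) (auto simp: encode_list_def)

text \<open>A new vote is a copy of some vote written in \<open>x\<close>, hence of size at most
  \<open>2 * length x\<close>; with at most \<open>length x\<close> voters this gives the quadratic
  term.\<close>

lemma certifies_tsize:
  assumes "certifies x cs W k p"
  shows "tsize (cs, W, k, p) \<le> poly [:4, 9, 2:] (length x)"
proof -
  let ?n = "length x"
  have x: "x = word_instance cs (map fst W) k p" using assms unfolding certifies_def by blast
  have "tsize cs \<le> 2 * length (encode_list encode_bits cs)"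
    by (intro tsize_encode_list tsize_encode_bits)
  moreover have "tsize k \<le> 2 * length (encode_bits k)" "tsize p \<le> 2 * length (encode_bits p)"
    by (rule tsize_encode_bits)+
  moreover have V: "tsize (map fst W) \<le> 2 * length (encode_list (encode_list encode_bits) (map fst W))"
    by (intro tsize_encode_list tsize_encode_bits)
  moreover have "tsize W \<le> tsize (map fst W) + length W * (2 * ?n + 1)"
  proof -
    have w: "tsize v \<le> 2 * ?n" if "v \<in> snd ` set W" for v
    proof -
      have "v \<in> set (map fst W)" using that assms unfolding certifies_def by auto
      from tsize_member[OF this] V show ?thesis by (simp add: x word_instance_def)
    qed
    have "tsize U \<le> tsize (map fst U) + length U * (2 * ?n + 1)" if "set U \<subseteq> set W" for U
      using that
    proof (induction U)
      case (Cons u U)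
      then have "tsize (snd u) \<le> 2 * ?n" by (intro w) auto
      then show ?case using Cons by (cases u) auto
    qed simp
    then show ?thesis by simp
  qed
  moreover have "length W \<le> ?n"
  proof -
    have "length W \<le> length (encode_list (encode_list encode_bits) (map fst W))"
      by (induction W) (auto simp: encode_list_def)
    then show ?thesis by (simp add: x word_instance_def)
  qed
  then have "length W * (2 * ?n + 1) \<le> ?n * (2 * ?n + 1)" by (rule mult_le_mono1)
  ultimately show ?thesis by (simp add: x word_instance_def algebra_simps)
qed

text \<open>Certificates are prefix codes of trees, read from right to left.\<close>

definition parse_step :: "bool \<Rightarrow> tree list \<Rightarrow> tree list" where
  "parse_step b ts = (if b then (case ts of [] \<Rightarrow> [] | t # us \<Rightarrow> (case us of [] \<Rightarrow> [] | u # vs \<Rightarrow> Node t u # vs))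
     else Leaf # ts)"

definition parse :: "bool list \<Rightarrow> tree" where
  "parse bs = (case fold parse_step (rev bs) [] of [] \<Rightarrow> Leaf | t # _ \<Rightarrow> t)"

definition tree_bits :: "tree \<Rightarrow> bool list" where
  "tree_bits t = map (\<lambda>a. a = 2) (code t)"

lemma parse_tree_bits: "parse (tree_bits t) = t"
proof -
  have "fold parse_step (rev (tree_bits t)) ts = t # ts" for ts
    by (induction t arbitrary: ts) (auto simp: tree_bits_def parse_step_def)
  then show ?thesis by (simp add: parse_def)
qed

lemma PT_Node: "PT f \<Longrightarrow> PT g \<Longrightarrow> PT (\<lambda>x. Node (f x) (g x))"
  by (rule PT_cast[OF PT_Pair, of f g]) (auto simp: enc_tree_def enc_prod_def)

lemma PT_parse:
  assumes "PT f"
  shows "PT (\<lambda>x. parse (f x))"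
proof -
  have "PT (\<lambda>x. fold parse_step (rev (f x)) [])"
  proof (rule PT_fold_growth)
    show "PT (\<lambda>p. parse_step (snd (fst p)) (snd p))"
      unfolding parse_step_def by (intro PT_intros PT_case_list PT_Node)
    show "tsize (parse_step b z) \<le> tsize z + poly [:2:] (tsize x + tsize b)" for x :: 'a and b z
      by (auto simp: parse_step_def split: list.splits)
  qed (intro PT_intros assms)+
  then show ?thesis unfolding parse_def by (intro PT_case_list PT_intros)
qed

fun left :: "tree \<Rightarrow> tree" where
  "left Leaf = Leaf" | "left (Node t u) = t"

fun right :: "tree \<Rightarrow> tree" where
  "right Leaf = Leaf" | "right (Node t u) = u"

lemma PT_left: 
  assumes "PT f"
  shows "PT (\<lambda>x. left (f x))"
proof (rule PT_cong)
  show "PT (\<lambda>x. case subtrees (f x) of [] \<Rightarrow> Leaf | t # _ \<Rightarrow> t)"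
    by (intro PT_case_list PT_subtrees PT_intros assms)
  show "left (f x) = (case subtrees (f x) of [] \<Rightarrow> Leaf | t # _ \<Rightarrow> t)" for x
    by (cases "f x") auto
qed

lemma PT_right: 
  assumes "PT f"
  shows "PT (\<lambda>x. right (f x))"
proof (rule PT_cast)
  show "PT (\<lambda>x. case subtrees (f x) of [] \<Rightarrow> [] | _ # ts \<Rightarrow> ts)"
    by (intro PT_case_list PT_subtrees PT_intros assms)
  show "enc (right (f x)) = enc (case subtrees (f x) of [] \<Rightarrow> [] | _ # ts \<Rightarrow> ts)" for x
    by (cases "f x") (auto simp: enc_subtrees enc_tree_def)
qed

text \<open>The decoders are total: a tree that is not a proper code still yields some word, and
  \<open>certifies\<close> judges whatever comes out.\<close>

definition tree_word :: "tree \<Rightarrow> bool list" where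
  "tree_word t = map (\<lambda>s. s \<noteq> Leaf) (subtrees t)"

definition tree_words :: "tree \<Rightarrow> bool list list" where
  "tree_words t = map tree_word (subtrees t)"

definition tree_pairs :: "tree \<Rightarrow> (bool list list \<times> bool list list) list" where
  "tree_pairs t = map (\<lambda>s. (tree_words (left s), tree_words (right s))) (subtrees t)"

lemma subtrees_enc: "subtrees (enc xs) = map enc xs" for xs :: "'a::enc list"
  by (induction xs) auto

lemma tree_word: "tree_word (enc bs) = bs"
  unfolding tree_word_def subtrees_enc by (induction bs) (auto simp: enc_bool_def)

lemma tree_words: "tree_words (enc ws) = ws"
  unfolding tree_words_def subtrees_enc by (induction ws) (auto simp: tree_word)

lemma tree_pairs: "tree_pairs (enc ps) = ps"
  unfolding tree_pairs_def subtrees_enc by (induction ps) (auto simp: tree_words enc_prod_def)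

lemma PT_tree_word: "PT f \<Longrightarrow> PT (\<lambda>x. tree_word (f x))"
  unfolding tree_word_def by (intro PT_intros PT_subtrees)

lemma PT_tree_words: "PT f \<Longrightarrow> PT (\<lambda>x. tree_words (f x))"
  unfolding tree_words_def by (intro PT_intros PT_subtrees PT_tree_word)

lemma PT_tree_pairs: "PT f \<Longrightarrow> PT (\<lambda>x. tree_pairs (f x))"
  unfolding tree_pairs_def by (intro PT_intros PT_subtrees PT_tree_words PT_left PT_right)

lemma PT_capped:
  assumes "PT n" "PT l"
  shows "PT (\<lambda>x. capped (n x) (l x))"
proof -
  define f where "f n b k = (if (if b then 1 else 0) + 2 * k \<le> n then (if b then 1 else 0) + 2 * k else n)" for n k :: nat and b
  obtain q where q: "\<And>x. tsize (n x) \<le> poly q (tsize x)" by (rule PT_tsize[OF assms(1)]) blast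
  have "PT (\<lambda>x. fold (f (n x)) (rev (l x)) 0)"
  proof (rule PT_fold)
    show "PT (\<lambda>p. f (n (fst (fst p))) (snd (fst p)) (snd p))"
      unfolding f_def by (intro PT_intros PT_comp[OF assms(1)])
    have "fold (f m) bs k \<le> m" if "k \<le> m" for m bs k
      using that by (induction bs arbitrary: k) (auto simp: f_def)
    from this[of 0] show "tsize (fold (f (n x)) (take m (rev (l x))) 0) \<le> poly q (tsize x)" for x m
      using q[of x] by (auto intro: order_trans[of _ "tsize (n x)"])
  qed (intro PT_intros assms)+
  moreover have "fold (f m) (rev bs) 0 = capped m bs" for m bs
    by (induction bs) (auto simp: f_def)
  ultimately show ?thesis by simp
qed

lemma PT_vetoes: 
  assumes "PT V" "PT c" 
  shows "PT (\<lambda>x. vetoes (V x) (c x))"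
  unfolding vetoes_def bottom3_def by (intro PT_intros PT_comp[OF assms(2)] assms)

lemma PT_numeral_word: "PT f \<Longrightarrow> PT (\<lambda>x. numeral_word (f x))"
  unfolding numeral_word_def by (intro PT_case_list PT_intros)

lemma PT_word_instance: 
  "PT cs \<Longrightarrow> PT V \<Longrightarrow> PT k \<Longrightarrow> PT p \<Longrightarrow> PT (\<lambda>x. word_instance (cs x) (V x) (k x) (p x))"
  unfolding word_instance_def by (intro PT_intros PT_encode_list)

theorem problem_in_NP: "veto3_conformant_bribery_problem \<in> NP"
proof -
  define R where "R x u = (let t = parse u in certifies x (tree_words (left t)) (tree_pairs (left (right t)))
      (tree_word (left (right (right t)))) (tree_word (right (right (right t)))))" for x u
  have "PT (\<lambda>p. R (fst p) (snd p))"
    unfolding R_def Let_def certifies_def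
    by (intro PT_intros PT_numeral_word PT_word_instance PT_vetoes PT_capped PT_tree_word PT_tree_words PT_tree_pairs
        PT_left PT_right PT_parse)
  then have "polytime_relation R" by (rule PT_polytime_relation)
  moreover have "x \<in> veto3_conformant_bribery_problem \<longleftrightarrow> (\<exists>u. length u \<le> poly [:4, 9, 2:] (length x) \<and> R x u)" for x
  proof
    assume "x \<in> veto3_conformant_bribery_problem"
    then obtain cs W k p where c: "certifies x cs W k p" unfolding problem_certifies by blast
    define u where "u = tree_bits (enc (cs, W, k, p))"
    have "length u = tsize (cs, W, k, p)" by (simp add: u_def tree_bits_def tsize_def)
    moreover have "R x u"
      using c by (simp add: R_def u_def parse_tree_bits enc_prod_def tree_words tree_pairs tree_word)
    ultimately show "\<exists>u. length u \<le> poly [:4, 9, 2:] (length x) \<and> R x u"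
      using certifies_tsize[OF c] by (intro exI[of _ u]) simp
  qed (auto simp: problem_certifies R_def Let_def)
  ultimately show ?thesis unfolding NP_def by blast
qed

section \<open>Exact covers with triples\<close>

definition cover :: "'a list list \<Rightarrow> 'a \<Rightarrow> nat" where
  "cover L c = length (filter (\<lambda>t. c \<in> set t) L)"

lemma cover_simps [simp]:
  "cover [] c = 0"
  "cover (t # L) c = (if c \<in> set t then Suc (cover L c) else cover L c)"
  "cover (L @ L') c = cover L c + cover L' c"
  "cover (replicate k t) c = (if c \<in> set t then k else 0)"
  by (auto simp: cover_def)

lemma cover_le: "cover L c \<le> length L"
  by (simp add: cover_def)

definition vote_for :: "'a list \<Rightarrow> 'a list \<Rightarrow> 'a vote" where
  "vote_for cs t = filter (\<lambda>c. c \<notin> set t) cs @ t"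

lemma bottom3_vote_for: "length t = 3 \<Longrightarrow> bottom3 (vote_for cs t) = set t"
  by (simp add: bottom3_def vote_for_def)

lemma vote_for_permutation:
  "distinct cs \<Longrightarrow> distinct t \<Longrightarrow> set t \<subseteq> set cs \<Longrightarrow> vote_for cs t \<in> permutations_of_set (set cs)"
  by (auto simp: permutations_of_set_def vote_for_def)

text \<open>The dummies \<open>d\<close> and \<open>d'\<close> fill the remaining bottom places of
  padding votes and of votes against \<open>p\<close>, so that such a vote hits only one other
  candidate.\<close>

definition cover_candidates :: "'a \<Rightarrow> 'a \<Rightarrow> 'a \<Rightarrow> ('a \<times> nat) list \<Rightarrow> 'a list" where
  "cover_candidates p d d' bs = p # d # d' # map fst bs"

text \<open>
  The padding votes give each element \<open>b\<close> of demand \<open>r\<close> exactly \<open>r\<close> vetoes less than the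
  number of vetoes of \<open>p\<close> that remains if \<open>D\<close> of the votes against \<open>p\<close> are changed.
\<close>

definition cover_votes :: "'a \<Rightarrow> 'a \<Rightarrow> 'a \<Rightarrow> ('a \<times> nat) list \<Rightarrow> 'a list list \<Rightarrow> nat \<Rightarrow> 'a vote list" where
  "cover_votes p d d' bs Ts D =
     (let cs = cover_candidates p d d' bs; Z = length Ts + D in
      map (vote_for cs) Ts @
      concat (map (\<lambda>b. replicate (Z - cover Ts (fst b) - snd b) (vote_for cs [fst b, d, d'])) bs) @
      replicate (Z + D) (vote_for cs [p, d, d']))"

lemma sum_list_eq_pointwise:
  fixes f g :: "'a \<Rightarrow> nat"
  assumes "\<And>x. x \<in> set xs \<Longrightarrow> f x \<le> g x" "(\<Sum>x\<leftarrow>xs. g x) \<le> (\<Sum>x\<leftarrow>xs. f x)" "x \<in> set xs"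
  shows "f x = g x"
  using assms
proof (induction xs)
  case (Cons y ys)
  have "(\<Sum>x\<leftarrow>ys. f x) \<le> (\<Sum>x\<leftarrow>ys. g x)" "f y \<le> g y"
    using Cons.prems(1) by (auto intro: sum_list_mono)
  then have "f y = g y" "(\<Sum>x\<leftarrow>ys. g x) \<le> (\<Sum>x\<leftarrow>ys. f x)" using Cons.prems(2) by auto
  then show ?case using Cons.IH Cons.prems by auto
qed simp

lemma vetoes_pairs:
  "vetoes (map fst W) c \<le> vetoes (map snd W) c + length (filter (\<lambda>w. fst w \<noteq> snd w) W)"
  "vetoes (map snd W) c \<le> vetoes (map fst W) c + vetoes (map snd (filter (\<lambda>w. fst w \<noteq> snd w) W)) c"
  by (induction W) auto

lemma vetoes_map_vote_for:
  "(\<And>t. t \<in> set L \<Longrightarrow> length t = 3) \<Longrightarrow> vetoes (map (vote_for cs) L) c = cover L c"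
  by (induction L) (auto simp: bottom3_vote_for)

lemma vetoes_replicate [simp]: "vetoes (replicate k v) c = (if c \<in> bottom3 v then k else 0)"
  by (simp add: vetoes_def)

context
  fixes p d d' :: 'a and bs :: "('a \<times> nat) list" and Ts :: "'a list list" and D :: nat
  assumes dist: "distinct (cover_candidates p d d' bs)"
    and triple: "\<And>t. t \<in> set Ts \<Longrightarrow> length t = 3 \<and> distinct t \<and> set t \<subseteq> fst ` set bs"
    and demand: "(\<Sum>b\<leftarrow>bs. snd b) = 3 * D" "\<And>b. b \<in> set bs \<Longrightarrow> snd b \<le> D"
begin

abbreviation (input) "cands \<equiv> cover_candidates p d d' bs"
abbreviation (input) "votes \<equiv> cover_votes p d d' bs Ts D"
abbreviation (input) "Z \<equiv> length Ts + D"

definition "padding = concat (map (\<lambda>b. replicate (Z - cover Ts (fst b) - snd b) (vote_for cands [fst b, d, d'])) bs)"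

lemma votes_eq: 
  "votes = map (vote_for cands) Ts @ padding @ replicate (Z + D) (vote_for cands [p, d, d'])"
  by (simp add: cover_votes_def padding_def Let_def)

lemma cover_votes_election: "election (set cands) votes"
proof -
  have 1: "vote_for cands t \<in> permutations_of_set (set cands)" if "t \<in> set Ts" for t
    using triple[OF that] by (intro vote_for_permutation dist) (auto simp: cover_candidates_def)
  have 2: "vote_for cands [c, d, d'] \<in> permutations_of_set (set cands)" if "c = p \<or> c \<in> fst ` set bs" for c
    using dist that by (intro vote_for_permutation dist) (auto simp: cover_candidates_def)
  have "v \<in> permutations_of_set (set cands)" if "v \<in> set votes" for v
  proof -
    from that consider t where "v = vote_for cands t" "t \<in> set Ts"
      | b where "v = vote_for cands [fst b, d, d']" "b \<in> set bs" | "v = vote_for cands [p, d, d']"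
      unfolding votes_eq padding_def by (auto simp: set_replicate_conv_if split: if_splits)
    then show ?thesis using 1 2 by cases auto
  qed
  then show ?thesis unfolding election_def by blast
qed

lemma vetoes_pads_0:
  assumes "c \<notin> fst ` set as" "c \<noteq> d" "c \<noteq> d'"
  shows "vetoes (concat (map (\<lambda>b. replicate (h b) (vote_for cs [fst b, d, d'])) as)) c = 0"
  using assms by (induction as) (simp_all add: bottom3_vote_for)

lemma vetoes_pads:
  assumes "distinct (map fst as)" "b \<in> set as" "fst b \<noteq> d" "fst b \<noteq> d'"
  shows "vetoes (concat (map (\<lambda>b. replicate (h b) (vote_for cs [fst b, d, d'])) as)) (fst b) = h b"
  using assms
proof (induction as)
  case (Cons a as)
  show ?case
  proof (cases "a = b")
    case True
    then show ?thesis using Cons.prems vetoes_pads_0[of "fst b" as] by (simp add: bottom3_vote_for)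
  next
    case False
    then have "b \<in> set as" using Cons.prems by simp
    moreover from this have "fst b \<noteq> fst a" using Cons.prems by (force simp: image_iff)
    ultimately show ?thesis using Cons by (simp add: bottom3_vote_for)
  qed
qed simp

lemma dummies: 
  "p \<notin> fst ` set bs" "p \<noteq> d" "p \<noteq> d'" "d \<noteq> d'" "distinct (map fst bs)"
  "b \<in> set bs \<Longrightarrow> fst b \<noteq> p \<and> fst b \<noteq> d \<and> fst b \<noteq> d'"
  using dist by (auto simp: cover_candidates_def)

lemma cover_Ts_p: "set L \<subseteq> set Ts \<Longrightarrow> cover L p = 0"
proof (induction L)
  case (Cons t L)
  then show ?case using triple[of t] dummies(1) by auto
qed simp

lemma vetoes_Ts: "set L \<subseteq> set Ts \<Longrightarrow> vetoes (map (vote_for cands) L) c = cover L c"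
  using triple by (intro vetoes_map_vote_for) blast

text \<open>With \<open>Z = length Ts + D\<close> the natural subtraction in the padding is exact:
  \<open>Ts\<close> covers an element at most \<open>length Ts\<close> times, and a demand is at
  most \<open>D\<close>.\<close>

lemma vetoes_votes:
  "vetoes votes p = Z + D"
  "b \<in> set bs \<Longrightarrow> vetoes votes (fst b) + snd b = Z"
proof -
  show "vetoes votes p = Z + D"
    using cover_Ts_p[OF order_refl] vetoes_pads_0[OF dummies(1-3)]
    by (simp add: votes_eq vetoes_Ts padding_def bottom3_vote_for)
  assume b: "b \<in> set bs"
  have "vetoes padding (fst b) = Z - cover Ts (fst b) - snd b"
    unfolding padding_def using dummies(6)[OF b] by (intro vetoes_pads dummies(5) b) auto
  then show "vetoes votes (fst b) + snd b = Z"
    using cover_le[of Ts "fst b"] demand(2)[OF b] dummies(6)[OF b]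
    by (simp add: votes_eq vetoes_Ts bottom3_vote_for)
qed

lemma cover_bribable:
  assumes L: "set L \<subseteq> set Ts" "length L = D" and c: "\<And>b. b \<in> set bs \<Longrightarrow> snd b \<le> cover L (fst b)"
  shows "veto3_conformant_bribable (set cands) votes D p"
  unfolding bribable_pairs
proof (intro exI conjI)
  let ?pv = "vote_for cands [p, d, d']"
  let ?U = "map (vote_for cands) Ts @ padding @ replicate Z ?pv"
  \<comment> \<open>Of the \<open>Z + D\<close> votes against \<open>p\<close>, the last
    \<open>D\<close> are replaced by the votes of \<open>L\<close>.\<close>
  define W where "W = map (\<lambda>v. (v, v)) ?U @ map (\<lambda>t. (?pv, vote_for cands t)) L"
  have fst: "map fst W = votes"
    using L(2) by (simp add: W_def votes_eq comp_def map_replicate_const replicate_add)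
  have snd: "map snd W = ?U @ map (vote_for cands) L"
    by (simp add: W_def comp_def)
  have "snd ` set W \<subseteq> set votes"
    using L(1) by (auto simp: W_def votes_eq)
  moreover have "length (filter (\<lambda>w. fst w \<noteq> snd w) W) \<le> D"
    using L(2) by (simp add: W_def filter_map comp_def)
      (metis length_filter_le length_map)
  ultimately show "bribe_pairs votes D W" using fst by (simp add: bribe_pairs_def)
  have p: "vetoes (map snd W) p = Z"
    using vetoes_votes(1) by (simp add: votes_eq snd bottom3_vote_for vetoes_Ts[OF L(1)] cover_Ts_p[OF L(1)])
  have b: "vetoes (map snd W) (fst b) \<ge> Z" if "b \<in> set bs" for b
    using vetoes_votes(2)[OF that] c[OF that] dummies(6)[OF that]
    by (simp add: votes_eq snd bottom3_vote_for vetoes_Ts[OF L(1)])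
  \<comment> \<open>The \<open>Z\<close> remaining votes against \<open>p\<close> veto both dummies
    as well.\<close>
  have "vetoes (map snd W) d \<ge> Z" "vetoes (map snd W) d' \<ge> Z"
    by (simp_all add: snd bottom3_vote_for)
  then show "p \<in> veto3_winners (set cands) (map snd W)"
    using p b by (auto simp: veto3_winners_vetoes cover_candidates_def)
qed

lemma bribable_cover:
  assumes "veto3_conformant_bribable (set cands) votes D p"
  obtains L where "set L \<subseteq> set Ts" "length L = D" "\<And>b. b \<in> set bs \<Longrightarrow> cover L (fst b) = snd b"
proof -
  from assms obtain W where W: "bribe_pairs votes D W" and win: "p \<in> veto3_winners (set cands) (map snd W)"
    unfolding bribable_pairs by blast
  define U where "U = map snd (filter (\<lambda>w. fst w \<noteq> snd w) W)"
  have fst: "map fst W = votes" and U: "set U \<subseteq> set votes" "length U \<le> D"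
    using W by (auto simp: bribe_pairs_def U_def)
  \<comment> \<open>Each of the at most \<open>D\<close> changed votes relieves \<open>p\<close> of
    at most one veto, so \<open>Z\<close> remain and every element has to catch up by its
    demand.\<close>
  have "vetoes (map snd W) p \<ge> Z"
    using vetoes_pairs(1)[of W p] U(2) vetoes_votes(1) by (simp add: fst U_def)
  then have ge: "snd b \<le> vetoes U (fst b)" if "b \<in> set bs" for b
    using vetoes_pairs(2)[of W "fst b"] vetoes_votes(2)[OF that] win that
    by (fastforce simp: fst U_def veto3_winners_vetoes cover_candidates_def)
  \<comment> \<open>The number of elements that a vote vetoes: double counting turns the gains of
    the elements into a sum over the new votes.\<close>
  define g where "g v = length (filter (\<lambda>b. fst b \<in> bottom3 v) bs)" for v
  have g_le: "g v \<le> card (bottom3 v \<inter> fst ` set bs)" for v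
  proof -
    have "g v = card (set (map fst (filter (\<lambda>b. fst b \<in> bottom3 v) bs)))"
      using dummies(5) distinct_map_filter by (subst distinct_card) (auto simp: g_def)
    also have "\<dots> \<le> card (bottom3 v \<inter> fst ` set bs)"
      by (intro card_mono) auto
    finally show ?thesis .
  qed
  have g3: "g v \<le> 3" if "v \<in> set votes" for v
  proof -
    have "length (drop (length v - 3) v) \<le> 3" by simp
    then have "card (bottom3 v) \<le> 3" unfolding bottom3_def using card_length le_trans by blast
    moreover have "card (bottom3 v \<inter> fst ` set bs) \<le> card (bottom3 v)"
      by (intro card_mono) (auto simp: bottom3_def)
    ultimately show ?thesis using g_le[of v] by linarith
  qed
  have g1: "g v \<le> 1" if v: "v \<in> set votes" "v \<notin> vote_for cands ` set Ts" for v
  proof -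
    obtain c where "v = vote_for cands [c, d, d']"
      using v by (auto simp: votes_eq padding_def split: if_splits)
    then have "bottom3 v \<inter> fst ` set bs \<subseteq> {c}" using dummies(6) by (auto simp: bottom3_vote_for)
    from card_mono[OF _ this] g_le[of v] show ?thesis by simp
  qed
  \<comment> \<open>A new vote that is no triple wastes at least two of its three places. As the
    gains must reach \<open>3 * D\<close>, there is no such vote, and all inequalities are
    tight.\<close>
  define N where "N = length (filter (\<lambda>v. v \<notin> vote_for cands ` set Ts) U)"
  have sum: "(\<Sum>b\<leftarrow>bs. vetoes U (fst b)) = (\<Sum>v\<leftarrow>U. g v)"
  proof (induction U)
    case (Cons v U)
    have "(\<Sum>b\<leftarrow>bs. vetoes (v # U) (fst b)) = (\<Sum>b\<leftarrow>bs. vetoes U (fst b)) + g v"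
      unfolding g_def by (induction bs) auto
    then show ?case using Cons by simp
  qed (simp add: sum_list_0)
  have "(\<Sum>v\<leftarrow>U. g v) + 2 * N \<le> 3 * length U"
    using U(1) unfolding N_def
  proof (induction U)
    case (Cons v U)
    then show ?case using g3[of v] g1[of v] by auto
  qed simp
  moreover have "3 * D \<le> (\<Sum>b\<leftarrow>bs. vetoes U (fst b))"
    unfolding demand(1)[symmetric] by (intro sum_list_mono ge)
  ultimately have N: "N = 0" and len: "length U = D" and le: "(\<Sum>b\<leftarrow>bs. vetoes U (fst b)) \<le> (\<Sum>b\<leftarrow>bs. snd b)"
    using sum U(2) demand(1) by auto
  have eq: "snd b = vetoes U (fst b)" if "b \<in> set bs" for b
    by (rule sum_list_eq_pointwise[where f = snd and g = "\<lambda>b. vetoes U (fst b)", OF ge le that])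
  have "\<forall>v \<in> set U. \<exists>t. v = vote_for cands t \<and> t \<in> set Ts"
    using N by (auto simp: N_def filter_empty_conv)
  then have "\<exists>L. U = map (vote_for cands) L \<and> set L \<subseteq> set Ts"
  proof (induction U)
    case (Cons v U)
    then obtain t L where "v = vote_for cands t" "t \<in> set Ts" "U = map (vote_for cands) L" "set L \<subseteq> set Ts"
      by auto
    then show ?case by (intro exI[of _ "t # L"]) simp
  qed simp
  then obtain L where "U = map (vote_for cands) L" "set L \<subseteq> set Ts" by blast
  then show ?thesis using that[of L] eq len vetoes_Ts[of L] by simp
qed

end

section \<open>From satisfiability to covers\<close>

type_synonym literal = "nat list \<times> bool"

definition satisfiable :: "literal list list \<Rightarrow> bool" where
  "satisfiable F \<longleftrightarrow> (\<exists>\<sigma>. \<forall>c \<in> set F. \<exists>l \<in> set c. \<sigma> (fst l) = snd l)"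

text \<open>Indexing with a default, as in \<open>PT_nth_or\<close>.\<close>

definition clause :: "literal list list \<Rightarrow> nat \<Rightarrow> literal list" where
  "clause F j = (if j < length F then F ! j else [])"

definition width :: "literal list list \<Rightarrow> nat \<Rightarrow> nat" where
  "width F j = length (remdups (clause F j))"

definition variables :: "literal list list \<Rightarrow> nat list list" where
  "variables F = remdups (map fst (concat F))"

text \<open>The leading tags keep the families apart from each other, from the elements
  \<open>[4]\<close>, \<open>[5]\<close>, \<open>[6]\<close>, and from \<open>[0]\<close>,
  \<open>[1]\<close>, \<open>[2]\<close>, which serve as \<open>p\<close>, \<open>d\<close>,
  \<open>d'\<close>.\<close>

definition elem_A :: "nat \<Rightarrow> nat list \<Rightarrow> nat list" where "elem_A j v = 7 # j # v"
definition elem_B :: "nat \<Rightarrow> nat list \<Rightarrow> nat list" where "elem_B j v = 8 # j # v"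
definition elem_C :: "nat \<Rightarrow> nat list" where "elem_C j = [3, j]"

text \<open>A triple covers the element of clause \<open>j\<close> if the literal \<open>l\<close> of the clause becomes false.\<close>

definition slot :: "literal list list \<Rightarrow> nat \<Rightarrow> literal \<Rightarrow> nat list" where
  "slot F j l = (if l \<in> set (clause F j) then elem_C j else [4])"

definition next_clause :: "literal list list \<Rightarrow> nat \<Rightarrow> nat" where
  "next_clause F j = (if Suc j = length F then 0 else Suc j)"

text \<open>
  For every variable, the elements \<open>A\<close> and \<open>B\<close> form a cycle through the clauses, which can be
  covered exactly in two ways: by the triples \<open>X\<close> (the variable is true) or by the triples \<open>Y\<close>.
\<close>

definition triple_X :: "literal list list \<Rightarrow> nat \<Rightarrow> nat list \<Rightarrow> nat list list" where
  "triple_X F j v = [elem_A j v, elem_B j v, slot F j (v, False)]"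

definition triple_Y :: "literal list list \<Rightarrow> nat \<Rightarrow> nat list \<Rightarrow> nat list list" where
  "triple_Y F j v = [elem_B j v, elem_A (next_clause F j) v, slot F j (v, True)]"

text \<open>
  Slots that belong to no clause go to the element \<open>[4]\<close>. A clause of \<open>w\<close> literals holds if at most
  \<open>w - 1\<close> of them are false; triples containing the elements \<open>[5]\<close> and \<open>[6]\<close> fill up to this number.
\<close>

definition sat_triples :: "literal list list \<Rightarrow> nat list list list" where
  "sat_triples F = concat (map (\<lambda>j. concat (map (\<lambda>v. [triple_X F j v, triple_Y F j v]) (variables F)) @
     [[elem_C j, [5], [6]]]) [0..<length F]) @ [[[4], [5], [6]]]"

definition slack :: "literal list list \<Rightarrow> nat" where
  "slack F = (\<Sum>j\<leftarrow>[0..<length F]. width F j - 1)"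

text \<open>An assignment selects one triple for every clause and variable. If \<open>f\<close> of
  them fall on the element of clause \<open>j\<close>, it takes \<open>width F j - 1 - f\<close>
  fillers, and \<open>[4]\<close> takes \<open>f\<close> fillers for the triples lost to the clause.
  The unknown \<open>f\<close> cancels, so there are always \<open>slack F\<close> fillers.\<close>

definition budget :: "literal list list \<Rightarrow> nat" where
  "budget F = slack F + length F * length (variables F)"

definition sat_demands :: "literal list list \<Rightarrow> (nat list \<times> nat) list" where
  "sat_demands F = ([4], length F * length (variables F)) # ([5], slack F) # ([6], slack F) #
     concat (map (\<lambda>j. (elem_C j, width F j - 1) # 
       concat (map (\<lambda>v. [(elem_A j v, 1), (elem_B j v, 1)]) (variables F))) [0..<length F])"

lemmas elem_defs = elem_A_def elem_B_def elem_C_def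

lemma width_card: "j < length F \<Longrightarrow> width F j = card (set (F ! j))"
  by (simp add: width_def clause_def length_remdups_card_conv)

lemma distinct_candidates: "distinct (cover_candidates [0] [1] [2] (sat_demands F))"
proof -
  have v: "distinct (concat (map (\<lambda>v. [elem_A j v, elem_B j v]) vs))" if "distinct vs" for j vs
    using that by (induction vs) (auto simp: elem_defs)
  have "distinct (concat (map (\<lambda>j. elem_C j # concat (map (\<lambda>v. [elem_A j v, elem_B j v]) vs)) js))"
    if "distinct vs" "distinct js" for vs js
    using that(2) by (induction js) (auto simp: v[OF that(1)], auto simp: elem_defs)
  from this[of "variables F" "[0..<length F]"] show ?thesis
    by (auto simp: cover_candidates_def sat_demands_def map_concat comp_def variables_def, auto simp: elem_defs)
qed

lemma sat_demand_set:
  "set (sat_demands F) = {([4], length F * length (variables F)), ([5], slack F), ([6], slack F)} \<union>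
     (\<Union>j<length F. insert (elem_C j, width F j - 1) (\<Union>v\<in>set (variables F). {(elem_A j v, 1), (elem_B j v, 1)}))"
  by (auto simp: sat_demands_def)

lemma next_clause_less: "j < length F \<Longrightarrow> next_clause F j < length F"
  by (auto simp: next_clause_def)

lemma next_clause_inj: "i < length F \<Longrightarrow> j < length F \<Longrightarrow> next_clause F i = next_clause F j \<Longrightarrow> i = j"
  by (auto simp: next_clause_def split: if_splits)

lemma next_clause_surj: 
  assumes "j < length F"
  obtains i where "i < length F" "next_clause F i = j"
proof (cases j)
  case 0
  with assms show ?thesis by (intro that[of "length F - 1"]) (auto simp: next_clause_def)
next
  case (Suc i)
  with assms show ?thesis by (intro that[of i]) (auto simp: next_clause_def)
qed

lemma sat_triple_set:
  "set (sat_triples F) = {[[4], [5], [6]]} \<union>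
     (\<Union>j<length F. insert [elem_C j, [5], [6]] (\<Union>v\<in>set (variables F). {triple_X F j v, triple_Y F j v}))"
  by (auto simp: sat_triples_def)

lemma elements:
  "fst ` set (sat_demands F) = {[4], [5], [6]} \<union>
     (\<Union>j<length F. insert (elem_C j) (\<Union>v\<in>set (variables F). {elem_A j v, elem_B j v}))"
  by (simp add: sat_demand_set image_Un image_UN)

lemma sat_triples_cases:
  assumes "t \<in> set (sat_triples F)"
  obtains "t = [[4], [5], [6]]" 
    | j where "j < length F" "t = [elem_C j, [5], [6]]"
    | j v where "j < length F" "v \<in> set (variables F)" "t = triple_X F j v"
    | j v where "j < length F" "v \<in> set (variables F)" "t = triple_Y F j v"
  using assms unfolding sat_triple_set by blast

lemma sat_triples_triple:
  assumes "t \<in> set (sat_triples F)"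
  shows "length t = 3 \<and> distinct t \<and> set t \<subseteq> fst ` set (sat_demands F)"
proof -
  have slot: "slot F j l = [4] \<or> slot F j l = elem_C j" for j l by (simp add: slot_def)
  show ?thesis using assms
  proof (cases rule: sat_triples_cases)
    case (3 j v)
    have "elem_A j v \<in> fst ` set (sat_demands F)" "elem_B j v \<in> fst ` set (sat_demands F)" 
      "slot F j (v, False) \<in> fst ` set (sat_demands F)" 
      using 3 slot[of j "(v, False)"] unfolding elements by blast+
    then show ?thesis using slot[of j "(v, False)"] by (auto simp: 3(3) triple_X_def elem_defs)
  next
    case (4 j v)
    have "elem_A (next_clause F j) v \<in> fst ` set (sat_demands F)" "elem_B j v \<in> fst ` set (sat_demands F)" 
      "slot F j (v, True) \<in> fst ` set (sat_demands F)" 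
      using 4 next_clause_less[of j F] slot[of j "(v, True)"] unfolding elements by blast+
    then show ?thesis using slot[of j "(v, True)"] by (auto simp: 4(3) triple_Y_def elem_defs)
  qed (auto simp: elements, auto simp: elem_defs)
qed

lemma sum_list_upt: "(\<Sum>j\<leftarrow>[0..<m]. f j) = (\<Sum>j<m. f j :: nat)"
  by (simp add: interv_sum_list_conv_sum_set_nat lessThan_atLeast0)

lemma sat_demands_sum: "(\<Sum>b\<leftarrow>sat_demands F. snd b) = 3 * budget F"
proof -
  have v: "(\<Sum>b\<leftarrow>concat (map (\<lambda>v. [(elem_A j v, 1), (elem_B j v, 1)]) vs). snd b) = 2 * length vs" for j vs
    by (induction vs) auto
  have "(\<Sum>b\<leftarrow>concat (map (\<lambda>j. (elem_C j, width F j - 1) # 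
       concat (map (\<lambda>v. [(elem_A j v, 1), (elem_B j v, 1)]) vs)) js). snd b) =
       (\<Sum>j\<leftarrow>js. width F j - 1) + length js * (2 * length vs)" for vs js
    using v by (induction js) auto
  then show ?thesis by (simp add: sat_demands_def budget_def slack_def)
qed

lemma sat_demands_le:
  assumes "b \<in> set (sat_demands F)"
  shows "snd b \<le> budget F"
proof -
  have "width F j - 1 \<le> slack F" if "j < length F" for j
    using that unfolding slack_def sum_list_upt by (intro member_le_sum) auto
  moreover have "1 \<le> length F * length (variables F)" if "j < length F" "v \<in> set (variables F)" for j v
    using that by (cases "variables F") auto
  ultimately show ?thesis using assms unfolding sat_demand_set budget_def by (fastforce intro: trans_le_add1 trans_le_add2)
qed

section \<open>Satisfying assignments and covers\<close>

lemma cover_concat_map: "cover (concat (map f js)) c = (\<Sum>j\<leftarrow>js. cover (f j) c)"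
  by (induction js) auto

lemma cover_pos: "t \<in> set L \<Longrightarrow> c \<in> set t \<Longrightarrow> 1 \<le> cover L c"
  by (induction L) auto

lemma cover_1_unique:
  assumes "cover L c = 1" "t \<in> set L" "c \<in> set t" "u \<in> set L" "c \<in> set u"
  shows "t = u"
proof -
  obtain x where x: "filter (\<lambda>t. c \<in> set t) L = [x]"
    using assms(1) by (auto simp: cover_def length_Suc_conv)
  have "t \<in> set (filter (\<lambda>t. c \<in> set t) L)" "u \<in> set (filter (\<lambda>t. c \<in> set t) L)"
    using assms by auto
  then show ?thesis unfolding x by simp
qed

lemma card_le_cover:
  assumes "T \<subseteq> set L" "\<And>t. t \<in> T \<Longrightarrow> c \<in> set t"
  shows "card T \<le> cover L c"
proof -
  have "card T \<le> card (set (filter (\<lambda>t. c \<in> set t) L))"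
    using assms by (intro card_mono) auto
  also have "\<dots> \<le> cover L c" unfolding cover_def by (rule card_length)
  finally show ?thesis .
qed

definition block :: "literal list list \<Rightarrow> (nat list \<Rightarrow> bool) \<Rightarrow> nat \<Rightarrow> nat list list list" where
  "block F \<sigma> j = map (\<lambda>v. if \<sigma> v then triple_X F j v else triple_Y F j v) (variables F)"

definition falsified :: "literal list list \<Rightarrow> (nat list \<Rightarrow> bool) \<Rightarrow> nat \<Rightarrow> nat" where
  "falsified F \<sigma> j = length (filter (\<lambda>v. (v, \<not> \<sigma> v) \<in> set (clause F j)) (variables F))"

lemma cover_block:
  "cover (block F \<sigma> j) (elem_C j) = falsified F \<sigma> j"
  "cover (block F \<sigma> j) [4] + falsified F \<sigma> j = length (variables F)"
proof -
  have "cover (map (\<lambda>v. if \<sigma> v then triple_X F j v else triple_Y F j v) vs) (elem_C j) =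
      length (filter (\<lambda>v. (v, \<not> \<sigma> v) \<in> set (clause F j)) vs)" for vs
    by (induction vs) (auto simp: triple_X_def triple_Y_def slot_def elem_defs)
  then show "cover (block F \<sigma> j) (elem_C j) = falsified F \<sigma> j"
    by (simp add: block_def falsified_def)
  have "cover (map (\<lambda>v. if \<sigma> v then triple_X F j v else triple_Y F j v) vs) [4] +
      length (filter (\<lambda>v. (v, \<not> \<sigma> v) \<in> set (clause F j)) vs) = length vs" for vs
    by (induction vs) (auto simp: triple_X_def triple_Y_def slot_def elem_defs)
  then show "cover (block F \<sigma> j) [4] + falsified F \<sigma> j = length (variables F)"
    by (simp add: block_def falsified_def)
qed

text \<open>A variable has just one false literal, so the false literals of a clause can be counted
  by variables, and the true literal \<open>l\<close> is not among them.\<close>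

lemma falsified_less:
  assumes "j < length F" "l \<in> set (F ! j)" "\<sigma> (fst l) = snd l"
  shows "falsified F \<sigma> j \<le> width F j - 1"
proof -
  let ?V = "set (filter (\<lambda>v. (v, \<not> \<sigma> v) \<in> set (clause F j)) (variables F))"
  have "falsified F \<sigma> j = card ?V"
    unfolding falsified_def by (rule distinct_card[symmetric]) (simp add: variables_def)
  also have "\<dots> = card ((\<lambda>v. (v, \<not> \<sigma> v)) ` ?V)"
    by (intro card_image[symmetric] inj_onI) simp
  also have "\<dots> \<le> card (set (F ! j) - {l})"
    using assms by (intro card_mono) (auto simp: clause_def)
  also have "\<dots> = width F j - 1" using assms by (simp add: width_card)
  finally show ?thesis .
qed

lemma satisfiable_cover:
  assumes "satisfiable F"
  obtains L where "set L \<subseteq> set (sat_triples F)" "length L = budget F"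
    "\<And>b. b \<in> set (sat_demands F) \<Longrightarrow> snd b \<le> cover L (fst b)"
proof -
  from assms obtain \<sigma> where "\<And>c. c \<in> set F \<Longrightarrow> \<exists>l \<in> set c. \<sigma> (fst l) = snd l"
    unfolding satisfiable_def by blast
  then have f: "falsified F \<sigma> j \<le> width F j - 1" if "j < length F" for j
    using that falsified_less nth_mem by metis
  define m n where "m = length F" and "n = length (variables F)"
  \<comment> \<open>\<open>g j\<close> fillers complete the element of clause \<open>j\<close>;
    \<open>s\<close> counts the fillers that complete \<open>[4]\<close>.\<close>
  define g where "g j = width F j - 1 - falsified F \<sigma> j" for j
  define s where "s = (\<Sum>j<m. falsified F \<sigma> j)"
  define B where "B j = block F \<sigma> j @ replicate (g j) [elem_C j, [5], [6]]" for j
  define L where "L = concat (map B [0..<m]) @ replicate s [[4], [5], [6]]"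
  have slack: "(\<Sum>j<m. g j) + s = slack F"
    unfolding s_def slack_def sum_list_upt m_def[symmetric] sum.distrib[symmetric]
    unfolding g_def by (rule sum.cong[OF refl], rule le_add_diff_inverse2, rule f) (simp add: m_def)
  have cov: "cover L c = (\<Sum>j<m. cover (B j) c) + cover (replicate s [[4], [5], [6]]) c" for c
    by (simp add: L_def cover_concat_map sum_list_upt)
  have block: "set (block F \<sigma> j) \<subseteq> set (sat_triples F)" if "j < m" for j
    using that by (auto simp: block_def sat_triple_set m_def)
  show ?thesis
  proof (rule that)
    show "set L \<subseteq> set (sat_triples F)"
    proof -
      have "[elem_C j, [5], [6]] \<in> set (sat_triples F)" if "j < m" for j
        using that by (auto simp: sat_triple_set m_def)
      with block have B: "set (B j) \<subseteq> set (sat_triples F)" if "j < m" for j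
        using that by (simp add: B_def set_replicate_conv_if)
      have "[[4], [5], [6]] \<in> set (sat_triples F)" by (simp add: sat_triple_set)
      moreover have "set L = (\<Union>j<m. set (B j)) \<union> set (replicate s [[4], [5], [6]])"
        by (auto simp: L_def)
      moreover have "(\<Union>j<m. set (B j)) \<subseteq> set (sat_triples F)"
        by (rule UN_least) (simp add: B)
      ultimately show ?thesis by (simp add: set_replicate_conv_if)
    qed
    have "length L = (\<Sum>j<m. n + g j) + s"
      by (simp add: L_def B_def length_concat comp_def sum_list_upt block_def n_def)
    then show "length L = budget F" using slack by (simp add: sum.distrib budget_def m_def n_def)
    fix b assume "b \<in> set (sat_demands F)"
    then consider "b = ([4], m * n)" | "b = ([5], slack F)" | "b = ([6], slack F)"
      | j where "j < m" "b = (elem_C j, width F j - 1)"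
      | j v where "j < m" "v \<in> set (variables F)" "b = (elem_A j v, 1)"
      | j v where "j < m" "v \<in> set (variables F)" "b = (elem_B j v, 1)"
      unfolding sat_demand_set m_def n_def by auto
    then show "snd b \<le> cover L (fst b)"
    proof cases
      case 1
      have "(\<Sum>j<m. n) = (\<Sum>j<m. cover (block F \<sigma> j) [4]) + s"
        unfolding s_def sum.distrib[symmetric] using cover_block(2)[of F \<sigma>] by (simp add: n_def)
      moreover have "(\<Sum>j<m. cover (block F \<sigma> j) [4]) \<le> (\<Sum>j<m. cover (B j) [4])"
        by (intro sum_mono) (simp add: B_def)
      ultimately show ?thesis using 1 by (simp add: cov)
    next
      case 2
      have "(\<Sum>j<m. g j) \<le> (\<Sum>j<m. cover (B j) [5])" by (intro sum_mono) (simp add: B_def)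
      then show ?thesis using 2 slack by (simp add: cov)
    next
      case 3
      have "(\<Sum>j<m. g j) \<le> (\<Sum>j<m. cover (B j) [6])" by (intro sum_mono) (simp add: B_def)
      then show ?thesis using 3 slack by (simp add: cov)
    next
      case (4 j)
      have "cover (B j) (elem_C j) \<le> (\<Sum>j'<m. cover (B j') (elem_C j))"
        using 4 by (intro member_le_sum) auto
      moreover have "cover (B j) (elem_C j) = width F j - 1"
        using f[of j] 4 by (simp add: B_def cover_block g_def m_def)
      ultimately show ?thesis using 4 by (simp add: cov)
    next
      case (5 j v)
      \<comment> \<open>On the cycle, \<open>A\<close> of clause \<open>j\<close> is shared by
        \<open>X\<close> of \<open>j\<close> and by \<open>Y\<close> of the preceding clause
        \<open>i\<close>.\<close>
      obtain i where i: "i < m" "next_clause F i = j" using 5 next_clause_surj unfolding m_def by blast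
      have "(if \<sigma> v then triple_X F j v else triple_Y F i v) \<in> set L"
        using 5 i by (auto simp: L_def B_def block_def)
      moreover have "elem_A j v \<in> set (if \<sigma> v then triple_X F j v else triple_Y F i v)"
        using i by (simp add: triple_X_def triple_Y_def)
      ultimately show ?thesis using cover_pos 5 by simp
    next
      case (6 j v)
      have "(if \<sigma> v then triple_X F j v else triple_Y F j v) \<in> set L"
        using 6 by (auto simp: L_def B_def block_def)
      moreover have "elem_B j v \<in> set (if \<sigma> v then triple_X F j v else triple_Y F j v)"
        by (simp add: triple_X_def triple_Y_def)
      ultimately show ?thesis using cover_pos 6 by simp
    qed
  qed
qed

text \<open>As each \<open>B\<close> is covered once, exactly one of \<open>X\<close> and
  \<open>Y\<close> is chosen at every clause; as each \<open>A\<close> is covered once, exactly one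
  of \<open>Y\<close> at a clause and \<open>X\<close> at the next is. So the choice for a variable
  is the same at all clauses and defines an assignment. In a clause without true literal all slots
  would fall on its element, one more than demanded.\<close>

lemma cover_satisfiable:
  assumes F: "\<And>c. c \<in> set F \<Longrightarrow> c \<noteq> []"
    and L: "set L \<subseteq> set (sat_triples F)" and c: "\<And>b. b \<in> set (sat_demands F) \<Longrightarrow> cover L (fst b) = snd b"
  shows "satisfiable F"
proof -
  define \<sigma> where "\<sigma> v \<longleftrightarrow> triple_X F 0 v \<in> set L" for v
  have A: "cover L (elem_A j v) = 1" and B: "cover L (elem_B j v) = 1"
    if "j < length F" "v \<in> set (variables F)" for j v
    using c[of "(elem_A j v, 1)"] c[of "(elem_B j v, 1)"] that by (auto simp: sat_demand_set)
  have hasA: "t = triple_X F j v \<or> (\<exists>i < length F. t = triple_Y F i v \<and> next_clause F i = j)"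
    if "t \<in> set L" "elem_A j v \<in> set t" for t j v
    using subsetD[OF L that(1)] that(2)
    by (cases rule: sat_triples_cases) (auto simp: triple_X_def triple_Y_def elem_defs slot_def split: if_splits)
  have hasB: "t = triple_X F j v \<or> t = triple_Y F j v" if "t \<in> set L" "elem_B j v \<in> set t" for t j v
    using subsetD[OF L that(1)] that(2)
    by (cases rule: sat_triples_cases) (auto simp: triple_X_def triple_Y_def elem_defs slot_def split: if_splits)
  have XY: "triple_X F i v \<noteq> triple_Y F j w" for i j v w
    by (simp add: triple_X_def triple_Y_def elem_defs)
  have mem: "\<exists>t \<in> set L. c \<in> set t" if "cover L c = 1" for c
    using that by (auto simp: cover_def length_Suc_conv filter_eq_Cons_iff)
  have X_Y: "triple_X F j v \<in> set L \<longleftrightarrow> triple_Y F j v \<notin> set L" if jv: "j < length F" "v \<in> set (variables F)" for j v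
  proof
    assume "triple_X F j v \<in> set L"
    then show "triple_Y F j v \<notin> set L"
      using cover_1_unique[OF B[OF jv], of "triple_X F j v" "triple_Y F j v"] XY
      by (auto simp: triple_X_def triple_Y_def)
  next
    assume "triple_Y F j v \<notin> set L"
    then show "triple_X F j v \<in> set L" using mem[OF B[OF jv]] hasB by metis
  qed
  have Y_X: "triple_Y F i v \<notin> set L \<longleftrightarrow> triple_X F (Suc i) v \<in> set L" 
    if iv: "Suc i < length F" "v \<in> set (variables F)" for i v
  proof -
    have n: "next_clause F i = Suc i" using iv by (simp add: next_clause_def)
    show ?thesis
    proof
      assume "triple_Y F i v \<notin> set L"
      moreover obtain t where "t \<in> set L" "elem_A (Suc i) v \<in> set t" using mem[OF A[OF iv]] by blast
      ultimately show "triple_X F (Suc i) v \<in> set L"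
        using hasA[of t "Suc i" v] next_clause_inj[of _ F i] iv(1) n by (metis Suc_lessD)
    next
      assume "triple_X F (Suc i) v \<in> set L"
      then show "triple_Y F i v \<notin> set L"
        using cover_1_unique[OF A[OF iv], of "triple_X F (Suc i) v" "triple_Y F i v"] XY n
        by (auto simp: triple_X_def triple_Y_def)
    qed
  qed
  have X: "triple_X F j v \<in> set L \<longleftrightarrow> \<sigma> v" if "j < length F" "v \<in> set (variables F)" for j v
    using that
  proof (induction j)
    case (Suc j)
    then show ?case using X_Y[of j v] Y_X[of j v] by simp
  qed (simp add: \<sigma>_def)
  have "\<exists>l \<in> set (F ! j). \<sigma> (fst l) = snd l" if j: "j < length F" for j
  proof (rule ccontr)
    assume no: "\<not> (\<exists>l \<in> set (F ! j). \<sigma> (fst l) = snd l)"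
    \<comment> \<open>The triple through the slot of \<open>l\<close> that is chosen when
      \<open>l\<close> is false.\<close>
    define h where "h l = (if snd l then triple_Y F j (fst l) else triple_X F j (fst l))" for l :: literal
    have "inj_on h (set (F ! j))"
      by (rule inj_onI) (auto simp: h_def triple_X_def triple_Y_def elem_defs prod_eq_iff split: if_splits)
    then have "width F j = card (h ` set (F ! j))" using j by (simp add: card_image width_card)
    also have "\<dots> \<le> cover L (elem_C j)"
    proof (rule card_le_cover)
      have "h l \<in> set L \<and> elem_C j \<in> set (h l)" if l: "l \<in> set (F ! j)" for l
      proof -
        have v: "fst l \<in> set (variables F)" using l j by (force simp: variables_def)
        have "\<sigma> (fst l) \<noteq> snd l" using no l by blast
        then have "snd l \<longrightarrow> triple_Y F j (fst l) \<in> set L" "\<not> snd l \<longrightarrow> triple_X F j (fst l) \<in> set L"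
          using X[OF j v] X_Y[OF j v] by blast+
        then have "h l \<in> set L" by (simp add: h_def)
        moreover have "elem_C j \<in> set (h l)"
        proof -
          have s: "slot F j l = elem_C j" using l j by (simp add: slot_def clause_def)
          show ?thesis
          proof (cases "snd l")
            case True
            then have "l = (fst l, True)" by (simp add: prod_eq_iff)
            then have "slot F j (fst l, True) = elem_C j" using s by simp
            then show ?thesis using True by (simp add: h_def triple_Y_def)
          next
            case False
            then have "l = (fst l, False)" by (simp add: prod_eq_iff)
            then have "slot F j (fst l, False) = elem_C j" using s by simp
            then show ?thesis using False by (simp add: h_def triple_X_def)
          qed
        qed
        ultimately show ?thesis by blast
      qed
      then show "h ` set (F ! j) \<subseteq> set L" "\<And>t. t \<in> h ` set (F ! j) \<Longrightarrow> elem_C j \<in> set t" by auto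
    qed
    also have "\<dots> = width F j - 1"
      using c[of "(elem_C j, width F j - 1)"] j by (auto simp: sat_demand_set)
    \<comment> \<open>Subtraction is truncated: \<open>width F j \<le> width F j - 1\<close> is only
      possible for an empty clause.\<close>
    finally have "width F j = 0" by simp
    then show False using F[of "F ! j"] j by (simp add: width_card)
  qed
  then show ?thesis unfolding satisfiable_def by (metis in_set_conv_nth)
qed

section \<open>Names of candidates and the assembled reduction\<close>

definition word :: "nat list \<Rightarrow> bool list" where
  "word c = concat (map (\<lambda>n. replicate n True @ [False]) c) @ [True]"

lemma word_inject: "word a = word b \<Longrightarrow> a = b"
proof -
  have r: "replicate n True @ False # r = replicate m True @ False # s \<Longrightarrow> n = m \<and> r = s" for n m r s
  proof (induction n arbitrary: m)
    case 0
    then show ?case by (cases m) auto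
  next
    case (Suc n)
    then show ?case by (cases m) auto
  qed
  have e: "replicate n True @ False # r \<noteq> [True]" for n r
    by (cases n) (auto simp: append_eq_Cons_conv)
  show "word a = word b \<Longrightarrow> a = b"
  proof (induction a arbitrary: b)
    case Nil
    then show ?case using e by (cases b) (auto simp: word_def dest: sym)
  next
    case (Cons x a)
    show ?case
    proof (cases b)
      case Nil
      then show ?thesis using Cons.prems e by (simp add: word_def)
    next
      case (Cons y b')
      with Cons.prems have "replicate x True @ False # word a = replicate y True @ False # word b'"
        by (simp add: word_def)
      from r[OF this] Cons.IH show ?thesis by (simp add: Cons)
    qed
  qed
qed

text \<open>The number can be exponential in the length of its word, so the reduction writes the
  numeral \<open>word c\<close> directly. The closing \<open>True\<close> of a word is its most
  significant bit and makes it a proper numeral.\<close>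

definition label :: "nat list \<Rightarrow> nat" where
  "label c = unbinary (word c)"

lemma binary_label: "binary (label c) = word c"
  unfolding label_def by (rule binary_unbinary) (simp add: numeral_word_def word_def)

lemma inj_label: "inj label"
  by (rule injI) (metis binary_label word_inject)

lemma encode_instance_in_problem:
  "encode_instance cs V k p \<in> veto3_conformant_bribery_problem \<longleftrightarrow>
     distinct cs \<and> election (set cs) V \<and> p \<in> set cs \<and> veto3_conformant_bribable (set cs) V k p"
  (is "?l \<longleftrightarrow> ?r")
proof
  assume ?l
  then obtain cs' V' k' p' where "encode_instance cs V k p = encode_instance cs' V' k' p'"
    "distinct cs' \<and> election (set cs') V' \<and> p' \<in> set cs' \<and> veto3_conformant_bribable (set cs') V' k' p'"
    unfolding veto3_conformant_bribery_problem_def by auto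
  then show ?r using encode_instance_inject by metis
qed (auto simp: veto3_conformant_bribery_problem_def)

definition reduction :: "literal list list \<Rightarrow> bool list" where
  "reduction F = (let cs = cover_candidates [0] [1] [2] (sat_demands F);
     V = cover_votes [0] [1] [2] (sat_demands F) (sat_triples F) (budget F) in
     word_instance (map word cs) (map (map word) V) (binary (budget F)) (word [0]))"

lemma reduction_correct:
  assumes F: "\<And>c. c \<in> set F \<Longrightarrow> c \<noteq> []"
  shows "reduction F \<in> veto3_conformant_bribery_problem \<longleftrightarrow> satisfiable F"
proof -
  let ?cs = "cover_candidates [0] [1] [2] (sat_demands F)"
  let ?V = "cover_votes [0] [1] [2] (sat_demands F) (sat_triples F) (budget F)"
  have eq: "reduction F = encode_instance (map label ?cs) (map (map label) ?V) (budget F) (label [0])"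
    unfolding reduction_def encode_instance_word Let_def map_map comp_def binary_label ..
  have e: "election (set ?cs) ?V" 
    by (rule cover_votes_election[OF distinct_candidates sat_triples_triple sat_demands_sum sat_demands_le])
  have "map label v \<in> permutations_of_set (label ` set ?cs)" if "v \<in> set ?V" for v
  proof -
    have "v \<in> permutations_of_set (set ?cs)" using e that unfolding election_def by blast
    then show ?thesis using inj_on_subset[OF inj_label subset_UNIV] 
      by (simp add: permutations_of_set_def distinct_map)
  qed
  then have "election (set (map label ?cs)) (map (map label) ?V)"
    unfolding election_def by (simp add: image_subset_iff)
  moreover have "distinct (map label ?cs)"
    using distinct_candidates inj_on_subset[OF inj_label subset_UNIV] by (simp add: distinct_map)
  moreover have "label [0] \<in> set (map label ?cs)" by (simp add: cover_candidates_def)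
  ultimately have "reduction F \<in> veto3_conformant_bribery_problem \<longleftrightarrow>
      veto3_conformant_bribable (label ` set ?cs) (map (map label) ?V) (budget F) (label [0])"
    unfolding eq encode_instance_in_problem by simp
  also have "\<dots> \<longleftrightarrow> veto3_conformant_bribable (set ?cs) ?V (budget F) [0]"
    by (rule bribable_rename[OF inj_label])
  also have "\<dots> \<longleftrightarrow> satisfiable F"
  proof
    assume *: "veto3_conformant_bribable (set ?cs) ?V (budget F) [0]"
    show "satisfiable F"
    proof (rule bribable_cover[OF distinct_candidates _ sat_demands_sum _ *])
      fix L assume "set L \<subseteq> set (sat_triples F)"
        "\<And>b. b \<in> set (sat_demands F) \<Longrightarrow> cover L (fst b) = snd b"
      with F show "satisfiable F" by (rule cover_satisfiable)
    qed (fact sat_triples_triple sat_demands_le)+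
  next
    assume "satisfiable F"
    then obtain L where "set L \<subseteq> set (sat_triples F)" "length L = budget F"
      "\<And>b. b \<in> set (sat_demands F) \<Longrightarrow> snd b \<le> cover L (fst b)" by (rule satisfiable_cover) blast
    then show "veto3_conformant_bribable (set ?cs) ?V (budget F) [0]"
      by (intro cover_bribable[OF distinct_candidates _ sat_demands_sum] sat_triples_triple sat_demands_le)
  qed
  finally show ?thesis .
qed

lemma PT_sum_list: 
  assumes "PT l"
  shows "PT (\<lambda>x. sum_list (l x) :: nat)"
proof (rule PT_cong)
  show "PT (\<lambda>x. length (concat (map (\<lambda>n. replicate n ()) (l x))))" by (intro PT_intros assms)
  show "sum_list (l x) = length (concat (map (\<lambda>n. replicate n ()) (l x)))" for x
    by (simp add: length_concat comp_def)
qed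

lemma PT_reduction:
  assumes "PT F"
  shows "PT (\<lambda>x. reduction (F x))"
proof -
  have cl: "PT f \<Longrightarrow> PT j \<Longrightarrow> PT (\<lambda>x. clause (f x) (j x))" for f :: "'z::enc \<Rightarrow> _" and j
    unfolding clause_def by (intro PT_nth_or PT_const)
  have vs: "PT f \<Longrightarrow> PT (\<lambda>x. variables (f x))" for f :: "'z::enc \<Rightarrow> _"
    unfolding variables_def by (intro PT_intros)
  have w: "PT f \<Longrightarrow> PT j \<Longrightarrow> PT (\<lambda>x. width (f x) (j x))" for f :: "'z::enc \<Rightarrow> _" and j
    unfolding width_def by (intro PT_intros cl)
  have sl: "PT f \<Longrightarrow> PT j \<Longrightarrow> PT l \<Longrightarrow> PT (\<lambda>x. slot (f x) (j x) (l x))" for f :: "'z::enc \<Rightarrow> _" and j l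
    unfolding slot_def elem_defs by (intro PT_intros cl)
  have nc: "PT f \<Longrightarrow> PT j \<Longrightarrow> PT (\<lambda>x. next_clause (f x) (j x))" for f :: "'z::enc \<Rightarrow> _" and j
    unfolding next_clause_def by (intro PT_intros)
  have bu: "PT (\<lambda>x. budget (F x))" and sk: "PT (\<lambda>x. slack (F x))"
    unfolding budget_def slack_def by (intro PT_intros PT_sum_list w vs PT_comp[OF assms] assms)+
  have tr: "PT (\<lambda>x. sat_triples (F x))"
    unfolding sat_triples_def triple_X_def triple_Y_def elem_defs
    by (intro PT_intros sl nc vs PT_comp[OF assms] assms)
  have de: "PT (\<lambda>x. sat_demands (F x))"
    unfolding sat_demands_def elem_defs
    by (intro PT_intros w vs sk PT_comp[OF assms] assms)
  have ca: "PT (\<lambda>x. cover_candidates [0] [1] [2] (sat_demands (F x)))"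
    unfolding cover_candidates_def by (intro PT_intros de)
  have vf: "PT (\<lambda>x. vote_for (f x) (g x))" if f: "PT f" and g: "PT g"
    for f :: "'z::enc \<Rightarrow> nat list list" and g
    unfolding vote_for_def by (intro PT_intros PT_comp[OF g] f g)
  have co: "PT (\<lambda>x. cover (f x) (g x))" if f: "PT f" and g: "PT g"
    for f :: "'z::enc \<Rightarrow> nat list list list" and g
    unfolding cover_def by (intro PT_intros PT_comp[OF g] f)
  have wo: "PT f \<Longrightarrow> PT (\<lambda>x. word (f x))" for f :: "'z::enc \<Rightarrow> _"
    unfolding word_def by (intro PT_intros)
  have vo: "PT (\<lambda>x. cover_votes [0] [1] [2] (sat_demands (F x)) (sat_triples (F x)) (budget (F x)))"
    unfolding cover_votes_def Let_def
    by (intro PT_intros vf co de tr bu ca PT_comp[OF de] PT_comp[OF tr] PT_comp[OF bu] PT_comp[OF ca])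
  show ?thesis
    unfolding reduction_def Let_def
    by (intro PT_word_instance PT_intros wo vo ca bu)
qed

section \<open>Satisfiability of the computation tableau\<close>

text \<open>
  Tape contents are described relative to the head, so that the read symbol is always in the
  same place and a move shifts the whole tape. All clauses about steps are then Horn clauses.
\<close>

definition rel :: "tape \<Rightarrow> int \<Rightarrow> nat" where
  "rel tp z = fst tp (snd tp + z)"

text \<open>The halting state idles, as in \<open>step\<close>, so that every state has a row and
  the tableau covers exactly \<open>T\<close> steps.\<close>

definition delta :: "tm \<Rightarrow> nat \<Rightarrow> nat list \<Rightarrow> nat \<times> (nat \<times> move) list" where
  "delta M q rs = (if q < num_states M then transition M q rs else (q, idle rs))"

text \<open>Relative to the head, a move by \<open>offset d\<close> displaces the contents by
  \<open>- offset d\<close>. Adding 1 makes this a natural number; the clauses subtract it again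
  from the index of the cell.\<close>

fun shift :: "move \<Rightarrow> nat" where
  "shift MoveLeft = 2" | "shift Stay = 1" | "shift MoveRight = 0"

lemma shift_offset: "int (shift d) = 1 - offset d"
  by (cases d) auto

lemma rel_act: "rel (act (a, d) tp) z = (if z = - offset d then a else rel tp (z + offset d))"
  by (cases tp) (auto simp: rel_def algebra_simps)

lemma step_delta: "step M (q, ts) = (case delta M q (map read_tape ts) of (q', as) \<Rightarrow> (q', map2 act as ts))"
  by (simp add: delta_def map2_act_idle)

lemma read_rel: "read_tape tp = rel tp 0"
  by (cases tp) (simp add: rel_def)

type_synonym entry = "nat \<times> (nat \<times> nat) list \<times> nat \<times> (nat \<times> nat \<times> nat) list"

text \<open>The machine is fixed, so the rows of its transition table are constants of the
  reduction, written as lists with explicit tape numbers.\<close>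

definition entry :: "tm \<Rightarrow> nat \<Rightarrow> nat list \<Rightarrow> entry" where
  "entry M q rs = (q, map (\<lambda>i. (i, rs ! i)) [0..<num_tapes M], fst (delta M q rs),
     map (\<lambda>i. (i, fst (snd (delta M q rs) ! i), shift (snd (snd (delta M q rs) ! i)))) [0..<num_tapes M])"

definition entries :: "tm \<Rightarrow> entry list" where
  "entries M = concat (map (\<lambda>q. map (entry M q) (List.n_lists (num_tapes M) [0..<alphabet_size M]))
     [0..<Suc (num_states M)])"

definition state_var :: "nat \<Rightarrow> nat \<Rightarrow> nat list" where
  "state_var t q = [0, t, q]"

definition cell_var :: "nat \<Rightarrow> nat \<Rightarrow> nat \<Rightarrow> nat \<Rightarrow> nat list" where
  "cell_var t i j a = [1, t, i, j, a]"

text \<open>The negated premises shared by all Horn clauses of a row; \<open>c\<close> is the index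
  of the cell under the head.\<close>

definition body :: "nat \<Rightarrow> nat \<Rightarrow> entry \<Rightarrow> literal list" where
  "body c t e = (state_var t (fst e), False) # map (\<lambda>s. (cell_var t (fst s) c (snd s), False)) (fst (snd e))"

text \<open>The cell under the head receives the written symbol, any other cell is copied to its
  displaced index. Indices start at 1 so that \<open>j + shift - 1\<close> does not
  truncate.\<close>

definition step_clauses :: "tm \<Rightarrow> nat \<Rightarrow> nat \<Rightarrow> nat \<Rightarrow> entry \<Rightarrow> literal list list" where
  "step_clauses M N c t e =
     ((state_var (Suc t) (fst (snd (snd e))), True) # body c t e) #
     concat (map (\<lambda>r.
       ((cell_var (Suc t) (fst r) (c + snd (snd r) - 1) (fst (snd r)), True) # body c t e) #
       concat (map (\<lambda>j. if j = c then [] else map (\<lambda>a.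
         (cell_var (Suc t) (fst r) (j + snd (snd r) - 1) a, True) # (cell_var t (fst r) j a, False) # body c t e)
         [0..<alphabet_size M]) (map Suc [0..<N])))
       (snd (snd (snd e))))"

text \<open>The certificate is left open: each of its \<open>m\<close> cells holds a bit or a blank,
  and a blank forces a blank to its right, so any word of length at most \<open>m\<close> can be
  chosen. The inner conditional is indexing with a default.\<close>

definition start_clauses :: "tm \<Rightarrow> nat \<Rightarrow> nat \<Rightarrow> nat \<Rightarrow> bool list \<Rightarrow> literal list list" where
  "start_clauses M N c m x =
     [[(state_var 0 0, True)]] @
     concat (map (\<lambda>i. map (\<lambda>j. [(cell_var 0 (Suc i) j 0, True)]) [0..<N]) [0..<num_tapes M - 1]) @
     map (\<lambda>j. [(cell_var 0 0 j 0, True)]) [0..<c] @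
     map (\<lambda>l. [(cell_var 0 0 (c + l) (if (if l < length x then x ! l else False) then 2 else 1), True)]) [0..<length x] @
     [[(cell_var 0 0 (c + length x) 3, True)]] @
     map (\<lambda>l. [(cell_var 0 0 (c + length x + 1 + l) 1, True), (cell_var 0 0 (c + length x + 1 + l) 2, True),
       (cell_var 0 0 (c + length x + 1 + l) 0, True)]) [0..<m] @
     map (\<lambda>l. [(cell_var 0 0 (c + length x + 1 + l) 0, False), (cell_var 0 0 (c + length x + 1 + Suc l) 0, True)]) [0..<m] @
     map (\<lambda>l. [(cell_var 0 0 (c + length x + 1 + (m + l)) 0, True)]) [0..<N]"

text \<open>Knowledge of the cells shrinks by one cell on each side per step, and after
  \<open>T\<close> steps the output cell is at most \<open>T\<close> away from the head. Hence a
  radius of \<open>2 * T\<close> is required at the start; with the head at index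
  \<open>2 * T + 1\<close>, it occupies the indices from 1 to \<open>2 * c - 1\<close>. The last
  clauses forbid the symbol 1, i.e. the answer \<open>False\<close>.\<close>

definition tableau :: "tm \<Rightarrow> nat \<Rightarrow> nat \<Rightarrow> bool list \<Rightarrow> literal list list" where
  "tableau M T m x = (let c = 2 * T + 1; N = 2 * c in
     start_clauses M N c m x @
     concat (map (\<lambda>t. concat (map (step_clauses M N c t) (entries M))) [0..<T]) @
     map (\<lambda>j. [(cell_var T (num_tapes M - 1) j 1, False)]) [0..<N])"

text \<open>Required by \<open>reduction_correct\<close>: an empty clause would be given demand 0 by
  truncated subtraction.\<close>

lemma tableau_nonempty: "c \<in> set (tableau M T m x) \<Longrightarrow> c \<noteq> []"
  by (auto simp: tableau_def start_clauses_def step_clauses_def Let_def split: if_splits)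

lemma PT_tableau:
  assumes T: "PT T" and m: "PT m" and x: "PT x"
  shows "PT (\<lambda>y. tableau M (T y) (m y) (x y))"
proof -
  have b: "PT (\<lambda>y. body (c y) (t y) (e y))" if c: "PT c" and t: "PT t" and e: "PT e" for c t e :: "'z::enc \<Rightarrow> _"
    unfolding body_def state_var_def cell_var_def
    by (intro PT_intros PT_comp[OF c] PT_comp[OF t] t e)
  have s: "PT (\<lambda>y. step_clauses M (N y) (c y) (t y) (e y))"
    if N: "PT N" and c: "PT c" and t: "PT t" and e: "PT e" for N c t e :: "'z::enc \<Rightarrow> _"
    unfolding step_clauses_def state_var_def cell_var_def
    by (intro PT_intros b PT_comp[OF N] PT_comp[OF c] PT_comp[OF t] PT_comp[OF e] c t e)
  have i: "PT (\<lambda>y. start_clauses M (N y) (c y) (m y) (x y))"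
    if N: "PT N" and c: "PT c" and m: "PT m" and x: "PT x" for N c m x :: "'z::enc \<Rightarrow> _"
    unfolding start_clauses_def state_var_def cell_var_def
    by (intro PT_intros PT_nth_or PT_comp[OF N] PT_comp[OF c] PT_comp[OF m] PT_comp[OF x] N c m x)
  show ?thesis
    unfolding tableau_def Let_def cell_var_def
    by (intro PT_intros s i PT_comp[OF T] T m x)
qed

section \<open>Meaning of the clauses\<close>

definition holds :: "(nat list \<Rightarrow> bool) \<Rightarrow> literal list \<Rightarrow> bool" where
  "holds \<sigma> cl \<longleftrightarrow> (\<exists>l \<in> set cl. \<sigma> (fst l) = snd l)"

lemma holds_simps [simp]: "holds \<sigma> [] = False" "holds \<sigma> (l # cl) \<longleftrightarrow> \<sigma> (fst l) = snd l \<or> holds \<sigma> cl"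
  by (auto simp: holds_def)

definition premise :: "tm \<Rightarrow> (nat list \<Rightarrow> bool) \<Rightarrow> nat \<Rightarrow> nat \<Rightarrow> nat \<Rightarrow> nat list \<Rightarrow> bool" where
  "premise M \<sigma> c t q rs \<longleftrightarrow> \<sigma> (state_var t q) \<and> (\<forall>i < num_tapes M. \<sigma> (cell_var t i c (rs ! i)))"

lemma holds_body: "holds \<sigma> (body c t (entry M q rs)) \<longleftrightarrow> \<not> premise M \<sigma> c t q rs"
  by (auto simp: body_def entry_def premise_def holds_def)

lemma entries_iff:
  "e \<in> set (entries M) \<longleftrightarrow> (\<exists>q rs. q \<le> num_states M \<and> length rs = num_tapes M \<and>
     set rs \<subseteq> {..<alphabet_size M} \<and> e = entry M q rs)"
proof -
  have "set [0..<Suc (num_states M)] = {..num_states M}" by auto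
  then show ?thesis
    unfolding entries_def set_concat set_map by (auto simp: set_n_lists lessThan_atLeast0 image_iff)
qed

definition step_holds :: "tm \<Rightarrow> (nat list \<Rightarrow> bool) \<Rightarrow> nat \<Rightarrow> nat \<Rightarrow> nat \<Rightarrow> nat \<Rightarrow> nat list \<Rightarrow> bool" where
  "step_holds M \<sigma> N c t q rs \<longleftrightarrow> (premise M \<sigma> c t q rs \<longrightarrow>
     \<sigma> (state_var (Suc t) (fst (delta M q rs))) \<and>
     (\<forall>i < num_tapes M. \<sigma> (cell_var (Suc t) i (c + shift (snd (snd (delta M q rs) ! i)) - 1) (fst (snd (delta M q rs) ! i))) \<and>
        (\<forall>j < N. Suc j \<noteq> c \<longrightarrow> (\<forall>a < alphabet_size M. \<sigma> (cell_var t i (Suc j) a) \<longrightarrow>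
           \<sigma> (cell_var (Suc t) i (j + shift (snd (snd (delta M q rs) ! i))) a)))))"

lemma ball_concat_map: "(\<forall>x \<in> set (concat (map f xs)). P x) \<longleftrightarrow> (\<forall>y \<in> set xs. \<forall>x \<in> set (f y). P x)"
  by auto

lemma step_clauses_hold:
  "(\<forall>cl \<in> set (step_clauses M N c t (entry M q rs)). holds \<sigma> cl) \<longleftrightarrow> step_holds M \<sigma> N c t q rs"
proof -
  have "(\<forall>cl \<in> set (step_clauses M N c t (entry M q rs)). holds \<sigma> cl) \<longleftrightarrow>
     (\<sigma> (state_var (Suc t) (fst (delta M q rs))) \<or> \<not> premise M \<sigma> c t q rs) \<and>
     (\<forall>i < num_tapes M. let ad = snd (delta M q rs) ! i in
        (\<sigma> (cell_var (Suc t) i (c + shift (snd ad) - 1) (fst ad)) \<or> \<not> premise M \<sigma> c t q rs) \<and>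
        (\<forall>j < N. \<forall>cl \<in> set (if Suc j = c then [] else map (\<lambda>a.
           (cell_var (Suc t) i (Suc j + shift (snd ad) - 1) a, True) # (cell_var t i (Suc j) a, False) # body c t (entry M q rs))
           [0..<alphabet_size M]). holds \<sigma> cl))"
    unfolding step_clauses_def 
    by (simp only: list.set ball_simps set_append ball_Un ball_concat_map holds_simps holds_body fst_conv snd_conv
        simp_thms Let_def entry_def[of M q rs] set_map set_upt)
      (auto simp: holds_body[unfolded entry_def] entry_def)
  also have "\<dots> \<longleftrightarrow> step_holds M \<sigma> N c t q rs"
    unfolding step_holds_def Let_def by (auto simp: holds_body)
  finally show ?thesis .
qed

section \<open>The run on a fixed input and what the clauses force\<close>

context
  fixes M :: tm and w :: "nat list"
  assumes M: "turing_machine M" and w: "set w \<subseteq> {..<4}"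
begin

definition conf :: "nat \<Rightarrow> config" where
  "conf t = (step M ^^ t) (initial M w)"

definition state :: "nat \<Rightarrow> nat" where
  "state t = fst (conf t)"

definition cell :: "nat \<Rightarrow> nat \<Rightarrow> int \<Rightarrow> nat" where
  "cell t i z = rel (snd (conf t) ! i) z"

abbreviation (input) "tapes \<equiv> num_tapes M"

definition reads :: "nat \<Rightarrow> nat list" where
  "reads t = map (\<lambda>i. cell t i 0) [0..<tapes]"

lemma tapes_pos: "tapes \<ge> 1" and alphabet: "alphabet_size M \<ge> 4"
  using M by (auto simp: turing_machine_def)

lemma delta_wf:
  assumes "q \<le> num_states M" "length rs = tapes" "set rs \<subseteq> {..<alphabet_size M}"
  shows "fst (delta M q rs) \<le> num_states M" "length (snd (delta M q rs)) = tapes"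
    "\<And>i. i < tapes \<Longrightarrow> fst (snd (delta M q rs) ! i) < alphabet_size M"
proof -
  have *: "case delta M q rs of (q', as) \<Rightarrow> q' \<le> num_states M \<and> length as = tapes \<and>
      (\<forall>(a, d) \<in> set as. a < alphabet_size M)"
  proof (cases "q < num_states M")
    case True
    then show ?thesis using M assms by (simp add: turing_machine_def delta_def)
  next
    case False
    then show ?thesis using assms by (auto simp: delta_def idle_def)
  qed
  then show "fst (delta M q rs) \<le> num_states M" "length (snd (delta M q rs)) = tapes"
    by (auto split: prod.splits)
  show "fst (snd (delta M q rs) ! i) < alphabet_size M" if "i < tapes" for i
    using * that nth_mem[of i "snd (delta M q rs)"]
    by (cases "snd (delta M q rs) ! i") (auto split: prod.splits)
qed

lemma conf_Suc:
  assumes "length (snd (conf t)) = tapes"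
  shows "conf (Suc t) = (fst (delta M (state t) (reads t)), map2 act (snd (delta M (state t) (reads t))) (snd (conf t)))"
proof -
  have "map read_tape (snd (conf t)) = reads t"
    using assms by (auto simp: reads_def cell_def read_rel intro!: nth_equalityI)
  moreover have "conf (Suc t) = step M (state t, snd (conf t))"
    by (simp add: conf_def state_def)
  ultimately show ?thesis by (simp only: step_delta split: prod.splits) simp
qed

lemma initial_cell: "cell 0 0 z = contents w z" "Suc i < tapes \<Longrightarrow> cell 0 (Suc i) z = 0"
  by (auto simp: cell_def conf_def initial_def rel_def contents_def)

lemma run_invariant:
  "length (snd (conf t)) = tapes \<and> state t \<le> num_states M \<and>
   (\<forall>i < tapes. (\<forall>z. cell t i z < alphabet_size M) \<and> \<bar>snd (snd (conf t) ! i)\<bar> \<le> int t)"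
proof (induction t)
  case 0
  have "contents w z < 4" for z
  proof (cases "0 \<le> z \<and> z < int (length w)")
    case True
    then have "w ! nat z \<in> set w" by (intro nth_mem) linarith
    with w True show ?thesis by (auto simp: contents_def)
  qed (auto simp: contents_def)
  then have "cell 0 i z < alphabet_size M" if "i < tapes" for i z
    using that alphabet initial_cell by (cases i) (auto intro: less_le_trans)
  then show ?case using tapes_pos
    by (auto simp: conf_def initial_def state_def nth_Cons')
next
  case (Suc t)
  have "length (reads t) = tapes" "set (reads t) \<subseteq> {..<alphabet_size M}"
    using Suc by (auto simp: reads_def)
  note d = delta_wf[OF _ this, of "state t"]
  note c = conf_Suc[of t]
  have off: "\<bar>offset m\<bar> \<le> 1" for m by (cases m) auto
  have "\<bar>h + offset m\<bar> \<le> 1 + int t" if "\<bar>h\<bar> \<le> int t" for h m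
    using that off[of m] by linarith
  moreover have "snd (act (a, m) tp) = snd tp + offset m" for a m tp by (cases tp) simp
  moreover have "rel (act (a, m) tp) z < alphabet_size M" 
    if "a < alphabet_size M" "\<And>z. rel tp z < alphabet_size M" for a m tp z
    using that by (simp add: rel_act)
  ultimately have "(\<forall>z. rel (act am tp) z < alphabet_size M) \<and> \<bar>snd (act am tp)\<bar> \<le> 1 + int t"
    if "fst am < alphabet_size M" "\<And>z. rel tp z < alphabet_size M" "\<bar>snd tp\<bar> \<le> int t" for am tp
    using that by (cases am) simp
  moreover have "length (snd (conf t)) = tapes" "state t \<le> num_states M"
    "\<And>i z. i < tapes \<Longrightarrow> rel (snd (conf t) ! i) z < alphabet_size M"
    "\<And>i. i < tapes \<Longrightarrow> \<bar>snd (snd (conf t) ! i)\<bar> \<le> int t"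
    using Suc.IH by (simp_all add: cell_def)
  ultimately show ?case using d c by (simp add: cell_def state_def)
qed

lemma reads_wf: "length (reads t) = tapes" "set (reads t) \<subseteq> {..<alphabet_size M}"
  using run_invariant[of t] by (auto simp: reads_def)

lemma cell_Suc:
  assumes "i < tapes" "snd (delta M (state t) (reads t)) ! i = (a, d)"
  shows "cell (Suc t) i z = (if z = - offset d then a else cell t i (z + offset d))"
  using assms run_invariant[of t] conf_Suc[of t] delta_wf(2)[OF _ reads_wf]
  by (simp add: cell_def rel_act)

lemma state_Suc: "state (Suc t) = fst (delta M (state t) (reads t))"
  using run_invariant[of t] conf_Suc[of t] by (simp add: state_def)

text \<open>The assignment read off from the run: index \<open>j\<close> stands for the cell at
  distance \<open>j - c\<close> from the head.\<close>

definition truth :: "nat \<Rightarrow> nat list \<Rightarrow> bool" where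
  "truth c v \<longleftrightarrow> (if v ! 0 = 0 then state (v ! 1) = v ! 2 else cell (v ! 1) (v ! 2) (int (v ! 3) - int c) = v ! 4)"

lemma truth_simps [simp]:
  "truth c (state_var t q) \<longleftrightarrow> state t = q"
  "truth c (cell_var t i j a) \<longleftrightarrow> cell t i (int j - int c) = a"
  by (simp_all add: truth_def state_var_def cell_var_def)

lemma truth_step:
  assumes "length rs = tapes" "c \<ge> 1"
  shows "step_holds M (truth c) N c t q rs"
  unfolding step_holds_def
proof (intro impI)
  assume p: "premise M (truth c) c t q rs"
  then have q: "q = state t" and rs: "rs = reads t"
    using assms(1) by (auto simp: premise_def reads_def intro!: nth_equalityI)
  have *: "cell (Suc t) i (int (c + shift d - 1) - int c) = a \<and>
      (\<forall>j < N. Suc j \<noteq> c \<longrightarrow> cell (Suc t) i (int (j + shift d) - int c) = cell t i (int (Suc j) - int c))"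
    if i: "i < tapes" and d: "snd (delta M (state t) (reads t)) ! i = (a, d)" for i a d
  proof -
    have "int (c + shift d - 1) - int c = - offset d" 
      using assms(2) shift_offset[of d] by (simp add: of_nat_diff)
    moreover have "cell (Suc t) i (int (j + shift d) - int c) = cell t i (int (Suc j) - int c)" if "Suc j \<noteq> c" for j
    proof -
      define z where "z = int (Suc j) - int c"
      have "int (j + shift d) - int c = z - offset d" using shift_offset[of d] by (simp add: z_def)
      moreover have "z \<noteq> 0" using that by (simp add: z_def)
      ultimately show ?thesis unfolding z_def[symmetric] by (simp add: cell_Suc[OF i d])
    qed
    ultimately show ?thesis by (simp add: cell_Suc[OF i d])
  qed
  then show "truth c (state_var (Suc t) (fst (delta M q rs))) \<and>
     (\<forall>i < tapes. truth c (cell_var (Suc t) i (c + shift (snd (snd (delta M q rs) ! i)) - 1) (fst (snd (delta M q rs) ! i))) \<and>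
        (\<forall>j < N. Suc j \<noteq> c \<longrightarrow> (\<forall>a < alphabet_size M. truth c (cell_var t i (Suc j) a) \<longrightarrow>
           truth c (cell_var (Suc t) i (j + shift (snd (snd (delta M q rs) ! i))) a))))"
    unfolding q rs truth_simps
  proof (intro conjI allI impI)
    show "state (Suc t) = fst (delta M (state t) (reads t))" by (rule state_Suc)
    fix i assume i: "i < tapes"
    note * = *[OF i, of "fst (snd (delta M (state t) (reads t)) ! i)" "snd (snd (delta M (state t) (reads t)) ! i)"]
    show "cell (Suc t) i (int (c + shift (snd (snd (delta M (state t) (reads t)) ! i)) - 1) - int c) =
        fst (snd (delta M (state t) (reads t)) ! i)"
      using * by simp
    show "cell (Suc t) i (int (j + shift (snd (snd (delta M (state t) (reads t)) ! i))) - int c) = a"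
      if "j < N" "Suc j \<noteq> c" "cell t i (int (Suc j) - int c) = a" for j a
      using * that by simp
  qed
qed

text \<open>A cell copied to position \<open>z\<close> was at \<open>z + offset d\<close> before the
  step, so the known radius \<open>k\<close> shrinks by one.\<close>

lemma forced_step:
  assumes st: "step_holds M \<sigma> (2 * c) c t (state t) (reads t)"
    and s: "\<sigma> (state_var t (state t))" and k: "k < int c"
    and cl: "\<And>i z. i < tapes \<Longrightarrow> \<bar>z\<bar> \<le> k \<Longrightarrow> \<sigma> (cell_var t i (nat (z + int c)) (cell t i z))"
    and k1: "1 \<le> k"
  shows "\<sigma> (state_var (Suc t) (state (Suc t)))"
    "\<And>i z. i < tapes \<Longrightarrow> \<bar>z\<bar> \<le> k - 1 \<Longrightarrow> \<sigma> (cell_var (Suc t) i (nat (z + int c)) (cell (Suc t) i z))"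
proof -
  have "premise M \<sigma> c t (state t) (reads t)"
    using s cl[of _ 0] k1 by (simp add: premise_def reads_def)
  with st have st: "\<sigma> (state_var (Suc t) (state (Suc t)))"
    "\<And>i a d. i < tapes \<Longrightarrow> snd (delta M (state t) (reads t)) ! i = (a, d) \<Longrightarrow>
       \<sigma> (cell_var (Suc t) i (c + shift d - 1) a) \<and>
        (\<forall>j < 2 * c. Suc j \<noteq> c \<longrightarrow> (\<forall>a < alphabet_size M. \<sigma> (cell_var t i (Suc j) a) \<longrightarrow>
           \<sigma> (cell_var (Suc t) i (j + shift d) a)))"
    unfolding step_holds_def state_Suc by auto
  show "\<sigma> (state_var (Suc t) (state (Suc t)))" by (rule st(1))
  fix i and z :: int assume i: "i < tapes" and z: "\<bar>z\<bar> \<le> k - 1"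
  obtain a d where d: "snd (delta M (state t) (reads t)) ! i = (a, d)" by fastforce
  have off: "\<bar>offset d\<bar> \<le> 1" by (cases d) auto
  show "\<sigma> (cell_var (Suc t) i (nat (z + int c)) (cell (Suc t) i z))"
  proof (cases "z = - offset d")
    case True
    then have "nat (z + int c) = c + shift d - 1" using shift_offset[of d] k k1 by linarith
    then show ?thesis using st(2)[OF i d] True by (simp add: cell_Suc[OF i d])
  next
    case False
    define j where "j = nat (z + offset d + int c) - 1"
    have j: "Suc j = nat (z + offset d + int c)" "j < 2 * c" "Suc j \<noteq> c" "j + shift d = nat (z + int c)"
      using False z k off shift_offset[of d] unfolding j_def by linarith+
    have "\<sigma> (cell_var t i (Suc j) (cell t i (z + offset d)))"
      unfolding j(1) using z off by (intro cl i) linarith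
    moreover have "cell t i (z + offset d) < alphabet_size M" using run_invariant i by blast
    ultimately have "\<sigma> (cell_var (Suc t) i (j + shift d) (cell t i (z + offset d)))"
      using st(2)[OF i d] j(2,3) by blast
    then show ?thesis unfolding j(4) using False by (simp add: cell_Suc[OF i d])
  qed
qed

text \<open>Nothing prevents \<sigma> from satisfying further variables; unit propagation through
  the Horn clauses shows that those of the run hold.\<close>

lemma forced:
  assumes st: "\<And>t e cl. t < T \<Longrightarrow> e \<in> set (entries M) \<Longrightarrow> cl \<in> set (step_clauses M (2 * c) c t e) \<Longrightarrow> holds \<sigma> cl"
    and s: "\<sigma> (state_var 0 0)" and c: "c = 2 * T + 1"
    and cl: "\<And>i z. i < tapes \<Longrightarrow> \<bar>z\<bar> \<le> 2 * int T \<Longrightarrow> \<sigma> (cell_var 0 i (nat (z + int c)) (cell 0 i z))"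
    and "t \<le> T"
  shows "\<sigma> (state_var t (state t)) \<and>
    (\<forall>i < tapes. \<forall>z. \<bar>z\<bar> \<le> 2 * int T - int t \<longrightarrow> \<sigma> (cell_var t i (nat (z + int c)) (cell t i z)))"
  using \<open>t \<le> T\<close>
proof (induction t)
  case 0
  have "state 0 = 0" by (simp add: state_def conf_def initial_def)
  then show ?case using s cl by simp
next
  case (Suc t)
  have "entry M (state t) (reads t) \<in> set (entries M)"
    unfolding entries_iff using run_invariant[of t] reads_wf[of t] by blast
  then have "step_holds M \<sigma> (2 * c) c t (state t) (reads t)"
    unfolding step_clauses_hold[symmetric] using st Suc.prems by (metis Suc_le_eq)
  then show ?case
    using Suc forced_step[of \<sigma> c t "2 * int T - int t"] c by (simp add: algebra_simps)
qed

lemma output_cell: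
  assumes "outputs_within M w T v"
  shows "cell T (tapes - 1) z = contents v (snd (snd (conf T) ! (tapes - 1)) + z)"
proof -
  have "fst (last (snd (conf T))) = contents v"
    using assms by (auto simp: outputs_within_def conf_def split: prod.splits)
  moreover have "last (snd (conf T)) = snd (conf T) ! (tapes - 1)"
    using run_invariant[of T] tapes_pos by (subst last_conv_nth) auto
  ultimately show ?thesis by (simp add: cell_def rel_def)
qed

end

section \<open>Satisfiability of the tableau and accepted certificates\<close>

lemma satisfiable_holds: "satisfiable F \<longleftrightarrow> (\<exists>\<sigma>. \<forall>cl \<in> set F. holds \<sigma> cl)"
  by (simp add: satisfiable_def holds_def)

lemma contents_pair:
  "z < 0 \<Longrightarrow> contents (pair_symbols x u) z = 0"
  "l < length x \<Longrightarrow> contents (pair_symbols x u) (int l) = (if x ! l then 2 else 1)"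
  "contents (pair_symbols x u) (int (length x)) = 3"
  "contents (pair_symbols x u) (int (length x + 1 + l)) = (if l < length u then if u ! l then 2 else 1 else 0)"
  by (auto simp: contents_def pair_symbols_def symbols_def nth_append nth_Cons' nat_add_distrib)

lemma start_clauses_hold:
  "(\<forall>cl \<in> set (start_clauses M N c m x). holds \<sigma> cl) \<longleftrightarrow>
     \<sigma> (state_var 0 0) \<and> (\<forall>i < num_tapes M - 1. \<forall>j < N. \<sigma> (cell_var 0 (Suc i) j 0)) \<and>
     (\<forall>j < c. \<sigma> (cell_var 0 0 j 0)) \<and>
     (\<forall>l < length x. \<sigma> (cell_var 0 0 (c + l) (if x ! l then 2 else 1))) \<and>
     \<sigma> (cell_var 0 0 (c + length x) 3) \<and>
     (\<forall>l < m. \<sigma> (cell_var 0 0 (c + length x + 1 + l) 1) \<or> \<sigma> (cell_var 0 0 (c + length x + 1 + l) 2) \<or>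
        \<sigma> (cell_var 0 0 (c + length x + 1 + l) 0)) \<and>
     (\<forall>l < m. \<sigma> (cell_var 0 0 (c + length x + 1 + l) 0) \<longrightarrow> \<sigma> (cell_var 0 0 (c + length x + 1 + Suc l) 0)) \<and>
     (\<forall>l < N. \<sigma> (cell_var 0 0 (c + length x + 1 + (m + l)) 0))"
  unfolding start_clauses_def set_append ball_Un ball_concat_map set_map ball_simps set_upt
  by (auto simp: atLeast0LessThan)

lemma tableau_hold:
  "(\<forall>cl \<in> set (tableau M T m x). holds \<sigma> cl) \<longleftrightarrow>
     (\<forall>cl \<in> set (start_clauses M (2 * (2 * T + 1)) (2 * T + 1) m x). holds \<sigma> cl) \<and>
     (\<forall>t < T. \<forall>e \<in> set (entries M). \<forall>cl \<in> set (step_clauses M (2 * (2 * T + 1)) (2 * T + 1) t e). holds \<sigma> cl) \<and>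
     (\<forall>j < 2 * (2 * T + 1). \<not> \<sigma> (cell_var T (num_tapes M - 1) j 1))"
  unfolding tableau_def Let_def set_append ball_Un ball_concat_map set_map ball_simps set_upt
  by (auto simp: atLeast0LessThan)

lemma tableau_satisfiable_if:
  assumes M: "turing_machine M" and u: "length u \<le> m"
    and out: "outputs_within M (pair_symbols x u) T (symbols [True])"
  shows "satisfiable (tableau M T m x)"
  unfolding satisfiable_holds
proof
  let ?c = "2 * T + 1"
  have "set (pair_symbols x u) \<subseteq> {..<4}"
    by (auto simp: pair_symbols_def symbols_def)
  note run = M this
  let ?\<sigma> = "truth M (pair_symbols x u) ?c"
  define h where "h j = contents (pair_symbols x u) (int j - int ?c)" for j
  have cell: "?\<sigma> (cell_var 0 0 j a) \<longleftrightarrow> h j = a" for j a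
    unfolding truth_simps(2)[OF run] initial_cell(1)[OF run] h_def ..
  have h: "j < ?c \<Longrightarrow> h j = 0" "l < length x \<Longrightarrow> h (?c + l) = (if x ! l then 2 else 1)"
    "h (?c + length x) = 3"
    "h (?c + length x + 1 + l) = (if l < length u then if u ! l then 2 else 1 else 0)" for j l
  proof -
    have "int (?c + l) - int ?c = int l" "int (?c + length x) - int ?c = int (length x)"
      "int (?c + length x + 1 + l) - int ?c = int (length x + 1 + l)" by simp_all
    then show "l < length x \<Longrightarrow> h (?c + l) = (if x ! l then 2 else 1)" "h (?c + length x) = 3"
      "h (?c + length x + 1 + l) = (if l < length u then if u ! l then 2 else 1 else 0)"
      unfolding h_def using contents_pair(2-4) by metis+
  qed (simp add: h_def contents_pair(1))
  have "\<forall>cl \<in> set (start_clauses M (2 * ?c) ?c m x). holds ?\<sigma> cl"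
    unfolding start_clauses_hold cell
  proof (intro conjI allI impI)
    show "?\<sigma> (state_var 0 0)"
      unfolding truth_simps(1)[OF run] by (simp add: state_def[OF run] conf_def[OF run] initial_def)
    show "?\<sigma> (cell_var 0 (Suc i) j 0)" if "i < num_tapes M - 1" for i j
      unfolding truth_simps(2)[OF run] using that by (intro initial_cell(2)[OF run]) simp
    show "h (?c + length x + 1 + l) = 1 \<or> h (?c + length x + 1 + l) = 2 \<or> h (?c + length x + 1 + l) = 0" for l
      unfolding h(4) by simp
    show "h (?c + length x + 1 + Suc l) = 0" if "h (?c + length x + 1 + l) = 0" for l
      using that unfolding h(4) by (simp split: if_splits)
    show "h (?c + length x + 1 + (m + l)) = 0" for l
      unfolding h(4) using u by simp
  qed (use h in auto)
  moreover have "\<forall>cl \<in> set (step_clauses M (2 * ?c) ?c t e). holds ?\<sigma> cl" if "e \<in> set (entries M)" for t e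
  proof -
    from that obtain q rs where "length rs = num_tapes M" "e = entry M q rs"
      unfolding entries_iff by blast
    then show ?thesis using truth_step[OF run, of rs ?c "2 * ?c" t q] step_clauses_hold[of M "2 * ?c" ?c t q rs ?\<sigma>]
      by simp
  qed
  moreover have "\<not> ?\<sigma> (cell_var T (num_tapes M - 1) j 1)" for j
  proof -
    have "contents [2] z \<noteq> 1" for z by (auto simp: contents_def)
    then show ?thesis unfolding truth_simps(2)[OF run] output_cell[OF run out] by (simp add: symbols_def)
  qed
  ultimately show "\<forall>cl \<in> set (tableau M T m x). holds ?\<sigma> cl"
    unfolding tableau_hold by blast
qed

text \<open>The conclusion is negative because \<sigma> may mark several symbols in one cell, so the
  output cannot be read off. A rejecting output, however, would force a variable that the last
  clauses forbid.\<close>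

lemma tableau_satisfiable_imp:
  assumes M: "turing_machine M" and sat: "satisfiable (tableau M T m x)"
  obtains u where "length u \<le> m" "\<not> outputs_within M (pair_symbols x u) T (symbols [False])"
proof -
  define c where "c = 2 * T + 1"
  let ?n = "length x"
  from sat obtain \<sigma> where "\<forall>cl \<in> set (tableau M T m x). holds \<sigma> cl"
    unfolding satisfiable_holds by blast
  then have start: "\<forall>cl \<in> set (start_clauses M (2 * c) c m x). holds \<sigma> cl"
    and steps: "\<And>t e cl. t < T \<Longrightarrow> e \<in> set (entries M) \<Longrightarrow> cl \<in> set (step_clauses M (2 * c) c t e) \<Longrightarrow> holds \<sigma> cl"
    and final: "\<And>j. j < 2 * c \<Longrightarrow> \<not> \<sigma> (cell_var T (num_tapes M - 1) j 1)"
    unfolding tableau_hold c_def by blast+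
  define v where "v l a = \<sigma> (cell_var 0 0 (c + ?n + 1 + l) a)" for l a
  from start have s0: "\<sigma> (state_var 0 0)"
    and other: "\<And>i j. i < num_tapes M - 1 \<Longrightarrow> j < 2 * c \<Longrightarrow> \<sigma> (cell_var 0 (Suc i) j 0)"
    and neg: "\<And>j. j < c \<Longrightarrow> \<sigma> (cell_var 0 0 j 0)"
    and inp: "\<And>l. l < ?n \<Longrightarrow> \<sigma> (cell_var 0 0 (c + l) (if x ! l then 2 else 1))"
    and sep: "\<sigma> (cell_var 0 0 (c + ?n) 3)"
    and guess: "\<And>l. l < m \<Longrightarrow> v l 1 \<or> v l 2 \<or> v l 0"
    and chain: "\<And>l. l < m \<Longrightarrow> v l 0 \<Longrightarrow> v (Suc l) 0"
    and rest: "\<And>l. l < 2 * c \<Longrightarrow> v (m + l) 0"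
    unfolding start_clauses_hold v_def by blast+
  \<comment> \<open>The certificate ends at the first cell marked blank; before it, a cell marked
    with both bits counts as \<open>True\<close>.\<close>
  define k where "k = (LEAST l. v l 0)"
  have "v m 0" using rest[of 0] by (simp add: c_def)
  then have k: "k \<le> m" "v k 0" "\<And>l. l < k \<Longrightarrow> \<not> v l 0"
    unfolding k_def by (auto intro: Least_le LeastI dest: not_less_Least)
  define u where "u = map (\<lambda>l. v l 2) [0..<k]"
  have blank: "v l 0" if "k \<le> l" "l < m + 2 * c" for l
  proof (cases "l \<le> m")
    case True
    with that(1) show ?thesis
      by (induction l rule: dec_induct) (use k(2) chain in auto)
  next
    case False
    then show ?thesis using rest[of "l - m"] that(2) by simp
  qed
  have v: "v l (if l < length u then if u ! l then 2 else 1 else 0)" if "l < m + 2 * c" for l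
    using guess[of l] k blank[of l] that by (auto simp: u_def)
  have "set (pair_symbols x u) \<subseteq> {..<4}"
    by (auto simp: pair_symbols_def symbols_def)
  note run = M this
  have inputs: "\<sigma> (cell_var 0 0 j (contents (pair_symbols x u) (int j - int c)))" if "j < 2 * c" for j
  proof -
    consider "j < c" | "c \<le> j" "j - c < ?n" | "j = c + ?n" | "c + ?n < j" by linarith
    then consider "j < c" | l where "j = c + l" "l < ?n" | "j = c + ?n" | l where "j = c + ?n + 1 + l"
    proof cases
      case 2
      then show ?thesis using that(2)[of "j - c"] by simp
    next
      case 4
      then show ?thesis using that(4)[of "j - (c + ?n + 1)"] by simp
    qed
    then show ?thesis
    proof cases
      case 1
      then show ?thesis using neg contents_pair(1)[of "int j - int c" x u] by simp
    next
      case (2 l)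
      then have "int j - int c = int l" by simp
      then show ?thesis using inp[of l] 2 contents_pair(2)[of l x u] by simp
    next
      case 3
      then have "int j - int c = int ?n" by simp
      then show ?thesis using sep 3 contents_pair(3)[of x u] by simp
    next
      case (4 l)
      then have e: "int j - int c = int (?n + 1 + l)" by simp
      show ?thesis using v[of l] that 4 unfolding e contents_pair(4) v_def by simp
    qed
  qed
  have cells: "\<sigma> (cell_var 0 i (nat (z + int c)) (cell M (pair_symbols x u) 0 i z))"
    if "i < num_tapes M" "\<bar>z\<bar> \<le> 2 * int T" for i z
  proof -
    have j: "nat (z + int c) < 2 * c" "int (nat (z + int c)) - int c = z" using that(2) by (auto simp: c_def)
    show ?thesis
    proof (cases i)
      case 0
      then show ?thesis using inputs[OF j(1)] by (simp only: initial_cell(1)[OF run] j(2))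
    next
      case (Suc i')
      then show ?thesis using other[OF _ j(1), of i'] initial_cell(2)[OF run, of i'] that(1) by simp
    qed
  qed
  have forced: "\<sigma> (state_var T (state M (pair_symbols x u) T)) \<and> (\<forall>i < num_tapes M. \<forall>z. \<bar>z\<bar> \<le> 2 * int T - int T \<longrightarrow>
      \<sigma> (cell_var T i (nat (z + int c)) (cell M (pair_symbols x u) T i z)))"
    by (rule forced[where \<sigma> = \<sigma> and c = c and T = T]) (fact run steps s0 c_def cells order_refl)+
  define h where "h = snd (snd (conf M (pair_symbols x u) T) ! (num_tapes M - 1))"
  have K: "num_tapes M - 1 < num_tapes M" using tapes_pos[OF run] by simp
  have h: "\<bar>h\<bar> \<le> int T" using run_invariant[OF run, of T] K by (simp add: h_def)
  have "\<not> outputs_within M (pair_symbols x u) T (symbols [False])"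
  proof
    assume "outputs_within M (pair_symbols x u) T (symbols [False])"
    \<comment> \<open>At distance \<open>- h\<close> from the head lies cell 0, which holds the
      first output symbol.\<close>
    from output_cell[OF run this, of "- h"] have "cell M (pair_symbols x u) T (num_tapes M - 1) (- h) = 1"
      by (simp add: h_def symbols_def contents_def)
    moreover have "\<sigma> (cell_var T (num_tapes M - 1) (nat (- h + int c)) (cell M (pair_symbols x u) T (num_tapes M - 1) (- h)))"
      by (rule forced[THEN conjunct2, rule_format]) (use K h in auto)
    moreover have "nat (- h + int c) < 2 * c"
      using h unfolding c_def by (subst nat_less_iff) auto
    ultimately show False using final by simp
  qed
  moreover have "length u \<le> m" using k(1) by (simp add: u_def)
  ultimately show ?thesis by (rule that[rotated])
qed

lemma tableau_satisfiable:
  assumes M: "turing_machine M"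
    and R: "\<And>u. length u \<le> m \<Longrightarrow> outputs_within M (pair_symbols x u) T (symbols [R u])"
  shows "satisfiable (tableau M T m x) \<longleftrightarrow> (\<exists>u. length u \<le> m \<and> R u)"
proof
  assume "satisfiable (tableau M T m x)"
  then obtain u where "length u \<le> m" "\<not> outputs_within M (pair_symbols x u) T (symbols [False])"
    using tableau_satisfiable_imp[OF M] by blast
  then show "\<exists>u. length u \<le> m \<and> R u" using R by (metis (full_types))
next
  assume "\<exists>u. length u \<le> m \<and> R u"
  then obtain u where u: "length u \<le> m" "R u" by blast
  then show "satisfiable (tableau M T m x)" using tableau_satisfiable_if[OF M u(1)] R[OF u(1)] by simp
qed

theorem problem_NP_hard: "NP_hard veto3_conformant_bribery_problem"
  unfolding NP_hard_def
proof
  fix A assume "A \<in> NP"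
  then obtain R q where R: "polytime_relation R" 
    and A: "\<And>x. x \<in> A \<longleftrightarrow> (\<exists>u. length u \<le> poly q (length x) \<and> R x u)"
    unfolding NP_def by blast
  from R obtain M p where M: "turing_machine M"
    "\<And>x u. outputs_within M (pair_symbols x u) (poly p (length x + length u)) (symbols [R x u])"
    unfolding polytime_relation_def by blast
  define f where "f x = reduction (tableau M (poly p (length x + poly q (length x))) (poly q (length x)) x)" for x
  have "x \<in> A \<longleftrightarrow> f x \<in> veto3_conformant_bribery_problem" for x
  proof -
    \<comment> \<open>The time bound for the longest certificates serves for all shorter ones, as
      halting configurations persist.\<close>
    have "outputs_within M (pair_symbols x u) (poly p (length x + poly q (length x))) (symbols [R x u])"
      if "length u \<le> poly q (length x)" for u
      using that by (intro outputs_within_mono[OF M(2)] poly_mono_nat) simp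
    from tableau_satisfiable[OF M(1) this] have "x \<in> A \<longleftrightarrow> 
        satisfiable (tableau M (poly p (length x + poly q (length x))) (poly q (length x)) x)"
      using A by simp
    then show ?thesis unfolding f_def using reduction_correct[OF tableau_nonempty] by simp
  qed
  moreover have "polytime_function f"
    unfolding f_def by (intro PT_polytime_function PT_reduction PT_tableau PT_intros)
  ultimately show "polytime_reducible A veto3_conformant_bribery_problem"
    unfolding polytime_reducible_def by blast
qed

theorem theorem8: "NP_complete veto3_conformant_bribery_problem"
  unfolding NP_complete_def using problem_in_NP problem_NP_hard by blast

end
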